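(* Let $n$ be a positive integer. The mixed Eulerian numbers $A_{c_1,\dots,c_n}$ have the following properties: (1) The numbers $A_{c_1,\dots,c_n}$ are positive integers defined for $c_1,\dots,c_n\ge0$, $c_1+\cdots+c_n=n$. (2) $A_{c_1,\dots,c_n}=A_{c_n,\dots,c_1}$. (3) For $1\le k\le n$, the number $A_{0^{k-1},n,0^{n-k}}$ is the usual Eulerian number $A(n,k)$. (4) $\sum\frac{1}{c_1!\cdots c_n!}A_{c_1,\dots,c_n}=(n+1)^{n-1}$, where the sum is over integers $c_1,\dots,c_n\ge0$ with $c_1+\cdots+c_n=n$. (5) $\sum A_{c_1,\dots,c_n}=n!\,C_n$, where the sum is over integers $c_1,\dots,c_n\ge0$ with $c_1+\cdots+c_n=n$ and $C_n=\frac{1}{n+1}\binom{2n}{n}$ is the Catalan number. (6) For $1\le k\le n-1$ and $i=0,\dots,n$, the number $A_{0^{k-1},n-i,i,0^{n-k-1}}$ equals the number of permutations $w\in S_{n+1}$ with $k$ descents and $w(n+1)=i+1$. (7) $A_{1,\dots,1}=n!$. (8) For $n\ge2$ and $0\le k\le n$, $A_{k,0,\dots,0,n-k}=\binom nk$. (9) $A_{c_1,\dots,c_n}=1^{c_1}2^{c_2}\cdots n^{c_n}$ if $c_1+\cdots+c_i\ge i$ for $i=1,\dots,n-1$ and $c_1+\cdots+c_n=n$. There are exactly $C_n$ such sequences $(c_1,\dots,c_n)$.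
   Context: For $1\le k\le n$, the hypersimplex $\Delta_{k,n+1}\subset\mathbb{R}^{n+1}$ is the convex hull of all $0/1$-vectors with exactly $k$ ones. For a polytope $P$ in a hyperplane $t_1+\cdots+t_{n+1}=c$ of $\mathbb{R}^{n+1}$, $\mathrm{Vol}\,P$ is the usual $n$-dimensional volume of the image of $P$ under the projection $(t_1,\dots,t_{n+1})\mapsto(t_1,\dots,t_n)$. For $u_1,\dots,u_n\ge0$ the volume of the Minkowski sum $u_1\Delta_{1,n+1}+\cdots+u_n\Delta_{n,n+1}$ (which, up to parallel translation, is the permutohedron $P_{n+1}(x_1,\dots,x_{n+1})=\mathrm{ConvexHull}((x_{w(1)},\dots,x_{w(n+1)})\mid w\in S_{n+1})$ with $u_i=x_i-x_{i+1}$) is a homogeneous polynomial of degree $n$ in $u_1,\dots,u_n$, and the mixed Eulerian numbers $A_{c_1,\dots,c_n}$ (for integers $c_1,\dots,c_n\ge0$ with $c_1+\cdots+c_n=n$) are defined by $$\mathrm{Vol}(u_1\Delta_{1,n+1}+\cdots+u_n\Delta_{n,n+1})=\sum_{c_1,\dots,c_n}A_{c_1,\dots,c_n}\frac{u_1^{c_1}}{c_1!}\cdots\frac{u_n^{c_n}}{c_n!}.$$ Equivalently, $A_{c_1,\dots,c_n}$ is $n!$ times the mixed volume of the hypersimplices in which $\Delta_{k,n+1}$ is repeated $c_k$ times. $0^l$ denotes a sequence of $l$ zeros. The Eulerian number $A(n,k)$ is the number of permutations in $S_n$ with exactly $k-1$ descents; a descent of a permutation $w$ is an index $i$ with $w(i)>w(i+1)$.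 *)

theory Defs
  imports
    "HOL-Analysis.Analysis"
    "HOL-Library.Function_Algebras"
    "HOL-Library.Set_Algebras"
    "HOL-Combinatorics.Permutations"
begin

text \<open>
  Since the dimension varies, a point \<open>(t\<^sub>1, \<dots>, t\<^sub>m)\<close> of \<open>m\<close>-dimensional space is a function
  \<open>nat \<Rightarrow> real\<close> that vanishes outside \<open>{1..m}\<close>.  The pointwise real vector space structure on
  functions makes the library's \<open>convex hull\<close> available for such points.
\<close>

instantiation "fun" :: (type, real_vector) real_vector
begin

definition scaleR_fun :: "real \<Rightarrow> ('a \<Rightarrow> 'b) \<Rightarrow> 'a \<Rightarrow> 'b" where
  "r *\<^sub>R f = (\<lambda>x. r *\<^sub>R f x)"

instance
  by standard (simp_all add: scaleR_fun_def fun_eq_iff scaleR_add_right scaleR_add_left)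

end

text \<open>The hypersimplex \<open>\<Delta>\<^bsub>k,m\<^esub>\<close>.\<close>

definition hypersimplex :: "nat \<Rightarrow> nat \<Rightarrow> (nat \<Rightarrow> real) set" where
  "hypersimplex k m =
     convex hull {v. (\<forall>i. v i \<in> {0, 1}) \<and> (\<forall>i. i \<notin> {1..m} \<longrightarrow> v i = 0) \<and> card {i. v i = 1} = k}"

text \<open>
  The volume of \<open>P\<close>, a polytope in a hyperplane \<open>t\<^sub>1 + \<dots> + t\<^bsub>n+1\<^esub> = c\<close>, is the \<open>n\<close>-dimensional
  Lebesgue measure of its projection to the first \<open>n\<close> coordinates.  Restriction puts the projected
  points into the space of the product measure, whose points are \<open>undefined\<close> outside \<open>{1..n}\<close>.
\<close>

definition hyperplane_volume :: "nat \<Rightarrow> (nat \<Rightarrow> real) set \<Rightarrow> real" where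
  "hyperplane_volume n P = measure (\<Pi>\<^sub>M i\<in>{1..n}. lborel) ((\<lambda>t. restrict t {1..n}) ` P)"

text \<open>The sum is the Minkowski sum of sets.\<close>

definition hypersimplex_sum :: "nat \<Rightarrow> (nat \<Rightarrow> real) \<Rightarrow> (nat \<Rightarrow> real) set" where
  "hypersimplex_sum n u = (\<Sum>k=1..n. (\<lambda>t. u k *\<^sub>R t) ` hypersimplex k (n + 1))"

text \<open>
  A sequence \<open>c\<^sub>1, \<dots>, c\<^sub>n\<close> is a list of length \<open>n\<close>, so \<open>c\<^sub>i\<close> is \<open>c ! (i - 1)\<close>.
\<close>

definition weak_compositions :: "nat \<Rightarrow> nat list set" where
  "weak_compositions n = {c. length c = n \<and> sum_list c = n}"

text \<open>
  \<open>A\<close> is the coefficient family of the volume polynomial; \<open>extensional\<close> fixes its values at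
  the irrelevant arguments, so that the family is unique.
\<close>

definition volume_expansion :: "nat \<Rightarrow> (nat list \<Rightarrow> real) \<Rightarrow> bool" where
  "volume_expansion n A \<longleftrightarrow>
     A \<in> extensional (weak_compositions n) \<and>
     (\<forall>u. (\<forall>k\<in>{1..n}. 0 \<le> u k) \<longrightarrow>
        hyperplane_volume n (hypersimplex_sum n u) =
        (\<Sum>c\<in>weak_compositions n.
           A c * (\<Prod>k=1..n. u k ^ (c ! (k - 1)) / fact (c ! (k - 1)))))"

definition mixed_eulerian :: "nat list \<Rightarrow> real" where
  "mixed_eulerian c = (THE A. volume_expansion (length c) A) c"

definition descents :: "nat \<Rightarrow> (nat \<Rightarrow> nat) \<Rightarrow> nat set" where
  "descents n w = {i\<in>{1..<n}. w i > w (i + 1)}"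

definition eulerian :: "nat \<Rightarrow> nat \<Rightarrow> nat" where
  "eulerian n k = card {w. w permutes {1..n} \<and> card (descents n w) + 1 = k}"

definition catalan :: "nat \<Rightarrow> real" where
  "catalan n = 1 / (real n + 1) * real ((2 * n) choose n)"

end

theory Submission
  imports Defs "HOL-Computational_Algebra.Polynomial"
begin

text \<open>
  Sort the coordinates of a point \<open>t\<close> of the permutohedron and pass to its partial sums \<open>s\<close>.  The
  permutohedron becomes \<open>(n + 1)!\<close> copies of the region of all concave sequences \<open>s\<close> that lie below
  the concave sequence \<open>h\<close> with second differences \<open>u\<close> and have the same ends.  Cut this region into
  cones over its faces \<open>s k = h k\<close>, with apex the linear sequence \<open>l\<close> between the two ends.  Such a face
  is a product of two smaller regions of the same kind.  So the volume divided by \<open>(n + 1)!\<close> is a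
  polynomial \<open>V\<close> with \<open>n V(u) = (\<Sum>k. (h k - l k) V\<^sub>k(u) V'\<^sub>k(u))\<close>, where \<open>h - l\<close> is the image of \<open>u\<close>
  under the inverse of the second difference operator, a discrete Green's function.

  The coefficient of \<open>V\<close> at \<open>c\<close> is the weight of the configuration with \<open>c j\<close> chips at the site \<open>j\<close>:
  remove a chip at \<open>j\<close>, and sum over the holes \<open>k\<close> that the other chips can leave behind the Green's
  function at \<open>(j, k)\<close> times the weights on both sides of \<open>k\<close>.  The chip that is removed may be chosen
  freely, as in the abelian property of sandpiles.  A suitable choice leaves one or two possible holes
  in each of the special cases of the theorem, and the refined Eulerian numbers satisfy the difference
  equation that results from the two choices for chips on two adjacent sites.  For the sums over all
  \<open>c\<close>, put the chips on a cycle of \<open>n + 1\<close> sites: the weights of the \<open>n + 1\<close> ways to cut the cycle add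
  up to a number that does not change when a chip is moved.
\<close>

section \<open>Weights of chip configurations\<close>

text \<open>The recursion for \<open>V\<close> only yields an average over all chips, while the
  special values need the finer statement that every single chip gives the whole coefficient. Its
  source is the derivative of \<open>V\<close>. Raising the bound \<open>h k\<close> sweeps out the
  face over \<open>k\<close>, and \<open>h k - l k\<close> depends on \<open>u j\<close> through the
  Green's function; so the derivative in direction \<open>u j\<close> is the sum over
  \<open>k\<close> of \<open>green a b j k\<close> times the face volumes. With divided powers as
  monomials, this derivative is the removal of a chip at \<open>j\<close>, and the freedom of choice
  is the symmetry of mixed partial derivatives. It is proved by pure algebra, because Green's
  functions of subintervals are Schur complements; no volume is differentiated. The factor
  \<open>(n + 1)!\<close> between weights and mixed Eulerian numbers also makes them integral: when
  the interval is split at \<open>k\<close>, it breaks up into the factorials of the two sides and a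
  binomial coefficient that clears the denominator of the Green's function.\<close>

text \<open>The Green's function of the second difference operator \<open>2 h j - h (j - 1) - h (j + 1)\<close> on the
  open interval \<open>{a<..<b}\<close> with boundary values 0, i.e. the inverse of the Cartan matrix.\<close>

definition green :: "nat \<Rightarrow> nat \<Rightarrow> nat \<Rightarrow> nat \<Rightarrow> real" where
  "green a b j k = (real (min j k) - real a) * (real b - real (max j k)) / (real b - real a)"

definition remove_chip :: "(nat \<Rightarrow> nat) \<Rightarrow> nat \<Rightarrow> nat \<Rightarrow> nat" where
  "remove_chip c j = c(j := c j - 1)"

text \<open>\<open>LEAST\<close> merely singles out one chip; \<open>chip_weight_remove_chip\<close>
  shows that every chip gives the same value. Chips outside the open interval are ignored, so the
  same \<open>c'\<close> serves both halves, and the test \<open>c' k = 0\<close> keeps chips from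
  getting lost at the cut.\<close>

function chip_weight :: "nat \<Rightarrow> nat \<Rightarrow> (nat \<Rightarrow> nat) \<Rightarrow> real" where
  "chip_weight a b c =
     (if \<exists>j\<in>{a<..<b}. 0 < c j then
        (let j = (LEAST j. j \<in> {a<..<b} \<and> 0 < c j); c' = remove_chip c j in
         (\<Sum>k\<in>{a<..<b}. if c' k = 0 then green a b j k * (chip_weight a k c' * chip_weight k b c') else 0))
      else if b = Suc a then 1 else 0)"
  by auto
termination
  by (relation "Wellfounded.measure (\<lambda>(a, b, c). b - a)") auto

declare chip_weight.simps [simp del]

lemma chip_weight_no_chips:
  assumes "\<And>j. j \<in> {a<..<b} \<Longrightarrow> c j = 0"
  shows "chip_weight a b c = (if b = Suc a then 1 else 0)"
  using assms by (subst chip_weight.simps) auto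

lemma chip_weight_Suc [simp]: "chip_weight a (Suc a) c = 1"
  by (subst chip_weight.simps) auto

lemma chip_weight_cong:
  assumes "\<And>j. j \<in> {a<..<b} \<Longrightarrow> c j = d j"
  shows "chip_weight a b c = chip_weight a b d"
  using assms
proof (induction a b c arbitrary: d rule: chip_weight.induct)
  case (1 a b c)
  show ?case
  proof (cases "\<exists>j\<in>{a<..<b}. 0 < c j")
    case False
    then have "\<And>j. j \<in> {a<..<b} \<Longrightarrow> c j = 0" "\<And>j. j \<in> {a<..<b} \<Longrightarrow> d j = 0"
      using 1(3) by auto
    then show ?thesis by (simp only: chip_weight_no_chips)
  next
    case True
    define j where "j = (LEAST j. j \<in> {a<..<b} \<and> 0 < c j)"
    have P: "(\<lambda>j. j \<in> {a<..<b} \<and> 0 < d j) = (\<lambda>j. j \<in> {a<..<b} \<and> 0 < c j)"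
      using 1(3) by (auto simp: fun_eq_iff)
    have dj: "j = (LEAST j. j \<in> {a<..<b} \<and> 0 < d j)" by (simp only: P j_def)
    have T2: "\<exists>j\<in>{a<..<b}. 0 < d j" using True 1(3) by auto
    have jin: "j \<in> {a<..<b}" unfolding j_def using LeastI_ex[of "\<lambda>j. j \<in> {a<..<b} \<and> 0 < c j"] True by blast
    have eq: "remove_chip c j k = remove_chip d j k" if "k \<in> {a<..<b}" for k
      using that 1(3)[OF that] by (auto simp: remove_chip_def)
    have c: "chip_weight a b c = (\<Sum>k\<in>{a<..<b}. if remove_chip c j k = 0 then
        green a b j k * (chip_weight a k (remove_chip c j) * chip_weight k b (remove_chip c j)) else 0)"
      unfolding j_def using True by (subst chip_weight.simps) (simp only: Let_def if_True)
    have d: "chip_weight a b d = (\<Sum>k\<in>{a<..<b}. if remove_chip d j k = 0 then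
        green a b j k * (chip_weight a k (remove_chip d j) * chip_weight k b (remove_chip d j)) else 0)"
      unfolding dj using T2 by (subst chip_weight.simps) (simp only: Let_def if_True)
    show ?thesis unfolding c d
    proof (rule sum.cong[OF refl])
      fix k assume k: "k \<in> {a<..<b}"
      show "(if remove_chip c j k = 0 then green a b j k * (chip_weight a k (remove_chip c j) * chip_weight k b (remove_chip c j)) else 0) =
         (if remove_chip d j k = 0 then green a b j k * (chip_weight a k (remove_chip d j) * chip_weight k b (remove_chip d j)) else 0)"
      proof (cases "remove_chip c j k = 0")
        case z: True
        have "chip_weight a k (remove_chip c j) = chip_weight a k (remove_chip d j)"
          by (rule 1(1)[OF True j_def refl k z]) (use k eq in auto)
        moreover have "chip_weight k b (remove_chip c j) = chip_weight k b (remove_chip d j)"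
          by (rule 1(2)[OF True j_def refl k z]) (use k eq in auto)
        ultimately show ?thesis using eq[OF k] by simp
      qed (use eq[OF k] in simp)
    qed
  qed
qed

text \<open>Restricting the interval to one side of \<open>k\<close> takes the Schur complement of the Green's function
  at \<open>k\<close>.  With the value 0 for sources outside the interval, this holds for all sources.\<close>

definition green0 :: "nat \<Rightarrow> nat \<Rightarrow> nat \<Rightarrow> nat \<Rightarrow> real" where
  "green0 a b j k = (if j \<in> {a<..<b} then green a b j k else 0)"

text \<open>For \<open>k \<le> j\<close> both sides vanish, since there the Green's function factors
  through \<open>k\<close>: \<open>green a b j l * green a b k k = green a b j k * green a b k
  l\<close>. Covering these sources as well spares a case distinction in
  \<open>green_swap_sources\<close>.\<close>

lemma green0_left:
  assumes "a < l" "l < k" "k < b" "j \<in> {a<..<b}"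
  shows "green0 a k j l = green a b j l - green a b j k * green a b k l / green a b k k"
proof -
  have nz: "real b - real a \<noteq> 0" "real k - real a \<noteq> 0" "real b - real k \<noteq> 0" using assms by auto
  consider "j \<le> l" | "l < j" "j < k" | "k \<le> j" by linarith
  then show ?thesis
    using assms nz by cases (auto simp: green0_def green_def min_def max_def divide_simps, (simp add: algebra_simps)+)
qed

lemma green0_right:
  assumes "a < l" "l < k" "k < b" "j \<in> {a<..<b}"
  shows "green0 l b j k = green a b j k - green a b j l * green a b l k / green a b l l"
proof -
  have nz: "real b - real a \<noteq> 0" "real l - real a \<noteq> 0" "real b - real l \<noteq> 0" using assms by auto
  consider "j \<le> l" | "l < j" "j < k" | "k \<le> j" by linarith
  then show ?thesis
    using assms nz by cases (auto simp: green0_def green_def min_def max_def divide_simps, (simp add: algebra_simps)+)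
qed

text \<open>Once the Schur complements are inserted, each product is either symmetric in
  \<open>i\<close> and \<open>j\<close> or exchanged with a partner. The two summands are the two
  orders in which the holes \<open>l\<close> and \<open>k\<close> can be made.\<close>

lemma green_swap_sources:
  assumes "a < l" "l < k" "k < b" "i \<in> {a<..<b}" "j \<in> {a<..<b}"
  shows "green a b j k * green0 a k i l + green a b j l * green0 l b i k =
         green a b i k * green0 a k j l + green a b i l * green0 l b j k"
  unfolding green0_left[OF assms(1-3,4)] green0_left[OF assms(1-3,5)]
     green0_right[OF assms(1-3,4)] green0_right[OF assms(1-3,5)]
  by (simp add: algebra_simps)

lemma sum_split_open:
  fixes f :: "nat \<Rightarrow> 'a::comm_monoid_add"
  assumes "a < k" "k < b"
  shows "sum f {a<..<b} = sum f {a<..<k} + f k + sum f {k<..<b}"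
proof -
  have "{a<..<b} = insert k ({a<..<k} \<union> {k<..<b})" using assms by auto
  then have "sum f {a<..<b} = f k + sum f ({a<..<k} \<union> {k<..<b})"
    by (simp only:) (subst sum.insert; auto)
  also have "sum f ({a<..<k} \<union> {k<..<b}) = sum f {a<..<k} + sum f {k<..<b}"
    by (rule sum.union_disjoint) auto
  finally show ?thesis by (simp add: ac_simps)
qed

lemma sum_triangle_swap:
  fixes f :: "nat \<Rightarrow> nat \<Rightarrow> 'a::comm_monoid_add"
  shows "(\<Sum>k\<in>{a<..<b}. \<Sum>l\<in>{k<..<b}. f k l) = (\<Sum>k\<in>{a<..<b}. \<Sum>l\<in>{a<..<k}. f l k)"
proof -
  have "(\<Sum>k\<in>{a<..<b}. \<Sum>l\<in>{k<..<b}. f k l) = (\<Sum>k\<in>{a<..<b}. \<Sum>l\<in>{l\<in>{a<..<b}. k < l}. f k l)"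
    by (rule sum.cong[OF refl], rule sum.cong) auto
  also have "\<dots> = (\<Sum>l\<in>{a<..<b}. \<Sum>k\<in>{k\<in>{a<..<b}. k < l}. f k l)"
    by (rule sum.swap_restrict) auto
  also have "\<dots> = (\<Sum>k\<in>{a<..<b}. \<Sum>l\<in>{a<..<k}. f l k)"
    by (rule sum.cong[OF refl], rule sum.cong) auto
  finally show ?thesis .
qed

lemma remove_chip_commute: "remove_chip (remove_chip c i) j = remove_chip (remove_chip c j) i"
  by (auto simp: remove_chip_def fun_eq_iff)

lemma chip_weight_least:
  assumes "\<exists>j\<in>{a<..<b}. 0 < c j"
  defines "j \<equiv> LEAST j. j \<in> {a<..<b} \<and> 0 < c j"
  shows "chip_weight a b c = (\<Sum>k\<in>{a<..<b}. if remove_chip c j k = 0 then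
        green a b j k * (chip_weight a k (remove_chip c j) * chip_weight k b (remove_chip c j)) else 0)"
  unfolding j_def using assms(1) by (subst chip_weight.simps) (simp only: Let_def if_True)

text \<open>Remove \<open>j\<close> and another chip \<open>i\<close>, leaving the holes
  \<open>l < k\<close>. Either hole may belong to \<open>j\<close>, and the total coefficient is
  symmetric in the two chips. It suffices to compare \<open>j\<close> with the least chip; the
  induction on the length allows \<open>i\<close> to be removed next in whichever half contains
  it.\<close>

lemma chip_weight_remove_chip:
  assumes "j \<in> {a<..<b}" "0 < c j"
  shows "chip_weight a b c = (\<Sum>k\<in>{a<..<b}. if remove_chip c j k = 0 then
        green a b j k * (chip_weight a k (remove_chip c j) * chip_weight k b (remove_chip c j)) else 0)"
  using assms
proof (induction "b - a" arbitrary: a b c j rule: less_induct)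
  case less
  define E where "E = (\<lambda>j. \<Sum>k\<in>{a<..<b}. if remove_chip c j k = 0 then
        green a b j k * (chip_weight a k (remove_chip c j) * chip_weight k b (remove_chip c j)) else 0)"
  \<comment> \<open>In the first summand \<open>j\<close> makes the hole \<open>k\<close> and then
    \<open>i\<close> makes \<open>l\<close>; in the second the holes are exchanged.
    \<open>green0\<close> discards the case in which \<open>i\<close> lies in the wrong
    half.\<close>
  have main: "E j = (\<Sum>k\<in>{a<..<b}. \<Sum>l\<in>{a<..<k}. if d k = 0 \<and> d l = 0 then
       (green a b j k * green0 a k i l + green a b j l * green0 l b i k) *
       (chip_weight a l d * chip_weight l k d * chip_weight k b d) else 0)"
    if ij: "i \<noteq> j" "i \<in> {a<..<b}" "j \<in> {a<..<b}" "0 < c i" "0 < c j"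
      and d: "d = remove_chip (remove_chip c j) i" for i j d
  proof -
    let ?c = "remove_chip c j"
    let ?T = "\<lambda>l k. chip_weight a l d * chip_weight l k d * chip_weight k b d"
    have ci: "0 < ?c i" using ij by (auto simp: remove_chip_def)
    have dc: "d x = ?c x" if "x \<noteq> i" for x using that by (auto simp: d remove_chip_def)
    have step: "(if ?c k = 0 then green a b j k * (chip_weight a k ?c * chip_weight k b ?c) else 0) =
       (\<Sum>l\<in>{a<..<k}. if d k = 0 \<and> d l = 0 then green a b j k * green0 a k i l * ?T l k else 0) +
       (\<Sum>l\<in>{k<..<b}. if d k = 0 \<and> d l = 0 then green a b j k * green0 k b i l * ?T k l else 0)"
      if k: "k \<in> {a<..<b}" for k
    proof -
      consider "i = k" | "i < k" | "k < i" by linarith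
      then show ?thesis
      proof cases
        \<comment> \<open>No hole can be made where the chip \<open>i\<close> still lies, and
          \<open>green0\<close> vanishes for a source at the end of either half.\<close>
        case 1
        have z: "green0 a k k l = 0" "green0 k b k l = 0" for l by (simp_all add: green0_def)
        show ?thesis using ci by (simp add: 1 z cong: if_cong)
      next
        case 2
        have dk: "d k = ?c k" using 2 by (intro dc) auto
        have r: "chip_weight k b ?c = chip_weight k b d"
          by (rule chip_weight_cong) (use 2 in \<open>auto simp: dc\<close>)
        have "chip_weight a k ?c = (\<Sum>l\<in>{a<..<k}. if d l = 0 then
            green a k i l * (chip_weight a l d * chip_weight l k d) else 0)"
          unfolding d by (rule less.hyps) (use k 2 ij ci in auto)
        moreover have "green0 a k i l = green a k i l" "green0 k b i l = 0" for l
          using 2 ij by (simp_all add: green0_def)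
        ultimately have z: "(if ?c k = 0 then green a b j k * (chip_weight a k ?c * chip_weight k b ?c) else 0) =
            (\<Sum>l\<in>{a<..<k}. if d k = 0 \<and> d l = 0 then green a b j k * green0 a k i l * ?T l k else 0)"
            "(\<Sum>l\<in>{k<..<b}. if d k = 0 \<and> d l = 0 then green a b j k * green0 k b i l * ?T k l else 0) = 0"
          unfolding dk r sum_distrib_left sum_distrib_right
          by - (cases "?c k = 0", (simp only: if_True simp_thms sum_distrib_left sum_distrib_right,
             intro sum.cong refl, simp), simp, simp cong: if_cong)
        show ?thesis unfolding z by simp
      next
        case 3
        have dk: "d k = ?c k" using 3 by (intro dc) auto
        have r: "chip_weight a k ?c = chip_weight a k d"
          by (rule chip_weight_cong) (use 3 in \<open>auto simp: dc\<close>)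
        have "chip_weight k b ?c = (\<Sum>l\<in>{k<..<b}. if d l = 0 then
            green k b i l * (chip_weight k l d * chip_weight l b d) else 0)"
          unfolding d by (rule less.hyps) (use k 3 ij ci in auto)
        moreover have "green0 k b i l = green k b i l" "green0 a k i l = 0" for l
          using 3 ij by (simp_all add: green0_def)
        ultimately have z: "(if ?c k = 0 then green a b j k * (chip_weight a k ?c * chip_weight k b ?c) else 0) =
            (\<Sum>l\<in>{k<..<b}. if d k = 0 \<and> d l = 0 then green a b j k * green0 k b i l * ?T k l else 0)"
            "(\<Sum>l\<in>{a<..<k}. if d k = 0 \<and> d l = 0 then green a b j k * green0 a k i l * ?T l k else 0) = 0"
          unfolding dk r sum_distrib_left sum_distrib_right
          by - (cases "?c k = 0", (simp only: if_True simp_thms sum_distrib_left sum_distrib_right,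
             intro sum.cong refl, simp), simp, simp cong: if_cong)
        show ?thesis unfolding z by simp
      qed
    qed
    have "E j = (\<Sum>k\<in>{a<..<b}. \<Sum>l\<in>{a<..<k}. if d k = 0 \<and> d l = 0 then green a b j k * green0 a k i l * ?T l k else 0) +
      (\<Sum>k\<in>{a<..<b}. \<Sum>l\<in>{k<..<b}. if d k = 0 \<and> d l = 0 then green a b j k * green0 k b i l * ?T k l else 0)"
      unfolding E_def using step by (simp add: sum.distrib)
    also have "\<dots> = (\<Sum>k\<in>{a<..<b}. \<Sum>l\<in>{a<..<k}. if d k = 0 \<and> d l = 0 then green a b j k * green0 a k i l * ?T l k else 0) +
      (\<Sum>k\<in>{a<..<b}. \<Sum>l\<in>{a<..<k}. if d l = 0 \<and> d k = 0 then green a b j l * green0 l b i k * ?T l k else 0)"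
      by (simp only: sum_triangle_swap)
    also have "\<dots> = (\<Sum>k\<in>{a<..<b}. \<Sum>l\<in>{a<..<k}. if d k = 0 \<and> d l = 0 then
       (green a b j k * green0 a k i l + green a b j l * green0 l b i k) * ?T l k else 0)"
      unfolding sum.distrib[symmetric] by (intro sum.cong refl) (auto simp: algebra_simps)
    finally show ?thesis .
  qed
  define i where "i = (LEAST j. j \<in> {a<..<b} \<and> 0 < c j)"
  have ex: "\<exists>j\<in>{a<..<b}. 0 < c j" using less.prems by auto
  have i: "i \<in> {a<..<b}" "0 < c i"
    unfolding i_def using LeastI_ex[of "\<lambda>j. j \<in> {a<..<b} \<and> 0 < c j"] ex by blast+
  have "chip_weight a b c = E i" unfolding E_def i_def by (rule chip_weight_least[OF ex])
  also have "E i = E j"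
  proof (cases "i = j")
    case False
    show ?thesis
      unfolding main[OF False i(1) less.prems(1) i(2) less.prems(2) refl]
        main[OF False[symmetric] less.prems(1) i(1) less.prems(2) i(2) remove_chip_commute]
      by (intro sum.cong refl if_cong arg_cong2[where f="(*)"] green_swap_sources)
        (use i less.prems in auto)
  qed simp
  finally show ?case unfolding E_def .
qed

lemma sum_remove_chip:
  assumes "finite S" "j \<in> S" "0 < c j"
  shows "sum c S = Suc (sum (remove_chip c j) S)"
  using assms by (simp add: sum.remove[of S j] remove_chip_def)

text \<open>Each removed chip is matched with one hole, and an emptied interval must have no
  interior site left. Hence a nonzero term determines how many chips lie to the left of its hole;
  later arguments locate holes by this count.\<close>

lemma chip_weight_nonzero:
  assumes "chip_weight a b c \<noteq> 0"
  shows "Suc (a + sum c {a<..<b}) = b"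
  using assms
proof (induction a b c rule: chip_weight.induct)
  case (1 a b c)
  show ?case
  proof (cases "\<exists>j\<in>{a<..<b}. 0 < c j")
    case False
    then have "\<And>j. j \<in> {a<..<b} \<Longrightarrow> c j = 0" by auto
    then show ?thesis using 1(3) chip_weight_no_chips[of a b c] by (auto split: if_splits)
  next
    case True
    define j where "j = (LEAST j. j \<in> {a<..<b} \<and> 0 < c j)"
    have j: "j \<in> {a<..<b}" "0 < c j"
      unfolding j_def using LeastI_ex[of "\<lambda>j. j \<in> {a<..<b} \<and> 0 < c j"] True by blast+
    obtain k where k: "k \<in> {a<..<b}" "remove_chip c j k = 0" "chip_weight a k (remove_chip c j) \<noteq> 0"
        "chip_weight k b (remove_chip c j) \<noteq> 0"
    proof -
      obtain k where "k \<in> {a<..<b}" "(if remove_chip c j k = 0 then green a b j k *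
          (chip_weight a k (remove_chip c j) * chip_weight k b (remove_chip c j)) else 0) \<noteq> 0"
        using 1(3) unfolding chip_weight_remove_chip[of j a b c, OF j]
        by (rule sum.not_neutral_contains_not_neutral)
      then show thesis by (intro that[of k]) (simp_all split: if_splits)
    qed
    show ?thesis
      using 1(1)[OF True j_def refl k(1,2,3)] 1(2)[OF True j_def refl k(1,2,4)] k(1,2)
        sum_remove_chip[of "{a<..<b}" j c] j sum_split_open[of a k b "remove_chip c j"]
      by auto
  qed
qed

text \<open>In contrast to the rule generated by the definition, the hypotheses cover all
  configurations on the two sides, so the chip to be removed can be chosen freely.\<close>

lemma chip_weight_induct [case_names no_chips chip]:
  fixes P :: "nat \<Rightarrow> nat \<Rightarrow> (nat \<Rightarrow> nat) \<Rightarrow> bool"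
  assumes "\<And>a b c. (\<And>j. j \<in> {a<..<b} \<Longrightarrow> c j = 0) \<Longrightarrow> P a b c"
    and "\<And>a b c j. j \<in> {a<..<b} \<Longrightarrow> 0 < c j \<Longrightarrow> (\<And>k d. k \<in> {a<..<b} \<Longrightarrow> P a k d) \<Longrightarrow>
           (\<And>k d. k \<in> {a<..<b} \<Longrightarrow> P k b d) \<Longrightarrow> P a b c"
  shows "P a b c"
proof -
  have "P a b c" if "b - a = n" for n a b c
    using that
  proof (induction n arbitrary: a b c rule: less_induct)
    case (less n a b c)
    show ?case
    proof (cases "\<exists>j\<in>{a<..<b}. 0 < c j")
      case True
      then obtain j where j: "j \<in> {a<..<b}" "0 < c j" by blast
      show ?thesis
      proof (rule assms(2)[of j a b c, OF j])
        fix k d assume k: "k \<in> {a<..<b}"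
        show "P a k d" by (rule less.IH[OF _ refl]) (use k less.prems in auto)
        show "P k b d" by (rule less.IH[OF _ refl]) (use k less.prems in auto)
      qed
    next
      case False
      then show ?thesis by (intro assms(1)) auto
    qed
  qed
  then show ?thesis by blast
qed

section \<open>Translations and reflections of the interval\<close>

lemma green_shift: "green (a + t) (b + t) (j + t) (k + t) = green a b j k"
  by (simp add: green_def min_def max_def)

lemma chip_weight_shift_aux:
  assumes "\<And>i. i \<in> {a<..<b} \<Longrightarrow> d (i + t) = c i"
  shows "chip_weight (a + t) (b + t) d = chip_weight a b c"
  using assms
proof (induction a b c arbitrary: d rule: chip_weight_induct)
  case (no_chips a b c)
  have "d i = 0" if "i \<in> {a + t<..<b + t}" for i
  proof -
    have "i - t \<in> {a<..<b}" "i - t + t = i" using that by auto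
    then show ?thesis using no_chips by metis
  qed
  then have "chip_weight (a + t) (b + t) d = (if b + t = Suc (a + t) then 1 else 0)"
    by (rule chip_weight_no_chips)
  moreover have "chip_weight a b c = (if b = Suc a then 1 else 0)"
    by (rule chip_weight_no_chips) (rule no_chips)
  ultimately show ?case by simp
next
  case (chip a b c j)
  have j: "j + t \<in> {a + t<..<b + t}" "0 < d (j + t)" using chip by auto
  have img: "{a + t<..<b + t} = (\<lambda>k. k + t) ` {a<..<b}"
  proof (intro equalityI subsetI)
    fix x assume "x \<in> {a + t<..<b + t}"
    then show "x \<in> (\<lambda>k. k + t) ` {a<..<b}" by (intro image_eqI[of _ _ "x - t"]) auto
  qed auto
  have r: "remove_chip d (j + t) (i + t) = remove_chip c j i" if "i \<in> {a<..<b}" for i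
    using chip.prems[OF that] by (auto simp: remove_chip_def)
  show ?case
    unfolding chip_weight_remove_chip[of "j + t" _ _ d, OF j] chip_weight_remove_chip[of j _ _ c, OF chip(1,2)] img
  proof (subst sum.reindex, simp, rule sum.cong[OF refl], goal_cases)
    case (1 k)
    have "chip_weight (a + t) (k + t) (remove_chip d (j + t)) = chip_weight a k (remove_chip c j)"
      by (rule chip(3)) (use 1 r in auto)
    moreover have "chip_weight (k + t) (b + t) (remove_chip d (j + t)) = chip_weight k b (remove_chip c j)"
      by (rule chip(4)) (use 1 r in auto)
    ultimately show ?case using r[OF 1] by (simp add: green_shift)
  qed
qed

lemma chip_weight_shift: "chip_weight (a + t) (b + t) c = chip_weight a b (\<lambda>i. c (i + t))"
  by (rule chip_weight_shift_aux) simp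

lemma green_reflect:
  assumes "a \<le> N" "b \<le> N" "j \<le> N" "k \<le> N"
  shows "green (N - b) (N - a) (N - j) (N - k) = green a b j k"
proof -
  have "real (N - a) = real N - real a" "real (N - b) = real N - real b"
    "real (min (N - j) (N - k)) = real N - real (max j k)" "real (max (N - j) (N - k)) = real N - real (min j k)"
    using assms by (auto simp: of_nat_diff min_def max_def)
  moreover have "real (N - min j k) = real N - real (min j k)" "real (N - max j k) = real N - real (max j k)"
    using assms by auto
  ultimately show ?thesis by (simp only: green_def) (simp add: mult.commute)
qed

lemma chip_weight_reflect_aux:
  assumes "a \<le> N" "b \<le> N" "\<And>i. i \<in> {a<..<b} \<Longrightarrow> d (N - i) = c i"
  shows "chip_weight (N - b) (N - a) d = chip_weight a b c"
  using assms
proof (induction a b c arbitrary: d rule: chip_weight_induct)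
  case (no_chips a b c)
  have "d i = 0" if "i \<in> {N - b<..<N - a}" for i
  proof -
    have "N - i \<in> {a<..<b}" "N - (N - i) = i" using that no_chips by auto
    then show ?thesis using no_chips by metis
  qed
  then have "chip_weight (N - b) (N - a) d = (if N - a = Suc (N - b) then 1 else 0)"
    by (rule chip_weight_no_chips)
  moreover have "chip_weight a b c = (if b = Suc a then 1 else 0)"
    by (rule chip_weight_no_chips) (rule no_chips)
  moreover have "N - a = Suc (N - b) \<longleftrightarrow> b = Suc a" using no_chips by auto
  ultimately show ?case by simp
next
  case (chip a b c j)
  have j: "N - j \<in> {N - b<..<N - a}" "0 < d (N - j)" using chip by auto
  have r: "remove_chip d (N - j) (N - i) = remove_chip c j i" if "i \<in> {a<..<b}" for i
    using chip.prems(3)[OF that] that chip by (auto simp: remove_chip_def)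
  show ?case
    unfolding chip_weight_remove_chip[of "N - j" _ _ d, OF j] chip_weight_remove_chip[of j _ _ c, OF chip(1,2)]
  proof (rule sum.reindex_bij_witness[of _ "\<lambda>k. N - k" "\<lambda>k. N - k"], goal_cases)
    case (5 k)
    define l where "l = N - k"
    have l: "l \<in> {a<..<b}" and k: "k = N - l" using 5 unfolding l_def by auto
    have "chip_weight (N - l) (N - a) (remove_chip d (N - j)) = chip_weight a l (remove_chip c j)"
      by (rule chip(3)) (use l r chip.prems in auto)
    moreover have "chip_weight (N - b) (N - l) (remove_chip d (N - j)) = chip_weight l b (remove_chip c j)"
      by (rule chip(4)) (use l r chip.prems in auto)
    moreover have "green (N - b) (N - a) (N - j) (N - l) = green a b j l"
      by (rule green_reflect) (use l chip in auto)
    moreover have "N - (N - l) = l" using l chip.prems by auto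
    ultimately show ?case using r[OF l] unfolding k by (simp add: mult.commute)
  qed (use chip.prems in auto)
qed

lemma chip_weight_reflect:
  assumes "a \<le> N" "b \<le> N"
  shows "chip_weight (N - b) (N - a) (\<lambda>i. c (N - i)) = chip_weight a b c"
  by (rule chip_weight_reflect_aux) (use assms in auto)

section \<open>Positivity and integrality\<close>

lemma green_pos:
  assumes "j \<in> {a<..<b}" "k \<in> {a<..<b}"
  shows "0 < green a b j k"
  using assms by (auto simp: green_def min_def max_def)

lemma chip_weight_nonneg: "0 \<le> chip_weight a b c"
proof (induction a b c rule: chip_weight_induct)
  case (chip a b c j)
  then show ?case
    unfolding chip_weight_remove_chip[of j _ _ c, OF chip(1,2)]
    by (intro sum_nonneg) (auto intro!: mult_nonneg_nonneg less_imp_le[OF green_pos])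
next
  case (no_chips a b c)
  show ?case by (subst chip_weight_no_chips) (use no_chips in auto)
qed

text \<open>The hole is the first site at which the partial sums of \<open>f\<close> fall behind.\<close>

lemma first_gap:
  fixes f :: "nat \<Rightarrow> nat"
  assumes "Suc (a + sum f {a<..<b}) < b"
  obtains k where "k \<in> {a<..<b}" "f k = 0" "Suc (a + sum f {a<..<k}) = k"
proof -
  define Q where "Q = (\<lambda>k. a < k \<and> a + sum f {a<..<Suc k} < k)"
  have Qb: "Q (b - 1)" using assms by (auto simp: Q_def)
  define k where "k = (LEAST k. Q k)"
  have Qk: "Q k" unfolding k_def by (rule LeastI[of Q, OF Qb])
  have kb: "k \<le> b - 1" unfolding k_def by (rule Least_le[of Q, OF Qb])
  have "\<not> Q (k - 1)" using not_less_Least[of "k - 1" Q] Qk unfolding k_def[symmetric] by (auto simp: Q_def)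
  then have 1: "k - 1 \<le> a + sum f {a<..<k}" using Qk by (auto simp: Q_def)
  have "{a<..<Suc k} = insert k {a<..<k}" using Qk by (auto simp: Q_def)
  then have "sum f {a<..<Suc k} = f k + sum f {a<..<k}" by simp
  then show ?thesis using 1 Qk kb assms by (intro that[of k]) (auto simp: Q_def)
qed

text \<open>All terms are nonnegative, so one admissible hole suffices. After a removal there is one
  chip too few, and \<open>first_gap\<close> finds an empty site with exactly the right number of
  chips on its left; the count on its right is then right too.\<close>

lemma chip_weight_pos:
  assumes "Suc (a + sum c {a<..<b}) = b"
  shows "0 < chip_weight a b c"
  using assms
proof (induction a b c rule: chip_weight_induct)
  case (no_chips a b c)
  then have "b = Suc a" by auto
  then show ?case by simp
next
  case (chip a b c j)
  let ?c = "remove_chip c j"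
  have s: "sum c {a<..<b} = Suc (sum ?c {a<..<b})" by (rule sum_remove_chip) (use chip in auto)
  then obtain k where k: "k \<in> {a<..<b}" "?c k = 0" "Suc (a + sum ?c {a<..<k}) = k"
    using chip.prems by (elim first_gap[of a ?c b, rotated]) auto
  have k2: "Suc (k + sum ?c {k<..<b}) = b"
    using sum_split_open[of a k b ?c] k s chip.prems by auto
  have p: "0 < green a b j k * (chip_weight a k ?c * chip_weight k b ?c)"
    using chip(3)[OF k(1) k(3)] chip(4)[OF k(1) k2] green_pos[OF chip(1) k(1)] by simp
  show ?case
    unfolding chip_weight_remove_chip[of j _ _ c, OF chip(1,2)]
    by (rule sum_pos2[OF _ k(1)]) (use p k in \<open>auto intro!: mult_nonneg_nonneg less_imp_le[OF green_pos]
        chip_weight_nonneg chip(1)\<close>)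
qed

text \<open>The binomial coefficient absorbs the denominator \<open>b - a\<close>, since both
  \<open>(N - K) * (N choose K)\<close> and \<open>K * (N choose K)\<close> are multiples of
  \<open>N\<close>. Which of them is needed depends on the side of \<open>k\<close> on which
  \<open>j\<close> lies.\<close>

lemma binomial_green_Ints:
  assumes "j \<in> {a<..<b}" "k \<in> {a<..<b}"
  shows "real ((b - a) choose (k - a)) * green a b j k \<in> \<int>"
proof -
  define N K where "N = b - a" and "K = k - a"
  have NK: "K < N" "0 < K" "real b - real a = real N" "real k = real K + real a" "real b = real N + real a"
    using assms by (auto simp: N_def K_def)
  have e1: "real (N choose K) * (real N - real K) = real N * real ((N - 1) choose K)"
  proof -
    have "(N - K) * (N choose K) = N * ((N - 1) choose K)" by (rule binomial_absorb_comp)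
    then have "real ((N - K) * (N choose K)) = real (N * ((N - 1) choose K))" by simp
    then show ?thesis using NK by (simp add: of_nat_diff mult.commute)
  qed
  have e2: "real (N choose K) * real K = real N * real ((N - 1) choose (K - 1))"
  proof -
    have "K * (N choose K) = N * ((N - 1) choose (K - 1))" by (rule times_binomial_minus1_eq) (use NK in auto)
    then have "real (K * (N choose K)) = real (N * ((N - 1) choose (K - 1)))" by simp
    then show ?thesis by (simp add: mult.commute)
  qed
  show ?thesis
  proof (cases "j \<le> k")
    case True
    have "real (N choose K) * green a b j k = (real j - real a) * (real (N choose K) * (real N - real K)) / real N"
      using True NK by (simp add: green_def min_def max_def)
    also have "\<dots> = (real j - real a) * real ((N - 1) choose K)" unfolding e1 using NK by simp
    finally show ?thesis unfolding N_def K_def by simp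
  next
    case False
    have "real (N choose K) * green a b j k = (real b - real j) * (real (N choose K) * real K) / real N"
      using False NK by (simp add: green_def min_def max_def)
    also have "\<dots> = (real b - real j) * real ((N - 1) choose (K - 1))" unfolding e2 using NK by simp
    finally show ?thesis unfolding N_def K_def by simp
  qed
qed

text \<open>The factorial splits into those of the two sides of the hole, which the induction uses,
  and a binomial coefficient, which makes the Green's function integral.\<close>

lemma fact_chip_weight_Ints: "fact (b - a) * chip_weight a b c \<in> \<int>"
proof (induction a b c rule: chip_weight_induct)
  case (chip a b c j)
  let ?c = "remove_chip c j"
  show ?case
    unfolding chip_weight_remove_chip[of j _ _ c, OF chip(1,2)] sum_distrib_left
  proof (rule Ints_sum)
    fix k assume k: "k \<in> {a<..<b}"
    have b: "(fact (b - a) :: real) = fact (k - a) * fact (b - k) * real ((b - a) choose (k - a))"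
    proof -
      have "b - a - (k - a) = b - k" "k - a \<le> b - a" using k by auto
      then have "real ((b - a) choose (k - a)) = fact (b - a) / (fact (k - a) * fact (b - k))"
        using binomial_fact[of "k - a" "b - a"] by simp
      then show ?thesis by simp
    qed
    have "fact (b - a) * (green a b j k * (chip_weight a k ?c * chip_weight k b ?c)) =
       (real ((b - a) choose (k - a)) * green a b j k) * ((fact (k - a) * chip_weight a k ?c) * (fact (b - k) * chip_weight k b ?c))"
      unfolding b by (simp only: mult_ac)
    also have "\<dots> \<in> \<int>"
      by (intro Ints_mult binomial_green_Ints chip k)
    finally show "fact (b - a) * (if ?c k = 0 then green a b j k * (chip_weight a k ?c * chip_weight k b ?c) else 0) \<in> \<int>"
      by simp
  qed
next
  case (no_chips a b c)
  show ?case by (subst chip_weight_no_chips) (use no_chips in auto)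
qed

text \<open>Remove a chip at the last occupied site \<open>j\<close>. Up to each site before
  \<open>m\<close>, the last one, there remain at least as many chips as its index, so no hole can
  open there. The hole is \<open>m\<close>, where the Green's function is \<open>j\<close> divided
  by the length. Thus each chip contributes its position, and the lengths multiply to the
  factorial.\<close>

lemma chip_weight_parking:
  assumes "0 < b" "\<And>i. i \<in> {0<..<b} \<Longrightarrow> i \<le> sum c {0<..i}" "sum c {0<..<b} = b - 1"
  shows "chip_weight 0 b c = (\<Prod>i\<in>{0<..<b}. real i ^ c i) / fact b"
  using assms
proof (induction b arbitrary: c)
  case (Suc m)
  show ?case
  proof (cases "m = 0")
    case False
    let ?b = "Suc m"
    have "\<exists>j\<in>{0<..<?b}. 0 < c j" using Suc.prems(3) False
      by (metis (no_types, lifting) bot_nat_0.not_eq_extremum diff_Suc_1 sum.neutral)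
    \<comment> \<open>Choosing the last occupied site keeps the prefix sums below \<open>j\<close>
      unchanged; from \<open>j\<close> on they are all \<open>m - 1\<close>, which is enough for
      every index below \<open>m\<close>.\<close>
    then obtain j where j: "j \<in> {0<..<?b}" "0 < c j" and jmax: "\<And>i. i \<in> {0<..<?b} \<Longrightarrow> 0 < c i \<Longrightarrow> i \<le> j"
    proof -
      let ?S = "{j\<in>{0<..<?b}. 0 < c j}"
      have S: "finite ?S" "?S \<noteq> {}" using \<open>\<exists>j\<in>{0<..<?b}. 0 < c j\<close> by auto
      then have "Max ?S \<in> ?S" by (rule Max_in)
      moreover have "\<And>i. i \<in> ?S \<Longrightarrow> i \<le> Max ?S" using S by simp
      ultimately show thesis by (intro that[of "Max ?S"]) blast+
    qed
    let ?c = "remove_chip c j"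
    have s: "sum c {0<..<?b} = Suc (sum ?c {0<..<?b})" by (rule sum_remove_chip) (use j in auto)
    have z: "?c i = 0" if "j < i" "i < ?b" for i using that jmax[of i] by (auto simp: remove_chip_def)
    have pre: "sum ?c {0<..i} = sum c {0<..i}" if "i < j" for i
      by (rule sum.cong) (use that in \<open>auto simp: remove_chip_def\<close>)
    have post: "sum ?c {0<..i} = m - 1" if "j \<le> i" "i < ?b" for i
    proof -
      have "sum ?c {0<..<?b} = sum ?c {0<..i}"
        by (rule sum.mono_neutral_right) (use that z in auto)
      then show ?thesis using s Suc.prems(3) by simp
    qed
    have ci: "i \<le> sum ?c {0<..i}" if "0 < i" "i < m" for i
      using that pre[of i] post[of i] Suc.prems(2)[of i] by (cases "i < j") auto
    have m: "m \<in> {0<..<?b}" using False by auto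
    have "{0<..m} = insert m {0<..<m}" using m by auto
    then have sm: "sum ?c {0<..m} = ?c m + sum ?c {0<..<m}" by simp
    have "{0<..<m} = {0<..m - 1}" using m by auto
    then have "m - 1 \<le> sum ?c {0<..<m}" using ci[of "m - 1"] m by (cases "m = 1") auto
    moreover have "sum ?c {0<..m} = m - 1" by (rule post) (use j in auto)
    ultimately have cm: "?c m = 0" "sum ?c {0<..<m} = m - 1" using sm by auto
    \<comment> \<open>A hole at \<open>k\<close> would need exactly \<open>k - 1\<close> chips at
      the sites up to \<open>k\<close>, but at least \<open>k\<close> are there.\<close>
    have vanish: "chip_weight 0 k ?c * chip_weight k ?b ?c = 0" if k: "k \<in> {0<..<?b} - {m}" "?c k = 0" for k
    proof (rule ccontr)
      assume n: "chip_weight 0 k ?c * chip_weight k ?b ?c \<noteq> 0"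
      have "Suc (0 + sum ?c {0<..<k}) = k" by (rule chip_weight_nonzero) (use n in auto)
      moreover have "{0<..k} = insert k {0<..<k}" using k by auto
      then have "sum ?c {0<..k} = sum ?c {0<..<k}" using k by simp
      moreover have "k \<le> sum ?c {0<..k}" by (rule ci) (use k in auto)
      ultimately show False by simp
    qed
    have IH: "chip_weight 0 m ?c = (\<Prod>i\<in>{0<..<m}. real i ^ ?c i) / fact m"
    proof (rule Suc.IH)
      show "i \<le> sum ?c {0<..i}" if "i \<in> {0<..<m}" for i using ci[of i] that by simp
    qed (use cm False in auto)
    have g: "green 0 ?b j m = real j / real ?b" using j by (auto simp: green_def min_def max_def)
    have "chip_weight 0 ?b c = (\<Sum>k\<in>{m}. if ?c k = 0 then green 0 ?b j k * (chip_weight 0 k ?c * chip_weight k ?b ?c) else 0)"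
      unfolding chip_weight_remove_chip[of j _ _ c, OF j]
    proof (rule sum.mono_neutral_right)
      show "\<forall>k\<in>{0<..<?b} - {m}. (if ?c k = 0 then green 0 ?b j k * (chip_weight 0 k ?c * chip_weight k ?b ?c) else 0) = 0"
        using vanish by (metis mult_zero_right)
    qed (use m in auto)
    also have "\<dots> = real j / real ?b * (\<Prod>i\<in>{0<..<m}. real i ^ ?c i) / fact m" using cm IH g by simp
    also have "(\<Prod>i\<in>{0<..<m}. real i ^ ?c i) = (\<Prod>i\<in>{0<..<?b}. real i ^ ?c i)"
    proof -
      have "{0<..<?b} = insert m {0<..<m}" using m by auto
      then show ?thesis using cm by simp
    qed
    also have "real j / real ?b * (\<Prod>i\<in>{0<..<?b}. real i ^ ?c i) / fact m = (real j * (\<Prod>i\<in>{0<..<?b}. real i ^ ?c i)) / fact ?b"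
      by simp
    also have "real j * (\<Prod>i\<in>{0<..<?b}. real i ^ ?c i) = (\<Prod>i\<in>{0<..<?b}. real i ^ c i)"
    proof -
      have "(\<Prod>i\<in>{0<..<?b} - {j}. real i ^ ?c i) = (\<Prod>i\<in>{0<..<?b} - {j}. real i ^ c i)"
        by (rule prod.cong) (auto simp: remove_chip_def)
      moreover have "real j * real j ^ ?c j = real j ^ c j"
        using j by (cases "c j") (auto simp: remove_chip_def)
      moreover have "prod f {0<..<?b} = f j * prod f ({0<..<?b} - {j})" for f :: "nat \<Rightarrow> real"
        by (rule prod.remove) (use j in auto)
      ultimately show ?thesis by (metis mult.assoc)
    qed
    finally show ?thesis .
  next
    case True
    have "{0<..<Suc 0} = {}" by auto
    then show ?thesis using True by simp
  qed
qed simp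

lemma chip_weight_all_first:
  assumes "a < b" "\<And>i. i \<in> {a<..<b} \<Longrightarrow> c i = (if i = Suc a then b - a - 1 else 0)"
  shows "chip_weight a b c = 1 / fact (b - a)"
proof -
  have "chip_weight a b c = chip_weight 0 (b - a) (\<lambda>i. c (i + a))"
    using chip_weight_shift[of 0 a "b - a" c] assms by simp
  also have "\<dots> = (\<Prod>i\<in>{0<..<b - a}. real i ^ c (i + a)) / fact (b - a)"
  proof (rule chip_weight_parking)
    fix i assume i: "i \<in> {0<..<b - a}"
    have "sum (\<lambda>i. c (i + a)) {0<..i} = (\<Sum>j\<in>{0<..i}. if j = 1 then b - a - 1 else 0)"
      by (rule sum.cong) (use i assms in auto)
    also have "\<dots> = b - a - 1" using i by simp
    finally show "i \<le> sum (\<lambda>i. c (i + a)) {0<..i}" using i by auto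
  next
    have "sum (\<lambda>i. c (i + a)) {0<..<b - a} = (\<Sum>j\<in>{0<..<b - a}. if j = 1 then b - a - 1 else 0)"
      by (rule sum.cong) (use assms in auto)
    then show "sum (\<lambda>i. c (i + a)) {0<..<b - a} = b - a - 1" by auto
  qed (use assms in auto)
  also have "(\<Prod>i\<in>{0<..<b - a}. real i ^ c (i + a)) = 1"
    by (rule prod.neutral) (use assms in auto)
  finally show ?thesis .
qed

lemma chip_weight_all_last:
  assumes "a < b" "\<And>i. i \<in> {a<..<b} \<Longrightarrow> c i = (if Suc i = b then b - a - 1 else 0)"
  shows "chip_weight a b c = 1 / fact (b - a)"
proof -
  have "chip_weight a b c = chip_weight (b - b) (b - a) (\<lambda>i. c (b - i))"
    by (rule chip_weight_reflect[symmetric]) (use assms in auto)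
  also have "\<dots> = 1 / fact (b - a - (b - b))"
    by (rule chip_weight_all_first) (use assms in auto)
  finally show ?thesis by simp
qed

text \<open>Remove a chip from site 1. The \<open>k - 1\<close> chips that stay there must fill the
  sites left of the hole, so the hole is \<open>k\<close>, and each side has all its chips at its
  outer end. For \<open>k = 0\<close> there is no chip to remove from site 1.\<close>

lemma chip_weight_first_last:
  assumes "2 \<le> n" "k \<le> n"
  shows "fact (n + 1) * chip_weight 0 (n + 1) (\<lambda>i. if i = 1 then k else if i = n then n - k else 0) = real (n choose k)"
proof (cases "k = 0")
  case True
  have "chip_weight 0 (n + 1) (\<lambda>i. if i = 1 then k else if i = n then n - k else 0) = 1 / fact (n + 1 - 0)"
    by (rule chip_weight_all_last) (use True assms in auto)
  then show ?thesis using True by simp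
next
  case False
  define x where "x = real (n + 1 - k)"
  let ?c = "\<lambda>i. if i = 1 then k else if i = n then n - k else 0"
  let ?r = "remove_chip ?c 1"
  have r: "?r = (\<lambda>i. if i = 1 then k - 1 else if i = n then n - k else 0)"
    by (auto simp: remove_chip_def fun_eq_iff)
  have k: "k \<in> {0<..<n + 1}" using False assms by auto
  have "chip_weight 0 (n + 1) ?c = (\<Sum>m\<in>{k}. if ?r m = 0 then green 0 (n + 1) 1 m * (chip_weight 0 m ?r * chip_weight m (n + 1) ?r) else 0)"
  proof -
    have "chip_weight 0 (n + 1) ?c = (\<Sum>m\<in>{0<..<n + 1}. if ?r m = 0 then green 0 (n + 1) 1 m * (chip_weight 0 m ?r * chip_weight m (n + 1) ?r) else 0)"
      by (rule chip_weight_remove_chip) (use assms False in auto)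
    also have "(\<Sum>m\<in>{0<..<n + 1}. if ?r m = 0 then green 0 (n + 1) 1 m * (chip_weight 0 m ?r * chip_weight m (n + 1) ?r) else 0) =
      (\<Sum>m\<in>{k}. if ?r m = 0 then green 0 (n + 1) 1 m * (chip_weight 0 m ?r * chip_weight m (n + 1) ?r) else 0)"
    proof (rule sum.mono_neutral_right)
      show "\<forall>m\<in>{0<..<n + 1} - {k}. (if ?r m = 0 then green 0 (n + 1) 1 m * (chip_weight 0 m ?r * chip_weight m (n + 1) ?r) else 0) = 0"
      proof (rule ballI, rule ccontr)
        fix m assume m: "m \<in> {0<..<n + 1} - {k}"
          and "(if ?r m = 0 then green 0 (n + 1) 1 m * (chip_weight 0 m ?r * chip_weight m (n + 1) ?r) else 0) \<noteq> 0"
        then have rm: "?r m = 0" and "chip_weight 0 m ?r \<noteq> 0" by (auto split: if_splits)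
        then have "m = Suc (0 + sum ?r {0<..<m})" by (intro chip_weight_nonzero[symmetric])
        also have "sum ?r {0<..<m} = (\<Sum>i\<in>{0<..<m}. if i = 1 then k - 1 else 0)"
          unfolding r by (rule sum.cong) (use m in auto)
        finally show False using m rm k by (auto simp only: r) (auto split: if_splits)
      qed
    qed (use k in auto)
    finally show ?thesis .
  qed
  also have "\<dots> = green 0 (n + 1) 1 k * (chip_weight 0 k ?r * chip_weight k (n + 1) ?r)"
  proof -
    have "?r k = 0" unfolding r using assms False by auto
    then show ?thesis by (simp del: One_nat_def)
  qed
  also have "chip_weight 0 k ?r = 1 / fact (k - 0)"
    unfolding r by (rule chip_weight_all_first) (use assms False in auto)
  also have "chip_weight k (n + 1) ?r = 1 / fact (n + 1 - k)"
    unfolding r by (rule chip_weight_all_last) (use assms False in auto)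
  also have "green 0 (n + 1) 1 k = real (n + 1 - k) / real (n + 1)"
    using k by (auto simp: green_def min_def max_def of_nat_diff)
  also have "(fact (n + 1 - k) :: real) = real (n + 1 - k) * fact (n - k)"
    using assms by (simp add: Suc_diff_le)
  finally have "chip_weight 0 (n + 1) ?c = x / real (n + 1) * (1 / fact (k - 0) * (1 / (x * fact (n - k))))"
    unfolding x_def .
  moreover have "x \<noteq> 0" using assms by (simp add: x_def)
  moreover have "(fact (n + 1) :: real) = real (n + 1) * fact n" by simp
  moreover have "real (n choose k) = fact n / (fact k * fact (n - k))" using assms by (simp add: binomial_fact)
  ultimately show ?thesis by (simp only:) simp
qed

section \<open>The volume polynomial\<close>

definition chip_configs :: "nat set \<Rightarrow> nat \<Rightarrow> (nat \<Rightarrow> nat) set" where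
  "chip_configs S n = {c. (\<forall>i. i \<notin> S \<longrightarrow> c i = 0) \<and> sum c S = n}"

lemma finite_chip_configs:
  assumes "finite S"
  shows "finite (chip_configs S n)"
proof (rule finite_subset)
  show "chip_configs S n \<subseteq> (\<lambda>f i. if i \<in> S then f i else 0) ` (S \<rightarrow>\<^sub>E {..n})"
  proof
    fix c assume c: "c \<in> chip_configs S n"
    have "c i \<le> n" if "i \<in> S" for i
      using c member_le_sum[of i S c] that assms by (auto simp: chip_configs_def)
    then have "restrict c S \<in> S \<rightarrow>\<^sub>E {..n}" by auto
    moreover have "c = (\<lambda>i. if i \<in> S then restrict c S i else 0)"
      using c by (auto simp: chip_configs_def fun_eq_iff)
    ultimately show "c \<in> (\<lambda>f i. if i \<in> S then f i else 0) ` (S \<rightarrow>\<^sub>E {..n})" by blast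
  qed
  show "finite ((\<lambda>f i. if i \<in> S then f i else 0) ` (S \<rightarrow>\<^sub>E {..n}))"
    using assms by (intro finite_imageI finite_PiE) auto
qed

text \<open>Divided powers: differentiation with respect to \<open>u j\<close> becomes the removal
  of a chip at \<open>j\<close>, without a numerical factor.\<close>

definition monomial :: "nat set \<Rightarrow> (nat \<Rightarrow> real) \<Rightarrow> (nat \<Rightarrow> nat) \<Rightarrow> real" where
  "monomial S u c = (\<Prod>i\<in>S. u i ^ c i / fact (c i))"

definition volume_poly :: "nat \<Rightarrow> nat \<Rightarrow> (nat \<Rightarrow> real) \<Rightarrow> real" where
  "volume_poly a b u = (\<Sum>c\<in>chip_configs {a<..<b} (b - a - 1). chip_weight a b c * monomial {a<..<b} u c)"

lemma monomial_remove_chip: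
  assumes "finite S" "j \<in> S" "0 < c j"
  shows "real (c j) * monomial S u c = u j * monomial S u (remove_chip c j)"
proof -
  have c: "monomial S u c = u j ^ c j / fact (c j) * (\<Prod>i\<in>S - {j}. u i ^ c i / fact (c i))"
    unfolding monomial_def by (rule prod.remove) (use assms in auto)
  have r: "monomial S u (remove_chip c j) = u j ^ (c j - 1) / fact (c j - 1) * (\<Prod>i\<in>S - {j}. u i ^ c i / fact (c i))"
    unfolding monomial_def
    by (subst prod.remove[of _ j]) (use assms in \<open>auto simp: remove_chip_def intro!: prod.cong\<close>)
  have e: "real (c j) * (u j ^ c j / fact (c j)) = u j * (u j ^ (c j - 1) / fact (c j - 1))"
    using assms by (cases "c j") (simp_all add: fact_Suc del: of_nat_Suc)
  show ?thesis unfolding c r mult.assoc[symmetric] e ..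
qed

lemma monomial_cong:
  assumes "\<And>i. i \<in> S \<Longrightarrow> c i = d i"
  shows "monomial S u c = monomial S u d"
  unfolding monomial_def using assms by (intro prod.cong) auto

text \<open>A configuration with a hole at \<open>k\<close> is a pair of configurations on the two
  sides, and only \<open>k - a - 1\<close> chips on the left give a nonzero weight. The total is
  \<open>b - a - 2\<close> because one chip has already been removed.\<close>

lemma volume_poly_product:
  assumes "a < k" "k < b"
  shows "(\<Sum>d\<in>chip_configs {a<..<b} (b - a - 2). if d k = 0 then
            chip_weight a k d * chip_weight k b d * monomial {a<..<b} u d else 0) =
         volume_poly a k u * volume_poly k b u"
proof -
  let ?L = "{a<..<k}" and ?R = "{k<..<b}" and ?S = "{a<..<b}"
  let ?good = "{d \<in> chip_configs ?S (b - a - 2). d k = 0 \<and> sum d ?L = k - a - 1}"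
  have split: "sum d ?S = sum d ?L + d k + sum d ?R" for d :: "nat \<Rightarrow> nat"
    by (rule sum_split_open) (use assms in auto)
  have S: "?S = insert k (?L \<union> ?R)" using assms by auto
  have mono: "monomial ?S u d = monomial ?L u d * monomial ?R u d" if "d k = 0" for d
  proof -
    have "monomial ?S u d = u k ^ d k / fact (d k) * monomial (?L \<union> ?R) u d"
      unfolding monomial_def S by (rule prod.insert) auto
    also have "monomial (?L \<union> ?R) u d = monomial ?L u d * monomial ?R u d"
      unfolding monomial_def by (rule prod.union_disjoint) auto
    finally show ?thesis using that by simp
  qed
  have "(\<Sum>d\<in>chip_configs ?S (b - a - 2). if d k = 0 then
            chip_weight a k d * chip_weight k b d * monomial ?S u d else 0) =
        (\<Sum>d\<in>{d \<in> chip_configs ?S (b - a - 2). d k = 0}. chip_weight a k d * chip_weight k b d * monomial ?S u d)"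
    by (rule sum.inter_filter[symmetric]) (simp add: finite_chip_configs)
  also have "\<dots> = (\<Sum>d\<in>?good. chip_weight a k d * chip_weight k b d * monomial ?S u d)"
  proof (rule sum.mono_neutral_right)
    show "\<forall>d\<in>{d \<in> chip_configs ?S (b - a - 2). d k = 0} - ?good.
        chip_weight a k d * chip_weight k b d * monomial ?S u d = 0"
    proof
      fix d assume "d \<in> {d \<in> chip_configs ?S (b - a - 2). d k = 0} - ?good"
      then have "Suc (a + sum d ?L) \<noteq> k" by auto
      then have "chip_weight a k d = 0" using chip_weight_nonzero[of a k d] by blast
      then show "chip_weight a k d * chip_weight k b d * monomial ?S u d = 0" by simp
    qed
    show "finite {d \<in> chip_configs ?S (b - a - 2). d k = 0}" by (simp add: finite_chip_configs)
  qed blast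
  also have "\<dots> = (\<Sum>(c1, c2)\<in>chip_configs ?L (k - a - 1) \<times> chip_configs ?R (b - k - 1).
        (chip_weight a k c1 * monomial ?L u c1) * (chip_weight k b c2 * monomial ?R u c2))"
  proof (rule sum.reindex_bij_witness[of _ "\<lambda>(c1, c2) i. c1 i + c2 i"
         "\<lambda>d. (\<lambda>i. if i \<in> ?L then d i else 0, \<lambda>i. if i \<in> ?R then d i else 0)"], goal_cases)
    case (1 d)
    then have "d i = 0" if "i \<notin> ?L" "i \<notin> ?R" for i
      using that S by (cases "i = k") (auto simp: chip_configs_def)
    then show ?case by (auto simp: fun_eq_iff)
  next
    case (2 d)
    then have "sum d ?R = b - k - 1" using split[of d] assms by (auto simp: chip_configs_def)
    then show ?case using 2 by (auto simp: chip_configs_def)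
  next
    case (3 p)
    then show ?case by (cases p) (auto simp: chip_configs_def fun_eq_iff)
  next
    case (4 p)
    obtain c1 c2 where p: "p = (c1, c2)" by (cases p)
    have z: "\<And>i. i \<notin> ?L \<Longrightarrow> c1 i = 0" "\<And>i. i \<notin> ?R \<Longrightarrow> c2 i = 0"
      and s: "sum c1 ?L = k - a - 1" "sum c2 ?R = b - k - 1"
      using 4 p by (auto simp: chip_configs_def)
    have "sum c1 ?R = 0" "sum c2 ?L = 0" using z by auto
    then have "sum (\<lambda>i. c1 i + c2 i) ?L = k - a - 1" "sum (\<lambda>i. c1 i + c2 i) ?R = b - k - 1"
      using s by (simp_all add: sum.distrib)
    moreover have "c1 k + c2 k = 0" using z by simp
    moreover have "c1 i + c2 i = 0" if "i \<notin> ?S" for i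
      using z[of i] that assms by auto
    ultimately show ?case using p assms split[of "\<lambda>i. c1 i + c2 i"] by (auto simp: chip_configs_def)
  next
    case (5 d)
    let ?c1 = "\<lambda>i. if i \<in> ?L then d i else 0" and ?c2 = "\<lambda>i. if i \<in> ?R then d i else 0"
    have "chip_weight a k ?c1 = chip_weight a k d" "chip_weight k b ?c2 = chip_weight k b d"
      by (rule chip_weight_cong; simp)+
    moreover have "monomial ?L u ?c1 = monomial ?L u d" "monomial ?R u ?c2 = monomial ?R u d"
      by (rule monomial_cong; simp)+
    ultimately show ?case using mono[of d] 5 by simp
  qed
  also have "\<dots> = volume_poly a k u * volume_poly k b u"
    unfolding volume_poly_def sum_product sum.cartesian_product by simp
  finally show ?thesis .
qed

text \<open>Euler's identity for a homogeneous polynomial: the degree \<open>b - a - 1\<close> is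
  spread over the sites as the multiplicities \<open>c j\<close>, and for each \<open>j\<close> the
  weight is expanded by removing a chip at that very site. This uses the free choice of the
  chip.\<close>

lemma volume_poly_recursion:
  assumes "Suc a < b"
  shows "real (b - a - 1) * volume_poly a b u =
         (\<Sum>k\<in>{a<..<b}. (\<Sum>j\<in>{a<..<b}. green a b j k * u j) * (volume_poly a k u * volume_poly k b u))"
proof -
  let ?S = "{a<..<b}"
  let ?C = "chip_configs ?S (b - a - 1)" and ?D = "chip_configs ?S (b - a - 2)"
  define F where "F = (\<lambda>j k d. if d k = 0 then green a b j k * (chip_weight a k d * chip_weight k b d) else 0)"
  have "real (b - a - 1) * volume_poly a b u =
      (\<Sum>c\<in>?C. \<Sum>j\<in>?S. real (c j) * (chip_weight a b c * monomial ?S u c))"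
    unfolding volume_poly_def sum_distrib_left
  proof (rule sum.cong[OF refl])
    fix c assume "c \<in> ?C"
    then have "real (b - a - 1) = (\<Sum>j\<in>?S. real (c j))" by (auto simp: chip_configs_def simp flip: of_nat_sum)
    then show "real (b - a - 1) * (chip_weight a b c * monomial ?S u c) =
       (\<Sum>j\<in>?S. real (c j) * (chip_weight a b c * monomial ?S u c))" by (simp add: sum_distrib_right)
  qed
  also have "\<dots> = (\<Sum>j\<in>?S. \<Sum>c\<in>?C. real (c j) * (chip_weight a b c * monomial ?S u c))"
    by (rule sum.swap)
  also have "\<dots> = (\<Sum>j\<in>?S. \<Sum>d\<in>?D. u j * monomial ?S u d * (\<Sum>k\<in>?S. F j k d))"
  proof (rule sum.cong[OF refl])
    fix j assume j: "j \<in> ?S"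
    have "(\<Sum>c\<in>?C. real (c j) * (chip_weight a b c * monomial ?S u c)) =
       (\<Sum>c\<in>{c\<in>?C. 0 < c j}. real (c j) * (chip_weight a b c * monomial ?S u c))"
      by (rule sum.mono_neutral_right) (auto simp: finite_chip_configs)
    also have "\<dots> = (\<Sum>d\<in>?D. u j * monomial ?S u d * (\<Sum>k\<in>?S. F j k d))"
    proof (rule sum.reindex_bij_witness[of _ "\<lambda>d. d(j := Suc (d j))" "\<lambda>c. remove_chip c j"], goal_cases)
      case (2 c)
      then show ?case using sum_remove_chip[of ?S j c] j by (auto simp: chip_configs_def remove_chip_def)
    next
      case (4 d)
      then have "sum (d(j := Suc (d j))) ?S = Suc (sum (remove_chip (d(j := Suc (d j))) j) ?S)"
        by (intro sum_remove_chip) (use j in auto)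
      then show ?case using 4 j assms by (auto simp: chip_configs_def remove_chip_def)
    next
      case (5 c)
      have c: "chip_weight a b c = (\<Sum>k\<in>?S. F j k (remove_chip c j))"
        unfolding F_def by (rule chip_weight_remove_chip) (use j 5 in auto)
      have m: "real (c j) * monomial ?S u c = u j * monomial ?S u (remove_chip c j)"
        by (rule monomial_remove_chip) (use j 5 in auto)
      have "real (c j) * (chip_weight a b c * monomial ?S u c) = (real (c j) * monomial ?S u c) * chip_weight a b c"
        by (simp only: mult_ac)
      also have "\<dots> = u j * monomial ?S u (remove_chip c j) * (\<Sum>k\<in>?S. F j k (remove_chip c j))"
        unfolding m by (simp only: c)
      finally show ?case by (rule sym)
    next
      case (1 c)
      then show ?case by (simp add: remove_chip_def)
    next
      case (3 d)
      show ?case by (simp add: remove_chip_def)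
    qed
    finally show "(\<Sum>c\<in>?C. real (c j) * (chip_weight a b c * monomial ?S u c)) =
      (\<Sum>d\<in>?D. u j * monomial ?S u d * (\<Sum>k\<in>?S. F j k d))" .
  qed
  also have "\<dots> = (\<Sum>k\<in>?S. \<Sum>j\<in>?S. \<Sum>d\<in>?D. u j * monomial ?S u d * F j k d)"
  proof -
    have "(\<Sum>j\<in>?S. \<Sum>d\<in>?D. u j * monomial ?S u d * (\<Sum>k\<in>?S. F j k d)) =
        (\<Sum>j\<in>?S. \<Sum>k\<in>?S. \<Sum>d\<in>?D. u j * monomial ?S u d * F j k d)"
      unfolding sum_distrib_left by (intro sum.cong refl sum.swap)
    also have "\<dots> = (\<Sum>k\<in>?S. \<Sum>j\<in>?S. \<Sum>d\<in>?D. u j * monomial ?S u d * F j k d)" by (rule sum.swap)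
    finally show ?thesis .
  qed
  also have "\<dots> = (\<Sum>k\<in>?S. (\<Sum>j\<in>?S. green a b j k * u j) * (volume_poly a k u * volume_poly k b u))"
  proof (rule sum.cong[OF refl])
    fix k assume k: "k \<in> ?S"
    then have v: "volume_poly a k u * volume_poly k b u = (\<Sum>d\<in>?D. if d k = 0 then
            chip_weight a k d * chip_weight k b d * monomial ?S u d else 0)"
      by (intro volume_poly_product[symmetric]) auto
    show "(\<Sum>j\<in>?S. \<Sum>d\<in>?D. u j * monomial ?S u d * F j k d) =
      (\<Sum>j\<in>?S. green a b j k * u j) * (volume_poly a k u * volume_poly k b u)"
      unfolding v sum_product F_def by (intro sum.cong refl) (simp add: mult_ac)
  qed
  finally show ?thesis .
qed

lemma volume_poly_Suc [simp]: "volume_poly a (Suc a) u = 1"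
proof -
  have "chip_configs {} 0 = {\<lambda>_. 0}" by (auto simp: chip_configs_def)
  moreover have "{a<..<Suc a} = {}" by auto
  ultimately show ?thesis by (simp add: volume_poly_def monomial_def)
qed

lemma volume_poly_scale: "volume_poly a b (\<lambda>i. r * u i) = r ^ (b - a - 1) * volume_poly a b u"
  unfolding volume_poly_def sum_distrib_left
proof (rule sum.cong[OF refl])
  fix c assume "c \<in> chip_configs {a<..<b} (b - a - 1)"
  then have "r ^ (b - a - 1) = (\<Prod>i\<in>{a<..<b}. r ^ c i)" by (simp add: chip_configs_def flip: power_sum)
  then have "monomial {a<..<b} (\<lambda>i. r * u i) c = r ^ (b - a - 1) * monomial {a<..<b} u c"
    by (simp add: monomial_def power_mult_distrib flip: prod.distrib)
  then show "chip_weight a b c * monomial {a<..<b} (\<lambda>i. r * u i) c = r ^ (b - a - 1) * (chip_weight a b c * monomial {a<..<b} u c)"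
    by simp
qed

lemma volume_poly_cong:
  assumes "\<And>i. i \<in> {a<..<b} \<Longrightarrow> u i = v i"
  shows "volume_poly a b u = volume_poly a b v"
proof -
  have "monomial {a<..<b} u c = monomial {a<..<b} v c" for c
    unfolding monomial_def by (rule prod.cong) (simp_all add: assms)
  then show ?thesis by (simp add: volume_poly_def)
qed

lemma volume_poly_nonneg:
  assumes "\<And>i. i \<in> {a<..<b} \<Longrightarrow> 0 \<le> u i"
  shows "0 \<le> volume_poly a b u"
proof -
  have "0 \<le> monomial {a<..<b} u c" for c
    unfolding monomial_def by (intro prod_nonneg ballI divide_nonneg_nonneg zero_le_power) (use assms in auto)
  then show ?thesis
    unfolding volume_poly_def by (intro sum_nonneg mult_nonneg_nonneg chip_weight_nonneg)
qed

section \<open>Second differences and Lebesgue measure on products\<close>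

abbreviation lborel_PiM :: "nat set \<Rightarrow> (nat \<Rightarrow> real) measure" where
  "lborel_PiM I \<equiv> \<Pi>\<^sub>M i\<in>I. lborel"

interpretation lborel_product: product_sigma_finite "\<lambda>_::nat. lborel :: real measure"
  by standard

text \<open>A graph over the other coordinates meets each line in direction \<open>j\<close> in one
  point. This disposes of all ties: equal ratios, where cones overlap, and equal coordinates, where
  chambers overlap.\<close>

lemma AE_PiM_coordinate_neq:
  fixes g :: "(nat \<Rightarrow> real) \<Rightarrow> real"
  assumes "finite I" "j \<in> I" "g \<in> borel_measurable (lborel_PiM I)"
    and "\<And>s x. g (s(j := x)) = g s"
  shows "AE s in lborel_PiM I. s j \<noteq> g s"
proof -
  let ?N = "{s \<in> space (lborel_PiM I). s j = g s}"
  have [measurable]: "g \<in> borel_measurable (lborel_PiM I)" by fact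
  have [measurable]: "(\<lambda>s. s j) \<in> borel_measurable (lborel_PiM I)"
    using assms(2) by measurable
  have N: "?N \<in> sets (lborel_PiM I)" by measurable
  have I: "I = insert j (I - {j})" using assms by auto
  have "emeasure (lborel_PiM I) ?N = (\<integral>\<^sup>+ s. indicator ?N s \<partial>lborel_PiM I)"
    using N by simp
  also have "\<dots> = (\<integral>\<^sup>+ s. \<integral>\<^sup>+ x. indicator ?N (s(j := x)) \<partial>lborel \<partial>lborel_PiM (I - {j}))"
    by (subst I, rule lborel_product.product_nn_integral_insert) (use assms N I in \<open>auto simp: insert_absorb\<close>)
  also have "\<dots> = (\<integral>\<^sup>+ s. 0 \<partial>lborel_PiM (I - {j}))"
  proof (rule nn_integral_cong)
    fix s :: "nat \<Rightarrow> real"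
    have "(\<integral>\<^sup>+ x. indicator ?N (s(j := x)) \<partial>lborel) \<le> (\<integral>\<^sup>+ x. indicator {g s} x \<partial>lborel)"
      using assms(4) by (intro nn_integral_mono) (auto split: split_indicator)
    also have "\<dots> = 0" by simp
    finally show "(\<integral>\<^sup>+ x. indicator ?N (s(j := x)) \<partial>lborel) = 0" by simp
  qed
  finally have "?N \<in> null_sets (lborel_PiM I)" using N by auto
  then show ?thesis by (rule AE_I') auto
qed

lemma emeasure_PiM_product:
  assumes IJ: "finite I" "finite J" "I \<inter> J = {}"
    and A: "A \<in> sets (lborel_PiM I)" and B: "B \<in> sets (lborel_PiM J)"
  shows "(\<integral>\<^sup>+ s. indicator A (restrict s I) * indicator B (restrict s J) \<partial>lborel_PiM (I \<union> J)) =
         emeasure (lborel_PiM I) A * emeasure (lborel_PiM J) B"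
proof -
  have "(\<integral>\<^sup>+ s. indicator A (restrict s I) * indicator B (restrict s J) \<partial>lborel_PiM (I \<union> J)) =
    (\<integral>\<^sup>+ x. \<integral>\<^sup>+ y. indicator A (restrict (merge I J (x, y)) I) * indicator B (restrict (merge I J (x, y)) J)
       \<partial>lborel_PiM J \<partial>lborel_PiM I)"
  proof (rule lborel_product.product_nn_integral_fold[OF IJ(3) IJ(1) IJ(2)])
    have "(\<lambda>s. restrict s I) \<in> measurable (lborel_PiM (I \<union> J)) (lborel_PiM I)"
      "(\<lambda>s. restrict s J) \<in> measurable (lborel_PiM (I \<union> J)) (lborel_PiM J)"
      by (rule measurable_restrict_subset; auto)+
    from this(1)[THEN measurable_compose, OF borel_measurable_indicator[OF A]]
      this(2)[THEN measurable_compose, OF borel_measurable_indicator[OF B]]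
    show "(\<lambda>s. indicator A (restrict s I) * indicator B (restrict s J) :: ennreal) \<in> borel_measurable (lborel_PiM (I \<union> J))"
      by (rule borel_measurable_times_ennreal)
  qed
  also have "\<dots> = (\<integral>\<^sup>+ x. \<integral>\<^sup>+ y. indicator A x * indicator B y \<partial>lborel_PiM J \<partial>lborel_PiM I)"
  proof (intro nn_integral_cong)
    fix x y assume x: "x \<in> space (lborel_PiM I)" and y: "y \<in> space (lborel_PiM J)"
    have "restrict x I = x" "restrict y J = y"
      using x y by (simp_all add: space_PiM PiE_restrict)
    then show "indicator A (restrict (merge I J (x, y)) I) * indicator B (restrict (merge I J (x, y)) J) =
      (indicator A x * indicator B y :: ennreal)"
      using IJ(3) by (simp add: restrict_merge)
  qed
  also have "\<dots> = emeasure (lborel_PiM I) A * emeasure (lborel_PiM J) B"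
    using A B by (simp add: nn_integral_cmult nn_integral_multc)
  finally show ?thesis .
qed

text \<open>The sign makes nonnegative values mean concavity. The truncated subtraction is harmless
  at the interior sites of an interval, where \<open>i \<ge> 1\<close>.\<close>

definition second_difference :: "(nat \<Rightarrow> real) \<Rightarrow> nat \<Rightarrow> real" where
  "second_difference h i = 2 * h i - h (i - 1) - h (i + 1)"

definition linear_interp :: "nat \<Rightarrow> nat \<Rightarrow> (nat \<Rightarrow> real) \<Rightarrow> nat \<Rightarrow> real" where
  "linear_interp a b h i = h a + (h b - h a) * (real i - real a) / (real b - real a)"

text \<open>Summation by parts: against a linear weight that vanishes at \<open>a\<close>, second
  differences telescope to boundary terms. Such a weight is one branch of the Green's
  function.\<close>

lemma sum_second_difference_left:
  assumes "a < k"
  shows "(\<Sum>j\<in>{a<..<k}. (real j - real a) * second_difference h j) =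
         (real k - real a) * h (k - 1) - (real k - real a - 1) * h k - h a"
  using assms
proof (induction k)
  case (Suc k)
  show ?case
  proof (cases "a = k")
    case True
    have "{a<..<Suc k} = {}" using True by auto
    then show ?thesis using True by simp
  next
    case False
    then have "{a<..<Suc k} = insert k {a<..<k}" "a < k" using Suc.prems by auto
    then show ?thesis using Suc.IH by (simp add: second_difference_def algebra_simps)
  qed
qed simp

lemma sum_second_difference_right:
  assumes "k < b"
  shows "(\<Sum>j\<in>{k<..<b}. (real b - real j) * second_difference h j) =
         (real b - real k) * h (k + 1) - (real b - real k - 1) * h k - h b"
proof -
  have "(\<Sum>j\<in>{b - Suc m<..<b}. (real b - real j) * second_difference h j) =
         real (Suc m) * h (b - m) - real m * h (b - Suc m) - h b" if "Suc m \<le> b" for m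
    using that
  proof (induction m)
    case 0
    have "{b - Suc 0<..<b} = {}" by auto
    then show ?case by simp
  next
    case (Suc m)
    have "{b - Suc (Suc m)<..<b} = insert (b - Suc m) {b - Suc m<..<b}" using Suc.prems by auto
    moreover have "b - Suc m - 1 = b - Suc (Suc m)" "b - Suc m + 1 = b - m" using Suc.prems by auto
    moreover have "real b - real (b - Suc m) = real (Suc m)" using Suc.prems by (simp add: of_nat_diff)
    ultimately show ?case using Suc by (simp add: second_difference_def algebra_simps)
  qed
  from this[of "b - k - 1"] assms show ?thesis
    by (simp add: of_nat_diff Suc_diff_Suc)
qed

text \<open>Each side of \<open>k\<close> telescopes, since both branches of the Green's function
  are linear; the neighbours \<open>h (k - 1)\<close> and \<open>h (k + 1)\<close> cancel against
  the term at the kink \<open>k\<close>.\<close>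

lemma sum_green_second_difference:
  assumes k: "k \<in> {a<..<b}"
  shows "(\<Sum>j\<in>{a<..<b}. green a b j k * second_difference h j) = h k - linear_interp a b h k"
proof -
  define p q n where "p = real k - real a" and "q = real b - real k" and "n = real b - real a"
  have n: "n = p + q" "0 < p" "0 < q" using k by (auto simp: p_def q_def n_def)
  have "(\<Sum>j\<in>{a<..<b}. green a b j k * second_difference h j) =
    (\<Sum>j\<in>{a<..<k}. green a b j k * second_difference h j) + green a b k k * second_difference h k +
    (\<Sum>j\<in>{k<..<b}. green a b j k * second_difference h j)"
    by (rule sum_split_open) (use k in auto)
  also have "(\<Sum>j\<in>{a<..<k}. green a b j k * second_difference h j) =
     q / n * (\<Sum>j\<in>{a<..<k}. (real j - real a) * second_difference h j)"
    unfolding sum_distrib_left by (rule sum.cong) (auto simp: green_def min_def max_def q_def n_def)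
  also have "(\<Sum>j\<in>{k<..<b}. green a b j k * second_difference h j) =
     p / n * (\<Sum>j\<in>{k<..<b}. (real b - real j) * second_difference h j)"
    unfolding sum_distrib_left by (rule sum.cong) (auto simp: green_def min_def max_def p_def n_def)
  also have "(\<Sum>j\<in>{a<..<k}. (real j - real a) * second_difference h j) = p * h (k - 1) - (p - 1) * h k - h a"
    unfolding p_def by (rule sum_second_difference_left) (use k in auto)
  also have "(\<Sum>j\<in>{k<..<b}. (real b - real j) * second_difference h j) = q * h (k + 1) - (q - 1) * h k - h b"
    unfolding q_def by (rule sum_second_difference_right) (use k in auto)
  also have "green a b k k = p * q / n" by (simp add: green_def p_def q_def n_def)
  also have "q / n * (p * h (k - 1) - (p - 1) * h k - h a) + p * q / n * second_difference h k +
      p / n * (q * h (k + 1) - (q - 1) * h k - h b) = h k - (h a + (h b - h a) * p / n)"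
    using n by (simp add: second_difference_def divide_simps) (simp add: algebra_simps)
  finally show ?thesis by (simp add: linear_interp_def p_def n_def)
qed

section \<open>The region below a concave sequence\<close>

text \<open>Points of the product space are \<open>undefined\<close> outside the open interval;
  second differences next to an end need the boundary values, which come from
  \<open>h\<close>.\<close>

definition interval_ext :: "nat \<Rightarrow> nat \<Rightarrow> (nat \<Rightarrow> real) \<Rightarrow> (nat \<Rightarrow> real) \<Rightarrow> nat \<Rightarrow> real" where
  "interval_ext a b h s i = (if i \<in> {a<..<b} then s i else h i)"

definition concave_region :: "nat \<Rightarrow> nat \<Rightarrow> (nat \<Rightarrow> real) \<Rightarrow> (nat \<Rightarrow> real) set" where
  "concave_region a b h = {s \<in> extensional {a<..<b}.
     \<forall>i\<in>{a<..<b}. 0 \<le> second_difference (interval_ext a b h s) i \<and> s i \<le> h i}"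

lemma borel_measurable_interval_ext [measurable]:
  "(\<lambda>s. interval_ext a b h s i) \<in> borel_measurable (lborel_PiM {a<..<b})"
proof (cases "i \<in> {a<..<b}")
  case True
  then have "(\<lambda>s. s i) \<in> borel_measurable (lborel_PiM {a<..<b})" by measurable
  then show ?thesis using True by (simp add: interval_ext_def)
next
  case False
  then have "(\<lambda>s. interval_ext a b h s i) = (\<lambda>s. h i)" by (auto simp: interval_ext_def)
  then show ?thesis by simp
qed

lemma space_lborel_PiM: "space (lborel_PiM I) = extensional I"
  by (simp add: space_PiM PiE_def)

lemma concave_region_sets [measurable]: "concave_region a b h \<in> sets (lborel_PiM {a<..<b})"
proof -
  have "concave_region a b h = {s \<in> space (lborel_PiM {a<..<b}).
     \<forall>i\<in>{a<..<b}. 0 \<le> second_difference (interval_ext a b h s) i \<and> s i \<le> h i}"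
    by (simp add: concave_region_def space_lborel_PiM)
  also have "\<dots> \<in> sets (lborel_PiM {a<..<b})"
    unfolding second_difference_def by measurable
  finally show ?thesis .
qed

text \<open>Minimum principle: the excess over the chord is a sum of nonnegative second differences
  with the positive Green's function as weight.\<close>

lemma concave_above_linear_interp:
  assumes "s \<in> concave_region a b h" "k \<in> {a<..<b}"
  shows "linear_interp a b h k \<le> s k"
proof -
  have "0 \<le> (\<Sum>j\<in>{a<..<b}. green a b j k * second_difference (interval_ext a b h s) j)"
    using assms by (intro sum_nonneg mult_nonneg_nonneg less_imp_le[OF green_pos]) (auto simp: concave_region_def)
  also have "\<dots> = interval_ext a b h s k - linear_interp a b (interval_ext a b h s) k"
    by (rule sum_green_second_difference) (rule assms)
  also have "\<dots> = s k - linear_interp a b h k"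
    using assms(2) by (simp add: interval_ext_def linear_interp_def)
  finally show ?thesis by simp
qed

lemma second_difference_interp:
  assumes "i \<in> {a<..<b}"
  shows "second_difference (\<lambda>i. linear_interp a b h i + r * (h i - linear_interp a b h i)) i = r * second_difference h i"
proof -
  have "second_difference (linear_interp a b h) i = 0"
    using assms by (simp add: second_difference_def linear_interp_def of_nat_diff divide_simps) (simp add: algebra_simps)
  moreover have "second_difference (\<lambda>i. linear_interp a b h i + r * (h i - linear_interp a b h i)) i =
      (1 - r) * second_difference (linear_interp a b h) i + r * second_difference h i"
    by (simp add: second_difference_def algebra_simps)
  ultimately show ?thesis by simp
qed

text \<open>\<open>hy\<close> is \<open>h\<close> contracted by the factor \<open>r\<close> towards
  its chord. The cone inequalities say that the point stays below \<open>hy\<close>, and at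
  \<open>k\<close> it touches \<open>hy\<close>; cutting there leaves two independent concave
  sequences that share the boundary value \<open>y\<close>.\<close>

lemma concave_cone_slice:
  fixes h :: "nat \<Rightarrow> real"
  assumes k: "k \<in> {a<..<b}"
    and conc: "\<And>i. i \<in> {a<..<b} \<Longrightarrow> 0 \<le> second_difference h i"
    and x: "x \<in> extensional ({a<..<b} - {k})"
    and r: "0 \<le> r" "r \<le> 1" "y = linear_interp a b h k + r * (h k - linear_interp a b h k)"
    and pos: "0 < h k - linear_interp a b h k"
  defines "hy \<equiv> \<lambda>i. linear_interp a b h i + r * (h i - linear_interp a b h i)"
  shows "x(k := y) \<in> concave_region a b h \<and> (\<forall>j\<in>{a<..<b}.
           ((x(k := y)) j - linear_interp a b h j) * (h k - linear_interp a b h k) \<le>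
           (y - linear_interp a b h k) * (h j - linear_interp a b h j)) \<longleftrightarrow>
         restrict x {a<..<k} \<in> concave_region a k hy \<and> restrict x {k<..<b} \<in> concave_region k b hy"
proof -
  let ?l = "linear_interp a b h"
  define s where "s = x(k := y)"
  define e where "e = interval_ext a b h s"
  have ab: "a < k" "k < b" "real b - real a \<noteq> 0" using k by auto
  have bd: "hy a = h a" "hy b = h b" "hy k = y" using ab by (auto simp: hy_def linear_interp_def r)
  have hyd: "second_difference hy i = r * second_difference h i" if "i \<in> {a<..<b}" for i
    unfolding hy_def by (rule second_difference_interp) (rule that)
  have D: "0 \<le> h j - ?l j" if "j \<in> {a<..<b}" for j
    unfolding sum_green_second_difference[OF that, symmetric]
    by (intro sum_nonneg mult_nonneg_nonneg less_imp_le[OF green_pos]) (use conc that in auto)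
  have hyle: "hy j \<le> h j" if "j \<in> {a<..<b}" for j
    using mult_right_mono[OF r(2) D[OF that]] by (simp add: hy_def)
  have e1: "interval_ext a k hy (restrict x {a<..<k}) i = e i" if "a \<le> i" "i \<le> k" for i
    using that bd ab by (auto simp: interval_ext_def e_def s_def)
  have e2: "interval_ext k b hy (restrict x {k<..<b}) i = e i" if "k \<le> i" "i \<le> b" for i
    using that bd ab by (auto simp: interval_ext_def e_def s_def)
  have d1: "second_difference (interval_ext a k hy (restrict x {a<..<k})) i = second_difference e i"
    if "i \<in> {a<..<k}" for i
    using that e1[of i] e1[of "i - 1"] e1[of "i + 1"] by (auto simp: second_difference_def)
  have d2: "second_difference (interval_ext k b hy (restrict x {k<..<b})) i = second_difference e i"
    if "i \<in> {k<..<b}" for i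
    using that e2[of i] e2[of "i - 1"] e2[of "i + 1"] by (auto simp: second_difference_def)
  have cone: "((s j - ?l j) * (h k - ?l k) \<le> (y - ?l k) * (h j - ?l j)) \<longleftrightarrow> s j \<le> hy j" for j
  proof -
    have "(y - ?l k) * (h j - ?l j) = (r * (h j - ?l j)) * (h k - ?l k)" by (simp add: r(3))
    then show ?thesis by (simp only: mult_le_cancel_right_pos[OF pos] hy_def) linarith
  qed
  have "s \<in> concave_region a b h \<and> (\<forall>j\<in>{a<..<b}. s j \<le> hy j) \<longleftrightarrow>
        restrict x {a<..<k} \<in> concave_region a k hy \<and> restrict x {k<..<b} \<in> concave_region k b hy"
    (is "?lhs \<longleftrightarrow> ?rhs")
  proof
    assume l: ?lhs
    then have c: "0 \<le> second_difference e i" "s i \<le> hy i" if "i \<in> {a<..<b}" for i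
      using that by (auto simp: concave_region_def e_def)
    have s: "s i = x i" if "i \<noteq> k" for i using that by (simp add: s_def)
    show ?rhs unfolding concave_region_def mem_Collect_eq
    proof (intro conjI ballI)
      fix i assume i: "i \<in> {a<..<k}"
      then have "i \<in> {a<..<b}" "i \<noteq> k" using ab by auto
      then show "0 \<le> second_difference (interval_ext a k hy (restrict x {a<..<k})) i"
        "restrict x {a<..<k} i \<le> hy i" using d1[OF i] c[of i] s[of i] i by auto
    next
      fix i assume i: "i \<in> {k<..<b}"
      then have "i \<in> {a<..<b}" "i \<noteq> k" using ab by auto
      then show "0 \<le> second_difference (interval_ext k b hy (restrict x {k<..<b})) i"
        "restrict x {k<..<b} i \<le> hy i" using d2[OF i] c[of i] s[of i] i by auto
    qed auto
  next
    assume rr: ?rhs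
    have c1: "0 \<le> second_difference e i" "s i \<le> hy i" if i: "i \<in> {a<..<k}" for i
    proof -
      have "0 \<le> second_difference (interval_ext a k hy (restrict x {a<..<k})) i" "restrict x {a<..<k} i \<le> hy i"
        using rr i unfolding concave_region_def by blast+
      then show "0 \<le> second_difference e i" "s i \<le> hy i" using d1[OF i] i by (auto simp: s_def)
    qed
    have c2: "0 \<le> second_difference e i" "s i \<le> hy i" if i: "i \<in> {k<..<b}" for i
    proof -
      have "0 \<le> second_difference (interval_ext k b hy (restrict x {k<..<b})) i" "restrict x {k<..<b} i \<le> hy i"
        using rr i unfolding concave_region_def by blast+
      then show "0 \<le> second_difference e i" "s i \<le> hy i" using d2[OF i] i by (auto simp: s_def)
    qed
    have c3: "s k = hy k" by (simp add: s_def bd)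
    have le: "s i \<le> hy i" if "i \<in> {a<..<b}" for i
      using c1(2)[of i] c2(2)[of i] c3 that by (cases i k rule: linorder_cases) auto
    have ele: "e i \<le> hy i" if "a \<le> i" "i \<le> b" for i
      using le[of i] that bd by (auto simp: e_def interval_ext_def)
    \<comment> \<open>Concavity at \<open>k\<close> is the one condition that neither half contains.
      It holds because the sequence touches the concave \<open>hy\<close> from below there.\<close>
    have "e (k - 1) \<le> hy (k - 1)" "e (k + 1) \<le> hy (k + 1)" by (rule ele; use ab in auto)+
    moreover have "e k = hy k" using c3 k by (simp add: e_def interval_ext_def)
    ultimately have "second_difference hy k \<le> second_difference e k" by (simp add: second_difference_def)
    then have c4: "0 \<le> second_difference e k" using hyd[OF k] conc[OF k] r(1) by (smt (verit) mult_nonneg_nonneg)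
    have "0 \<le> second_difference e i" if "i \<in> {a<..<b}" for i
      using c1(1)[of i] c2(1)[of i] c4 that by (cases i k rule: linorder_cases) auto
    moreover have "s i \<le> h i" if "i \<in> {a<..<b}" for i using le[OF that] hyle[OF that] by simp
    moreover have "s \<in> extensional {a<..<b}" using x k by (auto simp: extensional_def s_def)
    ultimately show ?lhs using le by (auto simp: concave_region_def e_def)
  qed
  then show ?thesis using cone unfolding s_def by simp
qed

lemma nn_integral_scaled_power:
  assumes "0 < d" "0 \<le> p"
  shows "(\<integral>\<^sup>+ y. ennreal (p * ((y - l) / d) ^ m) * indicator {l..l + d} y \<partial>lborel) =
         ennreal (d / (real m + 1) * p)"
proof -
  have "(\<integral>\<^sup>+ y. ennreal (p * ((y - l) / d) ^ m) * indicator {l..l + d} y \<partial>lborel) =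
     (d * p / (real m + 1)) * ((l + d - l) / d) ^ (m + 1) - (d * p / (real m + 1)) * ((l - l) / d) ^ (m + 1)"
  proof (rule nn_integral_FTC_Icc[where F = "\<lambda>y. (d * p / (real m + 1)) * ((y - l) / d) ^ (m + 1)"])
    fix y assume "y \<in> {l..l + d}"
    have D: "((\<lambda>y. ((y - l) / d) ^ (m + 1)) has_real_derivative real (m + 1) * ((y - l) / d) ^ m * (1 / d)) (at y)"
    proof -
      have "((\<lambda>y. (y - l) / d) has_real_derivative 1 / d) (at y)"
        using assms by (auto intro!: derivative_eq_intros)
      from DERIV_power[OF this, of "m + 1"] show ?thesis by (simp add: mult_ac)
    qed
    have "d * p / (real m + 1) * (real (m + 1) * ((y - l) / d) ^ m * (1 / d)) = p * ((y - l) / d) ^ m"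
      using assms by (simp add: add.commute)
    then show "((\<lambda>y. (d * p / (real m + 1)) * ((y - l) / d) ^ (m + 1)) has_real_derivative p * ((y - l) / d) ^ m) (at y)"
      using DERIV_cmult[OF D, of "d * p / (real m + 1)"] by metis
  qed (use assms in auto)
  then show ?thesis using assms by (simp add: mult.commute)
qed

text \<open>The ratio \<open>E k / D k\<close> measures how far a point has moved from the apex
  towards the face at \<open>k\<close>; the point lies in the cone with the largest ratio.
  Cross-multiplication keeps the description of the cones linear in the point.\<close>

lemma ratio_maximizer_unique:
  fixes E D :: "nat \<Rightarrow> real"
  assumes "finite S" "S \<noteq> {}" "\<And>i. i \<in> S \<Longrightarrow> 0 < D i"
    and ne: "\<And>i j. i \<in> S \<Longrightarrow> j \<in> S \<Longrightarrow> i \<noteq> j \<Longrightarrow> E i * D j \<noteq> E j * D i"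
  shows "\<exists>!k. k \<in> S \<and> (\<forall>j\<in>S. E j * D k \<le> E k * D j)"
proof -
  define R where "R = (\<lambda>i. E i / D i)"
  have R: "E j * D k \<le> E k * D j \<longleftrightarrow> R j \<le> R k" if "j \<in> S" "k \<in> S" for j k
    using assms(3)[OF that(1)] assms(3)[OF that(2)] by (simp add: R_def divide_simps)
  have "Max (R ` S) \<in> R ` S" using assms by (intro Max_in) auto
  then obtain k where k: "k \<in> S" "R k = Max (R ` S)" by auto
  have max: "R j \<le> R k" if "j \<in> S" for j unfolding k(2) using that assms by auto
  show ?thesis
  proof (rule ex1I[of _ k])
    show "k \<in> S \<and> (\<forall>j\<in>S. E j * D k \<le> E k * D j)" using k max R by auto
    fix i assume i: "i \<in> S \<and> (\<forall>j\<in>S. E j * D i \<le> E i * D j)"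
    then have "R k = R i" using R[of k i] max[of i] k by auto
    then have "E i * D k = E k * D i"
      using R[of k i] R[of i k] i k by (auto intro: antisym)
    then show "i = k" using ne[of i k] i k by blast
  qed
qed

text \<open>Fixing the value \<open>y\<close> of coordinate \<open>k\<close> slices the cone over
  face \<open>k\<close> into a product of two smaller regions below \<open>hy\<close>, of volume
  \<open>P k * r ^ (n - 1)\<close> by induction and homogeneity. Integration over \<open>y\<close>
  gives \<open>D k / n * P k\<close>, and the sum over \<open>k\<close> is the right side of
  \<open>volume_poly_recursion\<close>.\<close>

theorem emeasure_concave_region:
  assumes "a < b" "\<And>i. i \<in> {a<..<b} \<Longrightarrow> 0 \<le> second_difference h i"
  shows "emeasure (lborel_PiM {a<..<b}) (concave_region a b h) = ennreal (volume_poly a b (second_difference h))"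
  using assms
proof (induction "b - a" arbitrary: a b h rule: less_induct)
  case less
  let ?S = "{a<..<b}" and ?u = "second_difference h" and ?l = "linear_interp a b h"
  let ?M = "lborel_PiM ?S"
  define D where "D = (\<lambda>i. h i - ?l i)"
  have Dsum: "D k = (\<Sum>j\<in>?S. green a b j k * ?u j)" if "k \<in> ?S" for k
    unfolding D_def using sum_green_second_difference[OF that] by simp
  have bounds: "?l k \<le> s k" "s k \<le> h k" if "s \<in> concave_region a b h" "k \<in> ?S" for s k
    using concave_above_linear_interp[OF that] that by (auto simp: concave_region_def)
  consider "b = Suc a" | "Suc a < b" "\<forall>j\<in>?S. ?u j = 0" | j where "Suc a < b" "j \<in> ?S" "0 < ?u j"
    using less.prems by (metis Suc_lessI less_eq_real_def)
  then show ?case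
  proof cases
    case 1
    then have "?S = {}" by auto
    moreover have "concave_region a b h = {\<lambda>_. undefined}"
      using \<open>?S = {}\<close> by (auto simp: concave_region_def extensional_def)
    ultimately show ?thesis using 1 by (simp add: emeasure_PiM_empty)
  next
    \<comment> \<open>Here \<open>h\<close> coincides with its chord, so the region is squeezed into
      a null set, and the homogeneous polynomial of positive degree is evaluated at 0.\<close>
    case 2
    have "volume_poly a b ?u = volume_poly a b (\<lambda>i. 0 * ?u i)"
      by (rule volume_poly_cong) (use 2 in auto)
    also have "\<dots> = 0" unfolding volume_poly_scale using 2 by simp
    finally have v: "volume_poly a b ?u = 0" .
    have k: "Suc a \<in> ?S" using 2 by auto
    have "D (Suc a) = 0" using Dsum[OF k] 2 by simp
    then have "s (Suc a) = h (Suc a)" if "s \<in> concave_region a b h" for s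
      using bounds[OF that k] by (simp add: D_def)
    moreover have "AE s in ?M. s (Suc a) \<noteq> h (Suc a)"
      by (rule AE_PiM_coordinate_neq) (use k in auto)
    ultimately have "AE s in ?M. s \<notin> concave_region a b h" by (auto elim!: eventually_mono)
    then have "emeasure ?M (concave_region a b h) = 0"
      using AE_iff_measurable[of "concave_region a b h" ?M "\<lambda>s. s \<notin> concave_region a b h"]
        sets.sets_into_space[OF concave_region_sets[of a b h]] by auto
    then show ?thesis using v by simp
  next
    case (3 j0)
    define n where "n = b - a - 1"
    have n: "0 < n" using 3 by (simp add: n_def)
    have Dpos: "0 < D k" if "k \<in> ?S" for k
      unfolding Dsum[OF that]
      by (rule sum_pos2[OF _ 3(2)])
        (use 3 that less.prems in \<open>auto intro!: mult_pos_pos mult_nonneg_nonneg green_pos less_imp_le[OF green_pos]\<close>)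
    define cone where "cone = (\<lambda>k. {s \<in> concave_region a b h. \<forall>j\<in>?S. (s j - ?l j) * D k \<le> (s k - ?l k) * D j})"
    define P where "P = (\<lambda>k. volume_poly a k ?u * volume_poly k b ?u)"
    have cone_sets: "cone k \<in> sets ?M" if "k \<in> ?S" for k
    proof -
      have "cone k = concave_region a b h \<inter> {s \<in> space ?M. \<forall>j\<in>?S. (s j - ?l j) * D k \<le> (s k - ?l k) * D j}"
        by (auto simp: cone_def space_lborel_PiM concave_region_def)
      moreover have "{s \<in> space ?M. \<forall>j\<in>?S. (s j - ?l j) * D k \<le> (s k - ?l k) * D j} \<in> sets ?M"
      proof (rule sets.sets_Collect_finite_All)
        fix j assume [measurable]: "j \<in> ?S"
        have [measurable]: "k \<in> ?S" by fact
        show "{s \<in> space ?M. (s j - ?l j) * D k \<le> (s k - ?l k) * D j} \<in> sets ?M" by measurable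
      qed simp
      ultimately show ?thesis by auto
    qed
    \<comment> \<open>Outside a null set the ratios are pairwise different, so each point of the
      region lies in exactly one cone.\<close>
    have "AE s in ?M. \<forall>i\<in>?S. \<forall>j\<in>?S. i \<noteq> j \<longrightarrow> s j \<noteq> ?l j + (s i - ?l i) * D j / D i"
    proof (intro AE_finite_allI finite_greaterThanLessThan)
      fix i j assume i: "i \<in> ?S" and j: "j \<in> ?S"
      show "AE s in ?M. i \<noteq> j \<longrightarrow> s j \<noteq> ?l j + (s i - ?l i) * D j / D i"
      proof (cases "i = j")
        case False
        have "AE s in ?M. s j \<noteq> ?l j + (s i - ?l i) * D j / D i"
          by (rule AE_PiM_coordinate_neq) (use i j False in auto)
        then show ?thesis by (auto elim!: eventually_mono)
      qed simp
    qed
    then have ae: "AE s in ?M. indicator (concave_region a b h) s = (\<Sum>k\<in>?S. indicator (cone k) s :: ennreal)"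
    proof (rule eventually_mono)
      fix s assume ne: "\<forall>i\<in>?S. \<forall>j\<in>?S. i \<noteq> j \<longrightarrow> s j \<noteq> ?l j + (s i - ?l i) * D j / D i"
      show "indicator (concave_region a b h) s = (\<Sum>k\<in>?S. indicator (cone k) s :: ennreal)"
      proof (cases "s \<in> concave_region a b h")
        case True
        have "\<exists>!k. k \<in> ?S \<and> (\<forall>j\<in>?S. (s j - ?l j) * D k \<le> (s k - ?l k) * D j)"
        proof (rule ratio_maximizer_unique)
          fix i j assume ij: "i \<in> ?S" "j \<in> ?S" "i \<noteq> j"
          then have "s j \<noteq> ?l j + (s i - ?l i) * D j / D i" using ne by blast
          then show "(s i - ?l i) * D j \<noteq> (s j - ?l j) * D i"
            using Dpos[OF ij(1)] by (auto simp: field_simps)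
        qed (use Dpos 3 in auto)
        moreover have "s \<in> cone k \<longleftrightarrow> (\<forall>j\<in>?S. (s j - ?l j) * D k \<le> (s k - ?l k) * D j)" for k
          using True by (simp add: cone_def)
        ultimately obtain k0 where k0: "k0 \<in> ?S" "s \<in> cone k0" "\<And>k. k \<in> ?S \<Longrightarrow> s \<in> cone k \<Longrightarrow> k = k0"
          by metis
        have "(\<Sum>k\<in>?S. indicator (cone k) s :: ennreal) = (\<Sum>k\<in>?S. if k = k0 then 1 else 0)"
        proof (rule sum.cong[OF refl])
          fix k assume k: "k \<in> ?S"
          have "s \<in> cone k \<longleftrightarrow> k = k0" using k0(2) k0(3)[OF k] by blast
          then show "(indicator (cone k) s :: ennreal) = (if k = k0 then 1 else 0)" by (simp add: indicator_def)
        qed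
        also have "\<dots> = 1" using k0(1) by simp
        finally show ?thesis using True by simp
      next
        case False
        then have "s \<notin> cone k" for k by (simp add: cone_def)
        then show ?thesis using False by simp
      qed
    qed
    have cone_measure: "emeasure ?M (cone k) = ennreal (D k / real n * P k)" if k: "k \<in> ?S" for k
    proof -
      let ?L = "{a<..<k}" and ?R = "{k<..<b}"
      have ins: "?S = insert k (?L \<union> ?R)" and T: "?S - {k} = ?L \<union> ?R" using k by auto
      have Pnn: "0 \<le> P k"
        unfolding P_def by (intro mult_nonneg_nonneg volume_poly_nonneg less.prems) (use k in auto)
      have slice: "(\<integral>\<^sup>+ x. indicator (cone k) (x(k := y)) \<partial>lborel_PiM (?L \<union> ?R)) =
          ennreal (P k * ((y - ?l k) / D k) ^ (n - 1)) * indicator {?l k..?l k + D k} y" for y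
      proof (cases "y \<in> {?l k..?l k + D k}")
        case False
        have "x(k := y) \<notin> cone k" for x
          using bounds[OF _ k, of "x(k := y)"] False by (auto simp: cone_def D_def)
        then show ?thesis using False by simp
      next
        case True
        define r where "r = (y - ?l k) / D k"
        define hy where "hy = (\<lambda>i. ?l i + r * (h i - ?l i))"
        have r: "0 \<le> r" "r \<le> 1" using True Dpos[OF k] by (auto simp: r_def divide_simps)
        have y: "y = ?l k + r * (h k - ?l k)" using Dpos[OF k] by (simp add: r_def D_def)
        have hyd: "second_difference hy i = r * ?u i" if "i \<in> ?S" for i
          unfolding hy_def by (rule second_difference_interp) (rule that)
        have vol: "emeasure (lborel_PiM ?L) (concave_region a k hy) = ennreal (r ^ (k - a - 1) * volume_poly a k ?u)"
          "emeasure (lborel_PiM ?R) (concave_region k b hy) = ennreal (r ^ (b - k - 1) * volume_poly k b ?u)"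
        proof -
          have "emeasure (lborel_PiM ?L) (concave_region a k hy) = ennreal (volume_poly a k (second_difference hy))"
            by (rule less.hyps) (use k hyd r less.prems in auto)
          also have "volume_poly a k (second_difference hy) = volume_poly a k (\<lambda>i. r * ?u i)"
            by (rule volume_poly_cong) (use hyd k in auto)
          finally show "emeasure (lborel_PiM ?L) (concave_region a k hy) = ennreal (r ^ (k - a - 1) * volume_poly a k ?u)"
            unfolding volume_poly_scale .
          have "emeasure (lborel_PiM ?R) (concave_region k b hy) = ennreal (volume_poly k b (second_difference hy))"
            by (rule less.hyps) (use k hyd r less.prems in auto)
          also have "volume_poly k b (second_difference hy) = volume_poly k b (\<lambda>i. r * ?u i)"
            by (rule volume_poly_cong) (use hyd k in auto)
          finally show "emeasure (lborel_PiM ?R) (concave_region k b hy) = ennreal (r ^ (b - k - 1) * volume_poly k b ?u)"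
            unfolding volume_poly_scale .
        qed
        have "(\<integral>\<^sup>+ x. indicator (cone k) (x(k := y)) \<partial>lborel_PiM (?L \<union> ?R)) =
          (\<integral>\<^sup>+ x. indicator (concave_region a k hy) (restrict x ?L) * indicator (concave_region k b hy) (restrict x ?R)
             \<partial>lborel_PiM (?L \<union> ?R))"
        proof (rule nn_integral_cong)
          fix x assume "x \<in> space (lborel_PiM (?L \<union> ?R))"
          then have x: "x \<in> extensional (?S - {k})" unfolding T by (simp add: space_lborel_PiM)
          have "x(k := y) \<in> cone k \<longleftrightarrow> restrict x ?L \<in> concave_region a k hy \<and> restrict x ?R \<in> concave_region k b hy"
            using concave_cone_slice[OF k less.prems(2) x r y] Dpos[OF k]
            unfolding hy_def cone_def D_def by simp
          then show "(indicator (cone k) (x(k := y)) :: ennreal) =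
            indicator (concave_region a k hy) (restrict x ?L) * indicator (concave_region k b hy) (restrict x ?R)"
            by (auto split: split_indicator)
        qed
        also have "\<dots> = emeasure (lborel_PiM ?L) (concave_region a k hy) * emeasure (lborel_PiM ?R) (concave_region k b hy)"
          by (rule emeasure_PiM_product) auto
        also have "\<dots> = ennreal ((r ^ (k - a - 1) * volume_poly a k ?u) * (r ^ (b - k - 1) * volume_poly k b ?u))"
          unfolding vol
          by (rule ennreal_mult[symmetric]; intro mult_nonneg_nonneg volume_poly_nonneg zero_le_power r less.prems)
            (use k in auto)
        also have "(r ^ (k - a - 1) * volume_poly a k ?u) * (r ^ (b - k - 1) * volume_poly k b ?u) = P k * r ^ (n - 1)"
        proof -
          have "n - 1 = (k - a - 1) + (b - k - 1)" using k by (auto simp: n_def)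
          then show ?thesis by (simp add: P_def power_add)
        qed
        finally show ?thesis unfolding r_def indicator_simps(1)[OF True] mult_1_right .
      qed
      have "emeasure ?M (cone k) = (\<integral>\<^sup>+ s. indicator (cone k) s \<partial>?M)"
        using cone_sets[OF k] by simp
      also have "\<dots> = (\<integral>\<^sup>+ y. \<integral>\<^sup>+ x. indicator (cone k) (x(k := y)) \<partial>lborel_PiM (?L \<union> ?R) \<partial>lborel)"
        unfolding ins
        by (rule lborel_product.product_nn_integral_insert_rev)
          (use cone_sets[OF k] ins in auto)
      also have "\<dots> = ennreal (D k / (real (n - 1) + 1) * P k)"
        unfolding slice by (rule nn_integral_scaled_power) (use Dpos[OF k] Pnn in auto)
      also have "real (n - 1) + 1 = real n" using n by (simp add: of_nat_diff)
      finally show ?thesis .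
    qed
    have "emeasure ?M (concave_region a b h) = (\<integral>\<^sup>+ s. indicator (concave_region a b h) s \<partial>?M)"
      by simp
    also have "\<dots> = (\<integral>\<^sup>+ s. (\<Sum>k\<in>?S. indicator (cone k) s) \<partial>?M)"
      by (rule nn_integral_cong_AE) (rule ae)
    also have "\<dots> = (\<Sum>k\<in>?S. \<integral>\<^sup>+ s. indicator (cone k) s \<partial>?M)"
      by (rule nn_integral_sum) (use cone_sets in auto)
    also have "\<dots> = (\<Sum>k\<in>?S. emeasure ?M (cone k))"
      using cone_sets by (intro sum.cong) auto
    also have "\<dots> = (\<Sum>k\<in>?S. ennreal (D k / real n * P k))"
      using cone_measure by (intro sum.cong) auto
    also have "\<dots> = ennreal (\<Sum>k\<in>?S. D k / real n * P k)"
    proof (rule sum_ennreal)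
      fix k assume k: "k \<in> ?S"
      show "0 \<le> D k / real n * P k"
        unfolding P_def using Dpos[OF k]
        by (intro mult_nonneg_nonneg volume_poly_nonneg less.prems) (use k in auto)
    qed
    also have "(\<Sum>k\<in>?S. D k / real n * P k) = (\<Sum>k\<in>?S. (\<Sum>j\<in>?S. green a b j k * ?u j) * P k) / real n"
      unfolding sum_divide_distrib by (rule sum.cong) (use Dsum in auto)
    also have "\<dots> = volume_poly a b ?u"
      using volume_poly_recursion[OF 3(1), of ?u] n unfolding P_def n_def by (simp add: field_simps)
    finally show ?thesis .
  qed
qed

section \<open>Minkowski sums of hypersimplices\<close>

lemma sum_fun_apply: "(sum f A :: 'a \<Rightarrow> 'b::comm_monoid_add) x = (\<Sum>a\<in>A. f a x)"
  by (induction A rule: infinite_finite_induct) auto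

text \<open>Rado's theorem by transfers in the manner of Hardy, Littlewood and Polya. Moving an
  amount \<open>d\<close> from a coordinate \<open>j\<close> where \<open>x\<close> is too large to
  a later \<open>k\<close> where it is too small is a convex combination of \<open>x\<close> and a
  transposed copy, and makes at least one more coordinate agree with \<open>t\<close>.\<close>

lemma majorization_exchange:
  fixes Q :: "(nat \<Rightarrow> real) set"
  assumes "convex Q"
    and swap: "\<And>x a b. x \<in> Q \<Longrightarrow> a \<in> {1..m} \<Longrightarrow> b \<in> {1..m} \<Longrightarrow> x \<circ> Transposition.transpose a b \<in> Q"
    and anti: "\<And>i j. 1 \<le> i \<Longrightarrow> i \<le> j \<Longrightarrow> j \<le> m \<Longrightarrow> t j \<le> t i"
    and "x \<in> Q"
    and "\<And>k. k \<le> m \<Longrightarrow> sum t {1..k} \<le> sum x {1..k}"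
    and "sum t {1..m} = sum x {1..m}"
    and "\<And>i. i \<notin> {1..m} \<Longrightarrow> t i = x i"
  shows "t \<in> Q"
  using assms(4-)
proof (induction "card {i\<in>{1..m}. t i \<noteq> x i}" arbitrary: x rule: less_induct)
  case less
  show ?case
  proof (cases "\<exists>i\<in>{1..m}. t i \<noteq> x i")
    case False
    then have "t = x" using less.prems(4) by (auto simp: fun_eq_iff)
    then show ?thesis using less.prems by simp
  next
    case True
    have "\<exists>k. k \<in> {1..m} \<and> x k < t k"
    proof (rule ccontr)
      assume "\<nexists>k. k \<in> {1..m} \<and> x k < t k"
      then have le: "t i \<le> x i" if "i \<in> {1..m}" for i using that by force
      obtain i where i: "i \<in> {1..m}" "t i \<noteq> x i" using True by blast
      have "sum t {1..m} < sum x {1..m}"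
        by (rule sum_strict_mono_ex1) (use le i in \<open>auto simp: order.strict_iff_order\<close>)
      then show False using less.prems(3) by simp
    qed
    note ex = this
    define k where "k = (LEAST k. k \<in> {1..m} \<and> x k < t k)"
    have k: "k \<in> {1..m}" "x k < t k" using LeastI_ex[OF ex] unfolding k_def by blast+
    have kmin: "k \<le> i" if "i \<in> {1..m}" "x i < t i" for i
      unfolding k_def by (rule Least_le) (use that in blast)
    have ge: "t i \<le> x i" if "1 \<le> i" "i < k" for i
      using kmin[of i] that k by force
    \<comment> \<open>Since \<open>x\<close> falls short at \<open>k\<close>, the prefix inequality
      at \<open>k\<close> forces a surplus at an earlier coordinate.\<close>
    have "\<exists>j. 1 \<le> j \<and> j < k \<and> t j < x j"
    proof (rule ccontr)
      assume "\<nexists>j. 1 \<le> j \<and> j < k \<and> t j < x j"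
      then have eq: "x i = t i" if "1 \<le> i" "i < k" for i using ge[OF that] that by force
      have "sum x {1..k} < sum t {1..k}"
      proof (rule sum_strict_mono_ex1)
        show "\<forall>i\<in>{1..k}. x i \<le> t i"
        proof
          fix i assume "i \<in> {1..k}"
          then show "x i \<le> t i" using eq[of i] k by (cases "i = k") auto
        qed
      qed (use k in auto)
      then show False using less.prems(2)[of k] k by auto
    qed
    then obtain j where j: "1 \<le> j" "j < k" "t j < x j" by blast
    \<comment> \<open>The minimum makes one of the two coordinates agree with \<open>t\<close> and
      overshoots at neither.\<close>
    define d where "d = min (x j - t j) (t k - x k)"
    have d: "0 < d" "d \<le> x j - t j" "d \<le> t k - x k" using j k by (auto simp: d_def)
    have tjk: "t k \<le> t j" using anti[of j k] j k by auto
    define l where "l = d / (x j - x k)"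
    have xjk: "0 < x j - x k" using tjk j k by auto
    have l: "0 \<le> l" "l \<le> 1" "l * (x j - x k) = d" using d tjk xjk by (auto simp: l_def divide_simps)
    define x' where "x' = (\<lambda>i. x i + (if i = j then - d else 0) + (if i = k then d else 0))"
    have "x' = (1 - l) *\<^sub>R x + l *\<^sub>R (x \<circ> Transposition.transpose j k)"
    proof
      fix i
      consider "i = j" | "i = k" | "i \<noteq> j" "i \<noteq> k" by blast
      then show "x' i = ((1 - l) *\<^sub>R x + l *\<^sub>R (x \<circ> Transposition.transpose j k)) i"
        using j l(3) by cases (auto simp: x'_def scaleR_fun_def algebra_simps)
    qed
    also have "\<dots> \<in> Q"
      by (rule convexD[OF assms(1)]) (use less.prems(1) swap j k l in auto)
    finally have x'Q: "x' \<in> Q" .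
    have sumx': "sum x' {1..q} = sum x {1..q} + (if j \<le> q then - d else 0) + (if k \<le> q then d else 0)" for q
      unfolding x'_def using j k by (simp add: sum.distrib)
    show ?thesis
    proof (rule less.hyps[OF _ x'Q])
      have "x' j = t j \<or> x' k = t k" using j by (auto simp: x'_def d_def min_def)
      moreover have jk: "t j \<noteq> x j" "t k \<noteq> x k" "j \<in> {1..m}" "k \<in> {1..m}" using j k by auto
      ultimately have "\<exists>i\<in>{i\<in>{1..m}. t i \<noteq> x i}. i \<notin> {i\<in>{1..m}. t i \<noteq> x' i}" by auto
      moreover have "{i\<in>{1..m}. t i \<noteq> x' i} \<subseteq> {i\<in>{1..m}. t i \<noteq> x i}"
      proof
        fix i assume "i \<in> {i\<in>{1..m}. t i \<noteq> x' i}"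
        then show "i \<in> {i\<in>{1..m}. t i \<noteq> x i}"
          using jk by (cases "i = j \<or> i = k") (auto simp: x'_def)
      qed
      ultimately have "{i\<in>{1..m}. t i \<noteq> x' i} \<subset> {i\<in>{1..m}. t i \<noteq> x i}" by blast
      then show "card {i\<in>{1..m}. t i \<noteq> x' i} < card {i\<in>{1..m}. t i \<noteq> x i}"
        by (rule psubset_card_mono[rotated]) simp
    next
      fix q assume q: "q \<le> m"
      show "sum t {1..q} \<le> sum x' {1..q}"
      proof (cases "j \<le> q \<and> q < k")
        case True
        \<comment> \<open>Before \<open>k\<close> no coordinate of \<open>x\<close> is below that of
          \<open>t\<close>, so the surplus at \<open>j\<close> alone covers the amount taken
          away.\<close>
        have "x j - t j \<le> (\<Sum>i\<in>{1..q}. x i - t i)"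
          by (rule member_le_sum[of j "{1..q}" "\<lambda>i. x i - t i"]) (use True j ge in auto)
        then show ?thesis using True d unfolding sumx' by (simp add: sum_subtractf)
      next
        case False
        then show ?thesis using less.prems(2)[OF q] j unfolding sumx' by auto
      qed
    next
      show "sum t {1..m} = sum x' {1..m}" using less.prems(3) j k unfolding sumx' by auto
      show "t i = x' i" if "i \<notin> {1..m}" for i using less.prems(4)[OF that] that j k by (auto simp: x'_def)
    qed
  qed
qed

text \<open>A minimizer of \<open>\<Sum>i. i * t (p i)\<close> cannot be improved by an adjacent transposition.\<close>

lemma exists_sorting_permutation:
  fixes t :: "nat \<Rightarrow> real"
  shows "\<exists>p. p permutes {1..m} \<and> (\<forall>i\<in>{1..<m}. t (p (i + 1)) \<le> t (p i))"
proof -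
  let ?F = "\<lambda>p. \<Sum>i\<in>{1..m}. real i * t (p i)"
  have "finite {p. p permutes {1..m}}" by (simp add: finite_permutations)
  moreover have "{p. p permutes {1..m}} \<noteq> {}" using permutes_id by blast
  ultimately obtain p where p: "p permutes {1..m}" and pmin: "\<And>q. q permutes {1..m} \<Longrightarrow> ?F p \<le> ?F q"
    using ex_is_arg_min_if_finite[of "{p. p permutes {1..m}}" ?F] unfolding is_arg_min_linorder by auto
  have "t (p (i + 1)) \<le> t (p i)" if i: "i \<in> {1..<m}" for i
  proof -
    let ?q = "p \<circ> Transposition.transpose i (i + 1)"
    have q: "?q permutes {1..m}"
      by (rule permutes_compose[OF _ p]) (use i in \<open>auto intro: permutes_swap_id\<close>)
    have S: "{1..m} = insert i (insert (i + 1) ({1..m} - {i, i + 1}))" using i by auto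
    have split: "sum f {1..m} = f i + (f (i + 1) + sum f ({1..m} - {i, i + 1}))" for f :: "nat \<Rightarrow> real"
      by (subst S) (subst sum.insert; simp)+
    have "(\<Sum>j\<in>{1..m} - {i, i + 1}. real j * t (?q j)) = (\<Sum>j\<in>{1..m} - {i, i + 1}. real j * t (p j))"
      by (rule sum.cong) (auto simp: Transposition.transpose_def)
    moreover have "?F p \<le> ?F ?q" by (rule pmin[OF q])
    ultimately show ?thesis unfolding split by (simp add: algebra_simps)
  qed
  then show ?thesis using p by blast
qed

section \<open>The Minkowski sum described by inequalities\<close>

definition vertex_set :: "nat \<Rightarrow> nat \<Rightarrow> (nat \<Rightarrow> real) set" where
  "vertex_set k m = {v. (\<forall>i. v i \<in> {0, 1}) \<and> (\<forall>i. i \<notin> {1..m} \<longrightarrow> v i = 0) \<and> card {i. v i = 1} = k}"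

text \<open>For concave \<open>h\<close> with \<open>h 0 = 0\<close> this is the base polytope of
  the submodular set function that sends \<open>I\<close> to \<open>h (card I)\<close>, that is, a
  permutohedron given by its inequalities.\<close>

definition majorized :: "nat \<Rightarrow> (nat \<Rightarrow> real) \<Rightarrow> (nat \<Rightarrow> real) set" where
  "majorized m h = {t. (\<forall>i. i \<notin> {1..m} \<longrightarrow> t i = 0) \<and> (\<forall>I. I \<subseteq> {1..m} \<longrightarrow> sum t I \<le> h (card I)) \<and> sum t {1..m} = h m}"

lemma convex_majorized: "convex (majorized m h)"
proof (rule convexI)
  fix x y :: "nat \<Rightarrow> real" and u v :: real
  assume x: "x \<in> majorized m h" and y: "y \<in> majorized m h" and uv: "0 \<le> u" "0 \<le> v" "u + v = 1"
  have s: "sum (u *\<^sub>R x + v *\<^sub>R y) I = u * sum x I + v * sum y I" for I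
    by (simp add: scaleR_fun_def sum.distrib sum_distrib_left)
  have c: "u * c + v * c = c" for c using uv by (metis distrib_right mult_1)
  have "u * sum x I + v * sum y I \<le> h (card I)" if "I \<subseteq> {1..m}" for I
    using mult_left_mono[OF _ uv(1), of "sum x I" "h (card I)"] mult_left_mono[OF _ uv(2), of "sum y I" "h (card I)"]
      x y that c[of "h (card I)"] unfolding majorized_def by force
  moreover have "(u *\<^sub>R x + v *\<^sub>R y) i = 0" if "i \<notin> {1..m}" for i
    using x y that unfolding majorized_def by (simp add: scaleR_fun_def)
  moreover have "u * sum x {1..m} + v * sum y {1..m} = h m" using x y c[of "h m"] by (simp add: majorized_def)
  ultimately show "u *\<^sub>R x + v *\<^sub>R y \<in> majorized m h" unfolding majorized_def mem_Collect_eq s by blast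
qed

lemma vertex_set_majorized:
  assumes "k \<le> m"
  shows "vertex_set k m \<subseteq> majorized m (\<lambda>i. real (min k i))"
proof
  fix v assume v: "v \<in> vertex_set k m"
  have sum: "sum v I = real (card {i\<in>I. v i = 1})" if "finite I" for I
  proof -
    have "sum v I = (\<Sum>i\<in>I. if v i = 1 then 1 else 0)" using v by (intro sum.cong) (auto simp: vertex_set_def)
    then show ?thesis using that by (simp flip: sum.inter_filter)
  qed
  have sub: "{i. v i = 1} \<subseteq> {1..m}" using v by (force simp: vertex_set_def)
  have "{i\<in>{1..m}. v i = 1} = {i. v i = 1}" using sub by auto
  then have "sum v {1..m} = real (min k m)" using sum[of "{1..m}"] v assms by (simp add: vertex_set_def)
  moreover have "sum v I \<le> real (min k (card I))" if "I \<subseteq> {1..m}" for I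
  proof -
    have f: "finite I" using that finite_subset by blast
    have "card {i\<in>I. v i = 1} \<le> card I" by (rule card_mono) (use f in auto)
    moreover have "card {i\<in>I. v i = 1} \<le> card {i. v i = 1}"
      by (rule card_mono) (use sub finite_subset in auto)
    ultimately show ?thesis using sum[OF f] v by (auto simp: vertex_set_def)
  qed
  ultimately show "v \<in> majorized m (\<lambda>i. real (min k i))" using v by (auto simp: majorized_def vertex_set_def)
qed

lemma hypersimplex_alt: "hypersimplex k m = convex hull (vertex_set k m)"
  by (simp add: hypersimplex_def vertex_set_def)

lemma hypersimplex_subset_majorized:
  "k \<le> m \<Longrightarrow> hypersimplex k m \<subseteq> majorized m (\<lambda>i. real (min k i))"
  unfolding hypersimplex_alt by (intro hull_minimal vertex_set_majorized convex_majorized)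

lemma hypersimplex_sum_iff:
  "t \<in> hypersimplex_sum n u \<longleftrightarrow>
   (\<exists>s. (\<forall>k\<in>{1..n}. s k \<in> hypersimplex k (n + 1)) \<and> t = (\<lambda>i. \<Sum>k=1..n. u k * s k i))"
proof -
  have "t \<in> hypersimplex_sum n u \<longleftrightarrow> (\<exists>r. (\<forall>k\<in>{1..n}. r k \<in> (\<lambda>t. u k *\<^sub>R t) ` hypersimplex k (n + 1)) \<and> t = sum r {1..n})"
    unfolding hypersimplex_sum_def by (subst set_sum_alt) auto
  also have "\<dots> \<longleftrightarrow> (\<exists>s. (\<forall>k\<in>{1..n}. s k \<in> hypersimplex k (n + 1)) \<and> t = (\<lambda>i. \<Sum>k=1..n. u k * s k i))"
  proof
    assume "\<exists>r. (\<forall>k\<in>{1..n}. r k \<in> (\<lambda>t. u k *\<^sub>R t) ` hypersimplex k (n + 1)) \<and> t = sum r {1..n}"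
    then obtain r where r: "\<forall>k\<in>{1..n}. \<exists>s. s \<in> hypersimplex k (n + 1) \<and> r k = u k *\<^sub>R s" "t = sum r {1..n}"
      by blast
    then obtain s where s: "\<forall>k\<in>{1..n}. s k \<in> hypersimplex k (n + 1) \<and> r k = u k *\<^sub>R s k" by metis
    have "t = (\<lambda>i. \<Sum>k=1..n. u k * s k i)"
      unfolding r(2) fun_eq_iff sum_fun_apply using s by (intro allI sum.cong) (auto simp: scaleR_fun_def)
    then show "\<exists>s. (\<forall>k\<in>{1..n}. s k \<in> hypersimplex k (n + 1)) \<and> t = (\<lambda>i. \<Sum>k=1..n. u k * s k i)"
      using s by blast
  next
    assume "\<exists>s. (\<forall>k\<in>{1..n}. s k \<in> hypersimplex k (n + 1)) \<and> t = (\<lambda>i. \<Sum>k=1..n. u k * s k i)"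
    then obtain s where s: "\<forall>k\<in>{1..n}. s k \<in> hypersimplex k (n + 1)" "t = (\<lambda>i. \<Sum>k=1..n. u k * s k i)" by blast
    have "t = sum (\<lambda>k. u k *\<^sub>R s k) {1..n}"
      unfolding s(2) fun_eq_iff sum_fun_apply by (simp add: scaleR_fun_def)
    then show "\<exists>r. (\<forall>k\<in>{1..n}. r k \<in> (\<lambda>t. u k *\<^sub>R t) ` hypersimplex k (n + 1)) \<and> t = sum r {1..n}"
      using s(1) by (intro exI[of _ "\<lambda>k. u k *\<^sub>R s k"]) auto
  qed
  finally show ?thesis .
qed

lemma convex_hypersimplex_sum: "convex (hypersimplex_sum n u)"
  unfolding hypersimplex_sum_def hypersimplex_def
  by (intro convex_set_sum convex_scaling convex_convex_hull)

lemma hypersimplex_permute: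
  assumes p: "p permutes {1..m}" and t: "t \<in> hypersimplex k m"
  shows "t \<circ> p \<in> hypersimplex k m"
proof -
  have lin: "linear (\<lambda>x :: nat \<Rightarrow> real. x \<circ> p)"
    by (rule linearI) (auto simp: fun_eq_iff scaleR_fun_def)
  have "(\<lambda>x. x \<circ> p) ` vertex_set k m \<subseteq> vertex_set k m"
  proof (rule image_subsetI)
    fix v assume v: "v \<in> vertex_set k m"
    have "{i. (v \<circ> p) i = 1} = p -` {i. v i = 1}" by auto
    moreover have "card (p -` {i. v i = 1}) = card {i. v i = 1}"
      by (rule card_vimage_inj) (use permutes_inj[OF p] permutes_surj[OF p] in auto)
    moreover have "v (p i) = 0" if "i \<notin> {1..m}" for i
      using that v p by (simp add: vertex_set_def permutes_not_in)
    ultimately show "v \<circ> p \<in> vertex_set k m" using v by (auto simp: vertex_set_def)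
  qed
  then have "convex hull ((\<lambda>x. x \<circ> p) ` vertex_set k m) \<subseteq> convex hull vertex_set k m" by (rule hull_mono)
  then have "(\<lambda>x. x \<circ> p) ` (convex hull vertex_set k m) \<subseteq> convex hull vertex_set k m"
    by (simp only: convex_hull_linear_image[OF lin])
  then show ?thesis using t unfolding hypersimplex_alt by blast
qed

lemma hypersimplex_sum_permute:
  assumes "p permutes {1..n + 1}" "t \<in> hypersimplex_sum n u"
  shows "t \<circ> p \<in> hypersimplex_sum n u"
proof -
  obtain s where s: "\<forall>k\<in>{1..n}. s k \<in> hypersimplex k (n + 1)" "t = (\<lambda>i. \<Sum>k=1..n. u k * s k i)"
    using assms(2) unfolding hypersimplex_sum_iff by blast
  show ?thesis unfolding hypersimplex_sum_iff
    by (rule exI[of _ "\<lambda>k. s k \<circ> p"]) (use s hypersimplex_permute[OF assms(1)] in \<open>auto simp: fun_eq_iff\<close>)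
qed

text \<open>For nonnegative \<open>u\<close> and \<open>i \<le> n + 1\<close>, the largest sum of
  \<open>i\<close> coordinates on the Minkowski sum: on a single hypersimplex the maximum is
  \<open>min k i\<close>, and maxima of linear functions add up.\<close>

definition support_height :: "nat \<Rightarrow> (nat \<Rightarrow> real) \<Rightarrow> nat \<Rightarrow> real" where
  "support_height n u i = (\<Sum>k=1..n. u k * real (min k i))"

lemma hypersimplex_sum_subset:
  assumes "\<And>k. k \<in> {1..n} \<Longrightarrow> 0 \<le> u k"
  shows "hypersimplex_sum n u \<subseteq> majorized (n + 1) (support_height n u)"
proof
  fix t assume "t \<in> hypersimplex_sum n u"
  then obtain s where s: "\<forall>k\<in>{1..n}. s k \<in> hypersimplex k (n + 1)" "t = (\<lambda>i. \<Sum>k=1..n. u k * s k i)"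
    unfolding hypersimplex_sum_iff by blast
  have sm: "s k \<in> majorized (n + 1) (\<lambda>i. real (min k i))" if "k \<in> {1..n}" for k
    using hypersimplex_subset_majorized[of k "n + 1"] s(1) that by auto
  have sum: "sum t I = (\<Sum>k=1..n. u k * sum (s k) I)" for I
    unfolding s(2) by (subst sum.swap) (simp add: sum_distrib_left)
  have "sum t I \<le> support_height n u (card I)" if "I \<subseteq> {1..n + 1}" for I
    unfolding sum support_height_def
    by (intro sum_mono mult_left_mono) (use sm that assms in \<open>auto simp: majorized_def\<close>)
  moreover have "sum t {1..n + 1} = support_height n u (n + 1)"
    unfolding sum support_height_def
    by (intro sum.cong refl) (use sm in \<open>auto simp: majorized_def\<close>)
  moreover have "t i = 0" if "i \<notin> {1..n + 1}" for i
    unfolding s(2) by (rule sum.neutral) (use sm that in \<open>auto simp: majorized_def\<close>)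
  ultimately show "t \<in> majorized (n + 1) (support_height n u)" by (auto simp: majorized_def)
qed

lemma majorized_permute:
  assumes p: "p permutes {1..m}" and t: "t \<in> majorized m h"
  shows "t \<circ> p \<in> majorized m h"
proof -
  have inj: "inj_on p I" for I using permutes_inj[OF p] by (rule inj_on_subset) simp
  have s: "sum (t \<circ> p) I = sum t (p ` I)" for I using sum.reindex[OF inj, of t I] by simp
  have "sum (t \<circ> p) I \<le> h (card I)" if "I \<subseteq> {1..m}" for I
  proof -
    have "p ` I \<subseteq> {1..m}" using that permutes_image[OF p] by blast
    then have "sum t (p ` I) \<le> h (card (p ` I))" using t unfolding majorized_def by blast
    then show ?thesis using s[of I] card_image[OF inj, of I] by simp
  qed
  moreover have "sum (t \<circ> p) {1..m} = h m" using t s[of "{1..m}"] permutes_image[OF p] by (simp add: majorized_def)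
  moreover have "(t \<circ> p) i = 0" if "i \<notin> {1..m}" for i
    using that t p by (simp add: majorized_def permutes_not_in)
  ultimately show ?thesis by (auto simp: majorized_def)
qed

text \<open>One inclusion bounds coordinate sums summand by summand. For the other, \<open>t\<close>
  may be sorted by symmetry; it is then majorized by the vertex at which all prefix bounds are
  tight, and the Minkowski sum is convex and symmetric.\<close>

lemma hypersimplex_sum_eq_majorized:
  assumes "\<And>k. k \<in> {1..n} \<Longrightarrow> 0 \<le> u k"
  shows "hypersimplex_sum n u = majorized (n + 1) (support_height n u)"
proof (intro equalityI hypersimplex_sum_subset assms subsetI)
  fix t assume t: "t \<in> majorized (n + 1) (support_height n u)"
  obtain p where p: "p permutes {1..n + 1}" and sorted: "\<And>i. i \<in> {1..<n + 1} \<Longrightarrow> t (p (i + 1)) \<le> t (p i)"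
    using exists_sorting_permutation[of "n + 1" t] by blast
  \<comment> \<open>The indicator of the first \<open>k\<close> sites is the vertex of the
    hypersimplex that maximizes all prefix sums at once.\<close>
  define e :: "nat \<Rightarrow> nat \<Rightarrow> real" where "e = (\<lambda>k i. if i \<in> {1..k} then 1 else 0 :: real)"
  define x where "x = (\<lambda>i. \<Sum>k=1..n. u k * e k i)"
  have e: "e k \<in> hypersimplex k (n + 1)" if "k \<in> {1..n}" for k
  proof -
    have "{i. e k i = 1} = {1..k}" by (auto simp: e_def)
    then have "e k \<in> vertex_set k (n + 1)" using that by (auto simp: vertex_set_def e_def)
    then show ?thesis unfolding hypersimplex_alt by (rule hull_inc)
  qed
  have xQ: "x \<in> hypersimplex_sum n u" unfolding hypersimplex_sum_iff x_def using e by blast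
  have esum: "sum (e k) {1..i} = real (min k i)" for k i
  proof -
    have "sum (e k) {1..i} = (\<Sum>_\<in>{1..i} \<inter> {1..k}. 1)"
      unfolding e_def by (rule sum.inter_restrict[symmetric]) simp
    also have "{1..i} \<inter> {1..k} = {1..min k i}" by auto
    finally show ?thesis by simp
  qed
  have xsum: "sum x {1..i} = support_height n u i" for i
  proof -
    have "sum x {1..i} = (\<Sum>k=1..n. u k * sum (e k) {1..i})"
      unfolding x_def by (subst sum.swap) (simp add: sum_distrib_left)
    then show ?thesis by (simp only: esum support_height_def)
  qed
  have tp: "t \<circ> p \<in> majorized (n + 1) (support_height n u)" by (rule majorized_permute[OF p t])
  have "t \<circ> p \<in> hypersimplex_sum n u"
  proof (rule majorization_exchange[OF convex_hypersimplex_sum _ _ xQ, where m = "n + 1"])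
    fix y a b assume "y \<in> hypersimplex_sum n u" "a \<in> {1..n + 1}" "b \<in> {1..n + 1}"
    then show "y \<circ> Transposition.transpose a b \<in> hypersimplex_sum n u"
      by (intro hypersimplex_sum_permute permutes_swap_id)
  next
    fix i j :: nat assume ij: "1 \<le> i" "i \<le> j" "j \<le> n + 1"
    show "(t \<circ> p) j \<le> (t \<circ> p) i"
      using ij(2,3)
    proof (induction j rule: dec_induct)
      case (step j)
      then show ?case using sorted[of j] ij(1) by force
    qed simp
  next
    fix k assume "k \<le> n + 1"
    then have "sum (t \<circ> p) {1..k} \<le> support_height n u (card {1..k})"
      using tp unfolding majorized_def mem_Collect_eq by (metis atLeastatMost_subset_iff order_refl)
    then show "sum (t \<circ> p) {1..k} \<le> sum x {1..k}" unfolding xsum by simp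
  next
    show "sum (t \<circ> p) {1..n + 1} = sum x {1..n + 1}" unfolding xsum using tp by (simp add: majorized_def)
  next
    fix i assume i: "i \<notin> {1..n + 1}"
    have "x i = 0" unfolding x_def by (rule sum.neutral) (use i in \<open>auto simp: e_def\<close>)
    then show "(t \<circ> p) i = x i" using tp i by (simp add: majorized_def)
  qed
  then have "(t \<circ> p) \<circ> inv p \<in> hypersimplex_sum n u"
    by (rule hypersimplex_sum_permute[OF permutes_inv[OF p]])
  moreover have "(t \<circ> p) \<circ> inv p = t" using permutes_inv_o(1)[OF p] by (simp add: comp_assoc)
  ultimately show "t \<in> hypersimplex_sum n u" by simp
qed

section \<open>Chambers of the permutohedron\<close>

definition measure_preserving_on :: "'a measure \<Rightarrow> ('a \<Rightarrow> 'a) \<Rightarrow> bool" where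
  "measure_preserving_on M f \<longleftrightarrow> f \<in> measurable M M \<and> (\<forall>A\<in>sets M. emeasure M (f -` A \<inter> space M) = emeasure M A)"

lemma measure_preserving_on_comp:
  assumes f: "measure_preserving_on M f" and g: "measure_preserving_on M g"
  shows "measure_preserving_on M (g \<circ> f)"
proof -
  have m: "f \<in> measurable M M" "g \<in> measurable M M" using f g by (auto simp: measure_preserving_on_def)
  have "emeasure M ((g \<circ> f) -` A \<inter> space M) = emeasure M A" if A: "A \<in> sets M" for A
  proof -
    have "(g \<circ> f) -` A \<inter> space M = f -` (g -` A \<inter> space M) \<inter> space M"
      using measurable_space[OF m(1)] by auto
    also have "emeasure M \<dots> = emeasure M (g -` A \<inter> space M)"
      using f measurable_sets[OF m(2) A] unfolding measure_preserving_on_def by blast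
    also have "\<dots> = emeasure M A" using g A by (simp add: measure_preserving_on_def)
    finally show ?thesis .
  qed
  then show ?thesis using measurable_comp[OF m] by (simp add: measure_preserving_on_def)
qed

lemma measure_preserving_on_cong:
  assumes "\<And>x. x \<in> space M \<Longrightarrow> f x = g x"
  shows "measure_preserving_on M f \<longleftrightarrow> measure_preserving_on M g"
proof -
  have "f -` A \<inter> space M = g -` A \<inter> space M" for A using assms by auto
  moreover have "f \<in> measurable M M \<longleftrightarrow> g \<in> measurable M M" by (rule measurable_cong) (rule assms)
  ultimately show ?thesis by (simp add: measure_preserving_on_def)
qed

lemma measure_preserving_on_id: "measure_preserving_on M (\<lambda>x. x)"
proof -
  have "(\<lambda>x. x) -` A \<inter> space M = A" if "A \<in> sets M" for A using sets.sets_into_space[OF that] by auto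
  then show ?thesis by (simp add: measure_preserving_on_def)
qed

text \<open>By Fubini only the lines in direction \<open>a\<close> matter, and on each the map is a
  translation, combined with a reflection if \<open>c = - 1\<close>. The value \<open>1\<close>
  serves the shears, \<open>- 1\<close> the exchange with the dependent coordinate.\<close>

lemma measure_preserving_on_coordinate:
  fixes g :: "(nat \<Rightarrow> real) \<Rightarrow> real"
  assumes "finite I" "a \<in> I" and g: "g \<in> borel_measurable (lborel_PiM I)"
    and indep: "\<And>s x. g (s(a := x)) = g s" and c: "\<bar>c\<bar> = 1"
  shows "measure_preserving_on (lborel_PiM I) (\<lambda>s. s(a := g s + c * s a))"
proof -
  let ?M = "lborel_PiM I" and ?f = "\<lambda>s. s(a := g s + c * s a)"
  have co: "(\<lambda>s. s a) \<in> borel_measurable ?M" using assms(2) by measurable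
  have "(\<lambda>s. g s + c * s a) \<in> measurable ?M lborel" using g co by simp
  then have f: "?f \<in> measurable ?M ?M"
    by (intro measurable_fun_upd[of I I a]) (use assms(2) in auto)
  have I: "insert a (I - {a}) = I" using assms by auto
  have "emeasure ?M (?f -` A \<inter> space ?M) = emeasure ?M A" if A: "A \<in> sets ?M" for A
  proof -
    let ?B = "?f -` A \<inter> space ?M"
    have B: "?B \<in> sets ?M" by (rule measurable_sets[OF f A])
    have fub: "emeasure ?M X = (\<integral>\<^sup>+ s. \<integral>\<^sup>+ x. indicator X (s(a := x)) \<partial>lborel \<partial>lborel_PiM (I - {a}))"
      if X: "X \<in> sets ?M" for X
    proof -
      have "emeasure ?M X = (\<integral>\<^sup>+ s. indicator X s \<partial>lborel_PiM (insert a (I - {a})))" using X I by simp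
      also have "\<dots> = (\<integral>\<^sup>+ s. \<integral>\<^sup>+ x. indicator X (s(a := x)) \<partial>lborel \<partial>lborel_PiM (I - {a}))"
        by (rule lborel_product.product_nn_integral_insert) (use assms X I in auto)
      finally show ?thesis .
    qed
    show ?thesis unfolding fub[OF B] fub[OF A]
    proof (rule nn_integral_cong)
      fix s assume s: "s \<in> space (lborel_PiM (I - {a}))"
      have upd: "(\<lambda>x. s(a := x)) \<in> measurable lborel ?M"
        by (rule measurable_fun_upd[where J = "I - {a}"]) (use s assms in auto)
      have m: "(\<lambda>x. indicator A (s(a := x)) :: ennreal) \<in> borel_measurable borel"
        using measurable_compose[OF upd borel_measurable_indicator[OF A]] by simp
      have "(\<integral>\<^sup>+ x. indicator ?B (s(a := x)) \<partial>lborel) = (\<integral>\<^sup>+ x. indicator A (s(a := g s + c * x)) \<partial>lborel)"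
      proof (rule nn_integral_cong)
        fix x :: real
        have "s(a := x) \<in> space ?M" using measurable_space[OF upd, of x] by simp
        then show "(indicator ?B (s(a := x)) :: ennreal) = indicator A (s(a := g s + c * x))"
          using indep[of s x] by (simp add: indicator_def)
      qed
      also have "\<dots> = (\<integral>\<^sup>+ x. indicator A (s(a := x)) \<partial>lborel)"
        using nn_integral_real_affine[OF m, of c "g s"] c by auto
      finally show "(\<integral>\<^sup>+ x. indicator ?B (s(a := x)) \<partial>lborel) = (\<integral>\<^sup>+ x. indicator A (s(a := x)) \<partial>lborel)" .
    qed
  qed
  then show ?thesis using f by (simp add: measure_preserving_on_def)
qed

definition complete_point :: "nat \<Rightarrow> real \<Rightarrow> (nat \<Rightarrow> real) \<Rightarrow> nat \<Rightarrow> real" where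
  "complete_point n H t i = (if i \<in> {1..n} then t i else if i = n + 1 then H - sum t {1..n} else 0)"

text \<open>The action of the symmetric group on the hyperplane of coordinate sum \<open>H\<close>,
  read in the first \<open>n\<close> coordinates. It is a right action, so
  \<open>permute_point_comp\<close> reverses the order.\<close>

definition permute_point :: "nat \<Rightarrow> real \<Rightarrow> (nat \<Rightarrow> nat) \<Rightarrow> (nat \<Rightarrow> real) \<Rightarrow> nat \<Rightarrow> real" where
  "permute_point n H p t = restrict (complete_point n H t \<circ> p) {1..n}"

lemma sum_complete_point: "sum (complete_point n H t) {1..n + 1} = H"
proof -
  have "sum (complete_point n H t) {1..n + 1} = sum (complete_point n H t) {1..n} + complete_point n H t (n + 1)" by simp
  also have "sum (complete_point n H t) {1..n} = sum t {1..n}" by (rule sum.cong) (auto simp: complete_point_def)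
  finally show ?thesis by (simp add: complete_point_def)
qed

lemma complete_point_permute_point:
  assumes p: "p permutes {1..n + 1}"
  shows "complete_point n H (permute_point n H p t) = complete_point n H t \<circ> p"
proof
  fix i
  have "sum (complete_point n H t \<circ> p) {1..n + 1} = H"
    using sum.permute[OF p, of "complete_point n H t"] sum_complete_point[of n H t] by simp
  moreover have "sum (permute_point n H p t) {1..n} = sum (complete_point n H t \<circ> p) {1..n}"
    by (rule sum.cong) (auto simp: permute_point_def)
  ultimately have last: "H - sum (permute_point n H p t) {1..n} = (complete_point n H t \<circ> p) (n + 1)" by simp
  have "complete_point n H t (p i) = 0" if "i \<notin> {1..n + 1}"
    using that permutes_not_in[OF p that] by (auto simp: complete_point_def)
  then show "complete_point n H (permute_point n H p t) i = (complete_point n H t \<circ> p) i"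
    using last by (auto simp: complete_point_def[of n H "permute_point n H p t"]) (auto simp: permute_point_def)
qed

lemma permute_point_comp:
  assumes "q permutes {1..n + 1}"
  shows "permute_point n H (q \<circ> p) = permute_point n H p \<circ> permute_point n H q"
proof
  fix t
  show "permute_point n H (q \<circ> p) t = (permute_point n H p \<circ> permute_point n H q) t"
    unfolding permute_point_def[of n H p] o_def[of "\<lambda>t. restrict (complete_point n H t \<circ> p) {1..n}"]
      complete_point_permute_point[OF assms]
    by (simp add: permute_point_def comp_assoc)
qed

text \<open>Exchanging a coordinate with the last, dependent one is a reflection in a single coordinate, and
  these transpositions generate the symmetric group.\<close>

lemma measure_preserving_permute_point:
  assumes "p permutes {1..n + 1}"
  shows "measure_preserving_on (lborel_PiM {1..n}) (permute_point n H p)"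
proof -
  let ?M = "lborel_PiM {1..n}"
  have last: "measure_preserving_on ?M (permute_point n H (Transposition.transpose a (n + 1)))" if a: "a \<in> {1..n}" for a
  proof -
    define g where "g = (\<lambda>t. H - sum t ({1..n} - {a}) :: real)"
    have "measure_preserving_on ?M (\<lambda>t. t(a := g t + (- 1) * t a))"
      by (rule measure_preserving_on_coordinate) (use a in \<open>auto simp: g_def\<close>)
    moreover have "t(a := g t + (- 1) * t a) = permute_point n H (Transposition.transpose a (n + 1)) t" if t: "t \<in> space ?M" for t
    proof
      fix i
      have s: "sum t {1..n} = t a + sum t ({1..n} - {a})" using a by (simp add: sum.remove)
      have e: "t i = undefined" if "i \<notin> {1..n}" using t that by (auto simp: space_lborel_PiM extensional_def)
      show "(t(a := g t + (- 1) * t a)) i = permute_point n H (Transposition.transpose a (n + 1)) t i"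
        using a e by (auto simp: permute_point_def complete_point_def Transposition.transpose_def g_def s simp del: One_nat_def)
    qed
    ultimately show ?thesis
      using measure_preserving_on_cong[of ?M "\<lambda>t. t(a := g t + (- 1) * t a)"
          "permute_point n H (Transposition.transpose a (n + 1))"] by blast
  qed
  have transposition: "measure_preserving_on ?M (permute_point n H (Transposition.transpose a b))"
    if "a \<in> {1..n + 1}" "b \<in> {1..n + 1}" "a \<noteq> b" for a b
  proof -
    have "a \<in> {1..n} \<or> a = n + 1" "b \<in> {1..n} \<or> b = n + 1" "a \<noteq> b" using that by auto
    then consider "a = n + 1" "b \<in> {1..n}" | "b = n + 1" "a \<in> {1..n}" | "a \<in> {1..n}" "b \<in> {1..n}"
      by blast
    then show ?thesis
    proof cases
      case 1
      then show ?thesis using last[of b] by (simp add: transpose_commute)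
    next
      case 2
      then show ?thesis using last[of a] by simp
    next
      case 3
      let ?a = "Transposition.transpose a (n + 1)" and ?b = "Transposition.transpose b (n + 1)"
      have t: "Transposition.transpose a b = ?a \<circ> (?b \<circ> ?a)"
        using 3 that by (auto simp: fun_eq_iff Transposition.transpose_def)
      have perm: "?a permutes {1..n + 1}" "?b permutes {1..n + 1}" using 3 by (auto intro!: permutes_swap_id)
      show ?thesis
        unfolding t permute_point_comp[OF perm(1)] permute_point_comp[OF perm(2)]
        by (intro measure_preserving_on_comp last 3)
    qed
  qed
  show ?thesis using assms finite_atLeastAtMost
  proof (induction rule: permutes_induct)
    case id
    have "permute_point n H id t = t" if "t \<in> space ?M" for t
      using that by (auto simp: permute_point_def complete_point_def space_lborel_PiM extensional_def fun_eq_iff)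
    then show ?case using measure_preserving_on_cong[of ?M "permute_point n H id" "\<lambda>x. x"] measure_preserving_on_id by blast
  next
    case (swap a b p)
    have "Transposition.transpose a b permutes {1..n + 1}" by (rule permutes_swap_id) (use swap in auto)
    then show ?case unfolding permute_point_comp[OF \<open>Transposition.transpose a b permutes {1..n + 1}\<close>]
      by (intro measure_preserving_on_comp transposition swap)
  qed
qed

section \<open>Partial sums and sorting\<close>

definition shear :: "nat \<Rightarrow> (nat \<Rightarrow> real) \<Rightarrow> nat \<Rightarrow> real" where
  "shear k t = t(k := t k + sum t {1..<k})"

definition partial_sums :: "nat \<Rightarrow> (nat \<Rightarrow> real) \<Rightarrow> nat \<Rightarrow> real" where
  "partial_sums n t = restrict (\<lambda>i. sum t {1..i}) {1..n}"

text \<open>The map is unitriangular. It is built from shears, starting with the last coordinate, so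
  that each shear still sees the original coordinates below it; \<open>?G r\<close> is the stage at
  which the last \<open>r\<close> coordinates are done.\<close>

lemma measure_preserving_partial_sums: "measure_preserving_on (lborel_PiM {1..n}) (partial_sums n)"
proof -
  let ?M = "lborel_PiM {1..n}"
  let ?G = "\<lambda>r t. restrict (\<lambda>i. if n - r < i then sum t {1..i} else t i) {1..n}"
  have "measure_preserving_on ?M (?G r)" if "r \<le> n" for r
    using that
  proof (induction r)
    case 0
    have "?G 0 t = t" if "t \<in> space ?M" for t
      using that by (auto simp: space_lborel_PiM extensional_def fun_eq_iff)
    then show ?case using measure_preserving_on_cong[of ?M "?G 0" "\<lambda>x. x"] measure_preserving_on_id by blast
  next
    case (Suc r)
    define k where "k = n - r"
    have k: "k \<in> {1..n}" using Suc.prems by (auto simp: k_def)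
    have "measure_preserving_on ?M (\<lambda>t. t(k := sum t {1..<k} + 1 * t k))"
    proof (rule measure_preserving_on_coordinate)
      show "(\<lambda>t. sum t {1..<k}) \<in> borel_measurable ?M"
        by (rule borel_measurable_sum) (use k in auto)
    qed (use k in auto)
    moreover have "shear k = (\<lambda>t. t(k := sum t {1..<k} + 1 * t k))"
      by (simp add: fun_eq_iff shear_def add.commute)
    ultimately have sh: "measure_preserving_on ?M (shear k)" by (simp only:)
    have "shear k (?G r t) = ?G (Suc r) t" for t
    proof
      fix i
      have "sum (?G r t) {1..<k} = sum t {1..<k}" by (rule sum.cong) (use k in \<open>auto simp: k_def\<close>)
      moreover have "sum t {1..k} = sum t {1..<k} + t k"
        using k by (subst atLeastLessThanSuc_atLeastAtMost[symmetric]) simp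
      ultimately show "shear k (?G r t) i = ?G (Suc r) t i"
        using k by (cases "i = k") (auto simp: shear_def k_def)
    qed
    then have "?G (Suc r) = shear k \<circ> ?G r" unfolding fun_eq_iff o_def by metis
    moreover have "r \<le> n" using Suc.prems by simp
    ultimately show ?case using measure_preserving_on_comp[OF Suc.IH sh] by (simp only:)
  qed
  from this[of n] have "measure_preserving_on ?M (?G n)" by simp
  moreover have "?G n = partial_sums n" by (auto simp: partial_sums_def fun_eq_iff restrict_def)
  ultimately show ?thesis by simp
qed

text \<open>The largest element of \<open>I\<close> is at least \<open>card I\<close>, so its value
  is at most the one at \<open>card I\<close>. For sorted points, the bounds on initial segments
  therefore imply those on all subsets.\<close>

lemma antitone_sum_le_initial:
  fixes f :: "nat \<Rightarrow> real"
  assumes "\<And>i j. 1 \<le> i \<Longrightarrow> i \<le> j \<Longrightarrow> j \<le> m \<Longrightarrow> f j \<le> f i" "I \<subseteq> {1..m}"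
  shows "sum f I \<le> sum f {1..card I}"
  using assms(2)
proof (induction "card I" arbitrary: I)
  case 0
  then have "I = {}" using finite_subset[OF 0(2)] by simp
  then show ?case by simp
next
  case (Suc c)
  have fin: "finite I" using finite_subset[OF Suc.prems] by simp
  have ne: "I \<noteq> {}" using Suc.hyps(2) by auto
  define j where "j = Max I"
  have j: "j \<in> I" "\<And>i. i \<in> I \<Longrightarrow> i \<le> j" using fin ne by (auto simp: j_def)
  have "I \<subseteq> {1..j}" using j Suc.prems by auto
  then have "card I \<le> j" using card_mono[of "{1..j}" I] by simp
  then have fj: "f j \<le> f (card I)" using assms(1)[of "card I" j] Suc.hyps(2) j Suc.prems by auto
  have c: "card (I - {j}) = c" using Suc.hyps(2) j fin by simp
  have "sum f (I - {j}) \<le> sum f {1..card (I - {j})}" by (rule Suc.hyps(1)) (use c Suc.prems in auto)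
  then have "sum f I \<le> f j + sum f {1..c}" using fin j c by (simp add: sum.remove)
  also have "\<dots> \<le> f (card I) + sum f {1..c}" using fj by simp
  also have "\<dots> = sum f {1..card I}" unfolding Suc.hyps(2)[symmetric] by simp
  finally show ?case .
qed

text \<open>Without ties, the position of a coordinate in sorted order is determined by its rank,
  the number of larger coordinates.\<close>

lemma sorting_permutation_unique:
  fixes t :: "nat \<Rightarrow> real"
  assumes p: "p permutes {1..m}" "\<And>i. i \<in> {1..<m} \<Longrightarrow> t (p (i + 1)) \<le> t (p i)"
    and q: "q permutes {1..m}" "\<And>i. i \<in> {1..<m} \<Longrightarrow> t (q (i + 1)) \<le> t (q i)"
    and inj: "inj_on t {1..m}"
  shows "p = q"
proof -
  have rank: "card {j\<in>{1..m}. t (r i) < t j} = i - 1"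
    if r: "r permutes {1..m}" and sorted: "\<And>i. i \<in> {1..<m} \<Longrightarrow> t (r (i + 1)) \<le> t (r i)" and i: "i \<in> {1..m}" for r i
  proof -
    have le: "t (r y) \<le> t (r x)" if "1 \<le> x" "x \<le> y" "y \<le> m" for x y
      using that(2,3)
    proof (induction y rule: dec_induct)
      case (step y)
      then show ?case using sorted[of y] that(1) by force
    qed simp
    have less: "t (r i) < t (r x) \<longleftrightarrow> x < i" if "x \<in> {1..m}" for x
    proof (cases "x < i")
      case True
      have "r x \<noteq> r i" using permutes_inj[OF r] True by (auto dest: injD)
      then have "t (r x) \<noteq> t (r i)" using inj_onD[OF inj] permutes_in_image[OF r] that i by blast
      then show ?thesis using le[of x i] that i True by force
    next
      case False
      then show ?thesis using le[of i x] that i by force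
    qed
    have "{j\<in>{1..m}. t (r i) < t j} = r ` {1..<i}"
    proof (intro equalityI subsetI)
      fix j assume j: "j \<in> {j\<in>{1..m}. t (r i) < t j}"
      then obtain x where x: "x \<in> {1..m}" "j = r x" using permutes_image[OF r] by blast
      then show "j \<in> r ` {1..<i}" using j less[OF x(1)] by auto
    next
      fix j assume "j \<in> r ` {1..<i}"
      then obtain x where x: "x \<in> {1..<i}" "j = r x" by blast
      then have "x \<in> {1..m}" using i by auto
      then show "j \<in> {j\<in>{1..m}. t (r i) < t j}" using x less[of x] permutes_in_image[OF r, of x] by auto
    qed
    then show ?thesis using card_image[of r "{1..<i}"] permutes_inj[OF r] by (simp add: inj_on_def)
  qed
  show ?thesis
  proof
    fix i
    show "p i = q i"
    proof (cases "i \<in> {1..m}")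
      case True
      then have "q i \<in> {1..m}" using permutes_in_image[OF q(1)] by blast
      then obtain i' where i': "i' \<in> {1..m}" "q i = p i'" using permutes_image[OF p(1)] by blast
      have "i' - 1 = i - 1" using rank[OF p i'(1)] rank[OF q True] i'(2) by simp
      then show ?thesis using i' True by (metis Suc_pred' atLeastAtMost_iff less_eq_Suc_le One_nat_def)
    qed (use permutes_not_in[OF p(1)] permutes_not_in[OF q(1)] in auto)
  qed
qed

text \<open>The projected polytope as a condition on points instead of an image, which makes its
  measurability evident.\<close>

definition section_region :: "nat \<Rightarrow> (nat \<Rightarrow> real) \<Rightarrow> (nat \<Rightarrow> real) set" where
  "section_region n h = {t \<in> extensional {1..n}. complete_point n (h (n + 1)) t \<in> majorized (n + 1) h}"

lemma restrict_majorized: "(\<lambda>t. restrict t {1..n}) ` majorized (n + 1) h = section_region n h"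
proof (intro equalityI subsetI)
  fix s assume "s \<in> (\<lambda>t. restrict t {1..n}) ` majorized (n + 1) h"
  then obtain t where t: "t \<in> majorized (n + 1) h" "s = restrict t {1..n}" by blast
  have "sum t {1..n + 1} = h (n + 1)" using t by (simp add: majorized_def)
  moreover have "sum t {1..n + 1} = sum t {1..n} + t (n + 1)" by simp
  ultimately have last: "h (n + 1) - sum t {1..n} = t (n + 1)" by simp
  have "sum s {1..n} = sum t {1..n}" by (simp add: t)
  then have "complete_point n (h (n + 1)) s i = t i" for i
    using t last by (auto simp: complete_point_def majorized_def)
  then have "complete_point n (h (n + 1)) s = t" by (rule ext)
  then show "s \<in> section_region n h" using t by (simp add: section_region_def)
next
  fix s assume s: "s \<in> section_region n h"
  then have "restrict (complete_point n (h (n + 1)) s) {1..n} = s"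
    by (auto simp: section_region_def complete_point_def extensional_def fun_eq_iff)
  then show "s \<in> (\<lambda>t. restrict t {1..n}) ` majorized (n + 1) h"
    using s unfolding section_region_def by (intro image_eqI[of _ _ "complete_point n (h (n + 1)) s"]) auto
qed

lemma borel_measurable_complete_point [measurable]:
  "(\<lambda>t. complete_point n H t i) \<in> borel_measurable (lborel_PiM {1..n})"
proof -
  consider "i \<in> {1..n}" | "i = n + 1" | "i \<notin> {1..n}" "i \<noteq> n + 1" by blast
  then show ?thesis
  proof cases
    case 1
    then have "(\<lambda>t. t i) \<in> borel_measurable (lborel_PiM {1..n})" by measurable
    then show ?thesis using 1 by (simp add: complete_point_def)
  next
    case 2
    have "(\<lambda>t. H - sum t {1..n}) \<in> borel_measurable (lborel_PiM {1..n})"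
      by (intro borel_measurable_diff borel_measurable_sum) auto
    then show ?thesis using 2 by (simp add: complete_point_def)
  next
    case 3
    then have "(\<lambda>t. complete_point n H t i) = (\<lambda>t. 0)" by (auto simp: complete_point_def)
    then show ?thesis by simp
  qed
qed

lemma section_region_sets: "section_region n h \<in> sets (lborel_PiM {1..n})"
proof -
  let ?M = "lborel_PiM {1..n}" and ?c = "complete_point n (h (n + 1))"
  have "section_region n h = {t \<in> space ?M. \<forall>I\<in>Pow {1..n + 1}. sum (?c t) I \<le> h (card I)}"
  proof -
    have "?c t \<in> majorized (n + 1) h \<longleftrightarrow> (\<forall>I\<in>Pow {1..n + 1}. sum (?c t) I \<le> h (card I))" for t
    proof -
      have "?c t i = 0" if "i \<notin> {1..n + 1}" for i using that by (auto simp: complete_point_def)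
      then show ?thesis using sum_complete_point[of n "h (n + 1)" t] unfolding majorized_def by blast
    qed
    then show ?thesis by (simp add: section_region_def space_lborel_PiM)
  qed
  also have "\<dots> \<in> sets ?M"
  proof (rule sets.sets_Collect_finite_All)
    show "{t \<in> space ?M. sum (?c t) I \<le> h (card I)} \<in> sets ?M" for I by measurable
  qed simp
  finally show ?thesis .
qed

definition chamber :: "nat \<Rightarrow> (nat \<Rightarrow> real) \<Rightarrow> (nat \<Rightarrow> nat) \<Rightarrow> (nat \<Rightarrow> real) set" where
  "chamber n h p = {t \<in> section_region n h. \<forall>i\<in>{1..<n + 1}.
     complete_point n (h (n + 1)) t (p (i + 1)) \<le> complete_point n (h (n + 1)) t (p i)}"

lemma chamber_sets: "chamber n h p \<in> sets (lborel_PiM {1..n})"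
proof -
  let ?M = "lborel_PiM {1..n}" and ?c = "complete_point n (h (n + 1))"
  have "chamber n h p = section_region n h \<inter> {t \<in> space ?M. \<forall>i\<in>{1..<n + 1}. ?c t (p (i + 1)) \<le> ?c t (p i)}"
    by (auto simp: chamber_def section_region_def space_lborel_PiM)
  moreover have "{t \<in> space ?M. \<forall>i\<in>{1..<n + 1}. ?c t (p (i + 1)) \<le> ?c t (p i)} \<in> sets ?M"
  proof (rule sets.sets_Collect_finite_All)
    show "{t \<in> space ?M. ?c t (p (i + 1)) \<le> ?c t (p i)} \<in> sets ?M" for i by measurable
  qed simp
  ultimately show ?thesis using section_region_sets by auto
qed

lemma emeasure_chamber:
  assumes p: "p permutes {1..n + 1}"
  shows "emeasure (lborel_PiM {1..n}) (chamber n h p) = emeasure (lborel_PiM {1..n}) (chamber n h id)"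
proof -
  let ?M = "lborel_PiM {1..n}" and ?c = "complete_point n (h (n + 1))"
  have maj: "?c t \<circ> p \<in> majorized (n + 1) h \<longleftrightarrow> ?c t \<in> majorized (n + 1) h" for t
  proof
    assume "?c t \<circ> p \<in> majorized (n + 1) h"
    then have "?c t \<circ> p \<circ> inv p \<in> majorized (n + 1) h" by (rule majorized_permute[OF permutes_inv[OF p]])
    then show "?c t \<in> majorized (n + 1) h" using permutes_inv_o(1)[OF p] by (simp add: comp_assoc)
  qed (rule majorized_permute[OF p])
  have "permute_point n H p t \<in> extensional {1..n}" for H t by (simp add: permute_point_def)
  then have "permute_point n (h (n + 1)) p -` chamber n h id \<inter> space ?M = chamber n h p"
    unfolding chamber_def section_region_def space_lborel_PiM vimage_def Int_def mem_Collect_eq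
      complete_point_permute_point[OF p] maj id_apply o_apply by blast
  then show ?thesis
    using measure_preserving_permute_point[OF p, of "h (n + 1)"] chamber_sets[of n h id]
    unfolding measure_preserving_on_def by metis
qed

lemma AE_complete_point_inj: "AE t in lborel_PiM {1..n}. inj_on (complete_point n H t) {1..n + 1}"
proof -
  let ?M = "lborel_PiM {1..n}" and ?c = "complete_point n H"
  have one: "AE t in ?M. ?c t a \<noteq> ?c t b" if a: "a \<in> {1..n}" and b: "b \<in> {1..n + 1}" "a \<noteq> b" for a b
  proof (cases "b = n + 1")
    case True
    \<comment> \<open>The dependent coordinate itself contains \<open>- t a\<close>, so equality
      with it determines \<open>2 * t a\<close>; hence the division by two.\<close>
    have "AE t in ?M. t a \<noteq> (H - sum t ({1..n} - {a})) / 2"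
      by (rule AE_PiM_coordinate_neq) (use a in \<open>auto intro!: sum.cong\<close>)
    then show ?thesis
    proof (rule eventually_mono)
      fix t assume t: "t a \<noteq> (H - sum t ({1..n} - {a})) / 2"
      have "sum t {1..n} = t a + sum t ({1..n} - {a})" using a by (simp add: sum.remove)
      then show "?c t a \<noteq> ?c t b" using t a True by (auto simp: complete_point_def)
    qed
  next
    case False
    have "AE t in ?M. t a \<noteq> t b"
      by (rule AE_PiM_coordinate_neq) (use a b False in auto)
    then show ?thesis using a b False by (auto simp: complete_point_def elim!: eventually_mono)
  qed
  have "AE t in ?M. a \<noteq> b \<longrightarrow> ?c t a \<noteq> ?c t b" if "a \<in> {1..n + 1}" "b \<in> {1..n + 1}" for a b
  proof (cases "a = b")
    case False
    have "a \<in> {1..n} \<or> a = n + 1" "b \<in> {1..n} \<or> b = n + 1" using that by auto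
    then consider "a \<in> {1..n}" | "b \<in> {1..n}" using False by blast
    then show ?thesis
    proof cases
      case 1
      then show ?thesis using one[OF 1 that(2) False] by (auto elim!: eventually_mono)
    next
      case 2
      then show ?thesis using one[OF 2 that(1)] False by (auto elim!: eventually_mono)
    qed
  qed simp
  then have "AE t in ?M. \<forall>a\<in>{1..n + 1}. \<forall>b\<in>{1..n + 1}. a \<noteq> b \<longrightarrow> ?c t a \<noteq> ?c t b"
    by (intro AE_finite_allI finite_atLeastAtMost)
  then show ?thesis by (rule eventually_mono) (auto simp: inj_on_def)
qed

lemma emeasure_section_region:
  "emeasure (lborel_PiM {1..n}) (section_region n h) = of_nat (fact (n + 1)) * emeasure (lborel_PiM {1..n}) (chamber n h id)"
proof -
  let ?M = "lborel_PiM {1..n}" and ?c = "complete_point n (h (n + 1))"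
  let ?P = "{p. p permutes {1..n + 1}}"
  have fin: "finite ?P" by (simp add: finite_permutations)
  have "emeasure ?M (section_region n h) = (\<integral>\<^sup>+ t. indicator (section_region n h) t \<partial>?M)"
    using section_region_sets by simp
  also have "\<dots> = (\<integral>\<^sup>+ t. (\<Sum>p\<in>?P. indicator (chamber n h p) t) \<partial>?M)"
  proof (rule nn_integral_cong_AE, rule eventually_mono[OF AE_complete_point_inj[of n "h (n + 1)"]])
    fix t assume inj: "inj_on (?c t) {1..n + 1}"
    show "indicator (section_region n h) t = (\<Sum>p\<in>?P. indicator (chamber n h p) t :: ennreal)"
    proof (cases "t \<in> section_region n h")
      case True
      obtain p0 where p0: "p0 permutes {1..n + 1}" "\<And>i. i \<in> {1..<n + 1} \<Longrightarrow> ?c t (p0 (i + 1)) \<le> ?c t (p0 i)"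
        using exists_sorting_permutation[of "n + 1" "?c t"] by blast
      have "t \<in> chamber n h p \<longleftrightarrow> p = p0" if "p \<in> ?P" for p
      proof
        assume "t \<in> chamber n h p"
        then have "?c t (p (i + 1)) \<le> ?c t (p i)" if "i \<in> {1..<n + 1}" for i
          using that unfolding chamber_def by blast
        then show "p = p0" using that by (intro sorting_permutation_unique[OF _ _ p0 inj]) auto
      next
        assume "p = p0"
        then show "t \<in> chamber n h p" using p0(2) True unfolding chamber_def by blast
      qed
      then have "(\<Sum>p\<in>?P. indicator (chamber n h p) t :: ennreal) = (\<Sum>p\<in>?P. if p = p0 then 1 else 0)"
        by (intro sum.cong refl) (simp add: indicator_def)
      also have "\<dots> = 1" using fin p0(1) by simp
      finally show ?thesis using True by simp
    next
      case False
      then have "t \<notin> chamber n h p" for p by (simp add: chamber_def)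
      then show ?thesis using False by simp
    qed
  qed
  also have "\<dots> = (\<Sum>p\<in>?P. \<integral>\<^sup>+ t. indicator (chamber n h p) t \<partial>?M)"
    by (rule nn_integral_sum) (use chamber_sets in auto)
  also have "\<dots> = (\<Sum>p\<in>?P. emeasure ?M (chamber n h p))"
    using chamber_sets by (intro sum.cong) auto
  also have "\<dots> = (\<Sum>p\<in>?P. emeasure ?M (chamber n h id))"
  proof (rule sum.cong[OF refl])
    fix p assume "p \<in> ?P"
    then show "emeasure ?M (chamber n h p) = emeasure ?M (chamber n h id)" by (intro emeasure_chamber) simp
  qed
  also have "\<dots> = of_nat (fact (n + 1)) * emeasure ?M (chamber n h id)"
    by (simp add: card_permutations)
  finally show ?thesis .
qed

text \<open>Partial sums turn decreasing coordinates into a concave sequence and the bounds on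
  initial segments into \<open>s i \<le> h i\<close>. The boundary values are \<open>h 0 = 0\<close>
  and the coordinate sum \<open>h (n + 1)\<close>.\<close>

lemma emeasure_sorted_chamber:
  assumes "h 0 = 0"
  shows "emeasure (lborel_PiM {1..n}) (chamber n h id) = emeasure (lborel_PiM {1..n}) (concave_region 0 (n + 1) h)"
proof -
  let ?M = "lborel_PiM {1..n}" and ?c = "complete_point n (h (n + 1))"
  have S: "{0<..<n + 1} = {1..n}" by auto
  have "partial_sums n t \<in> concave_region 0 (n + 1) h \<longleftrightarrow> t \<in> chamber n h id" if t: "t \<in> extensional {1..n}" for t
  proof -
    let ?e = "interval_ext 0 (n + 1) h (partial_sums n t)"
    have csum: "sum (?c t) {1..i} = sum t {1..i}" if "i \<le> n" for i
      by (rule sum.cong) (use that in \<open>auto simp: complete_point_def\<close>)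
    have e: "?e i = sum (?c t) {1..i}" if i: "i \<le> n + 1" for i
    proof (cases "i \<in> {1..n}")
      case True
      then show ?thesis using csum[of i] by (simp add: interval_ext_def S partial_sums_def)
    next
      case False
      then have "i = 0 \<or> i = n + 1" using i by auto
      then show ?thesis using assms sum_complete_point[of n "h (n + 1)" t] by (auto simp: interval_ext_def)
    qed
    have d: "second_difference ?e i = ?c t i - ?c t (i + 1)" if i: "i \<in> {1..n}" for i
    proof -
      have es: "?e i = sum (?c t) {1..i}" "?e (i - 1) = sum (?c t) {1..i - 1}" "?e (i + 1) = sum (?c t) {1..i + 1}"
        by (rule e; use i in auto)+
      have "sum (?c t) {1..i} = sum (?c t) {1..i - 1} + ?c t i" using i by (cases i) auto
      moreover have "sum (?c t) {1..i + 1} = sum (?c t) {1..i} + ?c t (i + 1)" by simp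
      ultimately show ?thesis unfolding second_difference_def es by linarith
    qed
    have sorted: "?c t y \<le> ?c t x"
      if st: "\<forall>i\<in>{1..n}. 0 \<le> second_difference ?e i" and xy: "1 \<le> x" "x \<le> y" "y \<le> n + 1" for x y
      using xy(2,3)
    proof (induction y rule: dec_induct)
      case (step y)
      have "0 \<le> second_difference ?e y" using st step xy by auto
      then show ?case using d[of y] step xy by auto
    qed simp
    have ps: "partial_sums n t i = sum (?c t) {1..i}" if "i \<in> {1..n}" for i
      using that csum[of i] by (simp add: partial_sums_def)
    have "partial_sums n t \<in> concave_region 0 (n + 1) h \<longleftrightarrow>
      (\<forall>i\<in>{1..n}. 0 \<le> second_difference ?e i) \<and> (\<forall>i\<in>{1..n}. sum (?c t) {1..i} \<le> h i)"
      unfolding concave_region_def S using ps by (auto simp: partial_sums_def)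
    also have "\<dots> \<longleftrightarrow> (\<forall>i\<in>{1..n}. 0 \<le> second_difference ?e i) \<and> ?c t \<in> majorized (n + 1) h"
    proof (intro conj_cong refl iffI ballI)
      fix i assume i: "i \<in> {1..n}" and "?c t \<in> majorized (n + 1) h"
      then have "\<forall>I. I \<subseteq> {1..n + 1} \<longrightarrow> sum (?c t) I \<le> h (card I)" unfolding majorized_def by blast
      moreover have "{1..i} \<subseteq> {1..n + 1}" using i by auto
      ultimately have "sum (?c t) {1..i} \<le> h (card {1..i})" by blast
      then show "sum (?c t) {1..i} \<le> h i" by simp
    next
      assume st: "\<forall>i\<in>{1..n}. 0 \<le> second_difference ?e i" and le: "\<forall>i\<in>{1..n}. sum (?c t) {1..i} \<le> h i"
      have "sum (?c t) I \<le> h (card I)" if I: "I \<subseteq> {1..n + 1}" for I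
      proof -
        have "card I \<le> n + 1" using card_mono[OF _ I] by simp
        then have "sum (?c t) {1..card I} \<le> h (card I)"
          using le assms sum_complete_point[of n "h (n + 1)" t]
          by (cases "card I = 0"; cases "card I = n + 1") auto
        moreover have "sum (?c t) I \<le> sum (?c t) {1..card I}"
          by (rule antitone_sum_le_initial[where m = "n + 1"]) (use sorted[OF st] I in auto)
        ultimately show ?thesis by simp
      qed
      moreover have "?c t i = 0" if "i \<notin> {1..n + 1}" for i using that by (auto simp: complete_point_def)
      ultimately show "?c t \<in> majorized (n + 1) h"
        using sum_complete_point[of n "h (n + 1)" t] unfolding majorized_def by blast
    qed
    also have "\<dots> \<longleftrightarrow> t \<in> chamber n h id"
      using t d by (auto simp: chamber_def section_region_def)
    finally show ?thesis .
  qed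
  then have "partial_sums n -` concave_region 0 (n + 1) h \<inter> space ?M = chamber n h id"
    by (auto simp: space_lborel_PiM chamber_def section_region_def)
  moreover have "concave_region 0 (n + 1) h \<in> sets ?M"
    using concave_region_sets[of 0 "n + 1" h] unfolding S .
  ultimately show ?thesis
    using measure_preserving_partial_sums[of n] unfolding measure_preserving_on_def by metis
qed

lemma second_difference_support_height:
  assumes "i \<in> {1..n}"
  shows "second_difference (support_height n u) i = u i"
proof -
  have "second_difference (support_height n u) i =
      (\<Sum>k=1..n. u k * (2 * real (min k i) - real (min k (i - 1)) - real (min k (i + 1))))"
    unfolding second_difference_def support_height_def
    by (simp add: sum_distrib_left sum_subtractf right_diff_distrib mult_ac)
  also have "\<dots> = (\<Sum>k=1..n. if k = i then u k else 0)"
    by (rule sum.cong) (use assms in \<open>auto simp: min_def\<close>)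
  also have "\<dots> = u i" using assms by simp
  finally show ?thesis .
qed

theorem hyperplane_volume_hypersimplex_sum:
  assumes "\<forall>k\<in>{1..n}. 0 \<le> u k"
  shows "hyperplane_volume n (hypersimplex_sum n u) = fact (n + 1) * volume_poly 0 (n + 1) u"
proof -
  let ?M = "lborel_PiM {1..n}" and ?h = "support_height n u"
  have S: "{0<..<n + 1} = {1..n}" by auto
  have sd: "second_difference ?h i = u i" if "i \<in> {0<..<n + 1}" for i
    using second_difference_support_height[of i n u] that by simp
  have h0: "?h 0 = 0" by (simp add: support_height_def)
  have nn: "0 \<le> volume_poly 0 (n + 1) u" by (rule volume_poly_nonneg) (use assms in auto)
  have "emeasure ?M (concave_region 0 (n + 1) ?h) = ennreal (volume_poly 0 (n + 1) (second_difference ?h))"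
    unfolding S[symmetric] by (rule emeasure_concave_region) (use assms sd in auto)
  also have "volume_poly 0 (n + 1) (second_difference ?h) = volume_poly 0 (n + 1) u"
    by (rule volume_poly_cong) (rule sd)
  finally have "emeasure ?M (section_region n ?h) = of_nat (fact (n + 1)) * ennreal (volume_poly 0 (n + 1) u)"
    unfolding emeasure_section_region emeasure_sorted_chamber[where h = ?h and n = n, OF h0] by simp
  also have "\<dots> = ennreal (fact (n + 1) * volume_poly 0 (n + 1) u)"
    using nn by (simp add: ennreal_mult ennreal_of_nat_eq_real_of_nat del: fact_Suc)
  finally have "measure ?M (section_region n ?h) = fact (n + 1) * volume_poly 0 (n + 1) u"
    using nn by (simp add: measure_def del: fact_Suc)
  moreover have "hypersimplex_sum n u = majorized (n + 1) ?h"
    by (rule hypersimplex_sum_eq_majorized) (use assms in auto)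
  ultimately show ?thesis unfolding hyperplane_volume_def by (simp only: restrict_majorized)
qed

section \<open>Mixed Eulerian numbers as chip weights\<close>

definition site_config :: "nat list \<Rightarrow> nat \<Rightarrow> nat" where
  "site_config c i = (if i \<in> {1..length c} then c ! (i - 1) else 0)"

lemma sum_site_config: "sum (site_config c) {0<..<length c + 1} = sum_list c"
proof -
  have "{0<..<length c + 1} = Suc ` {0..<length c}"
    by (simp add: image_Suc_atLeastLessThan atLeastSucLessThan_greaterThanLessThan)
  then have "sum (site_config c) {0<..<length c + 1} = (\<Sum>i\<in>{0..<length c}. site_config c (Suc i))"
    by (simp only: sum.reindex[OF inj_Suc, unfolded o_def])
  also have "\<dots> = sum_list c"
    unfolding sum_list_sum_nth by (rule sum.cong) (auto simp: site_config_def)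
  finally show ?thesis .
qed

lemma bij_betw_site_config: "bij_betw site_config (weak_compositions n) (chip_configs {0<..<n + 1} n)"
proof (rule bij_betwI[where g = "\<lambda>f. map f [1..<n + 1]"])
  have sc: "site_config (map f [1..<n + 1]) = f" if "f \<in> chip_configs {0<..<n + 1} n" for f
  proof
    fix i
    show "site_config (map f [1..<n + 1]) i = f i"
    proof (cases "i \<in> {1..n}")
      case True
      have "i - 1 < length [1..<n + 1]" using True by auto
      then have "map f [1..<n + 1] ! (i - 1) = f ([1..<n + 1] ! (i - 1))" by (rule nth_map)
      also have "[1..<n + 1] ! (i - 1) = i" using True by (subst nth_upt) auto
      finally show ?thesis using True by (simp add: site_config_def del: upt_Suc)
    next
      case False
      then have "i \<notin> {0<..<n + 1}" by auto
      then have "f i = 0" using that unfolding chip_configs_def by blast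
      then show ?thesis using False by (auto simp: site_config_def simp del: upt_Suc)
    qed
  qed
  show "site_config \<in> weak_compositions n \<rightarrow> chip_configs {0<..<n + 1} n"
    using sum_site_config by (auto simp: weak_compositions_def chip_configs_def site_config_def)
  show "(\<lambda>f. map f [1..<n + 1]) \<in> chip_configs {0<..<n + 1} n \<rightarrow> weak_compositions n"
  proof (rule funcsetI)
    fix f assume f: "f \<in> chip_configs {0<..<n + 1} n"
    then have "sum_list (map f [1..<n + 1]) = n"
      using sum_site_config[of "map f [1..<n + 1]"] unfolding sc[OF f] by (simp add: chip_configs_def del: upt_Suc)
    then show "map f [1..<n + 1] \<in> weak_compositions n" by (simp add: weak_compositions_def del: upt_Suc)
  qed
  show "map (site_config c) [1..<n + 1] = c" if "c \<in> weak_compositions n" for c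
    using that by (intro nth_equalityI) (auto simp: weak_compositions_def site_config_def simp del: upt_Suc)
  show "site_config (map f [1..<n + 1]) = f" if "f \<in> chip_configs {0<..<n + 1} n" for f
    by (rule sc[OF that])
qed

lemma finite_weak_compositions: "finite (weak_compositions n)"
  using bij_betw_finite[OF bij_betw_site_config] finite_chip_configs by blast

lemma volume_poly_weak_compositions:
  "volume_poly 0 (n + 1) u = (\<Sum>c\<in>weak_compositions n. chip_weight 0 (n + 1) (site_config c) *
     (\<Prod>k=1..n. u k ^ (c ! (k - 1)) / fact (c ! (k - 1))))"
proof -
  have "volume_poly 0 (n + 1) u = (\<Sum>c\<in>chip_configs {0<..<n + 1} n. chip_weight 0 (n + 1) c * monomial {0<..<n + 1} u c)"
    by (simp add: volume_poly_def)
  also have "\<dots> = (\<Sum>c\<in>weak_compositions n. chip_weight 0 (n + 1) (site_config c) * monomial {0<..<n + 1} u (site_config c))"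
    by (rule sum.reindex_bij_betw[OF bij_betw_site_config, symmetric])
  also have "\<dots> = (\<Sum>c\<in>weak_compositions n. chip_weight 0 (n + 1) (site_config c) *
     (\<Prod>k=1..n. u k ^ (c ! (k - 1)) / fact (c ! (k - 1))))"
  proof (rule sum.cong[OF refl])
    fix c assume c: "c \<in> weak_compositions n"
    have "monomial {0<..<n + 1} u (site_config c) = (\<Prod>k=1..n. u k ^ (c ! (k - 1)) / fact (c ! (k - 1)))"
      unfolding monomial_def by (rule prod.cong) (use c in \<open>auto simp: site_config_def weak_compositions_def\<close>)
    then show "chip_weight 0 (n + 1) (site_config c) * monomial {0<..<n + 1} u (site_config c) =
      chip_weight 0 (n + 1) (site_config c) * (\<Prod>k=1..n. u k ^ (c ! (k - 1)) / fact (c ! (k - 1)))" by simp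
  qed
  finally show ?thesis .
qed

text \<open>Uniqueness of digits in base \<open>b\<close>, least significant digit first.\<close>

lemma horner_sum_inj:
  assumes "length xs = length ys" "\<forall>x\<in>set xs. x < b" "\<forall>y\<in>set ys. y < b" "horner_sum (\<lambda>x. x) b xs = horner_sum (\<lambda>x. x) (b::nat) ys"
  shows "xs = ys"
  using assms
proof (induction xs ys rule: list_induct2)
  case (Cons x xs y ys)
  have eq: "x + b * horner_sum (\<lambda>x. x) b xs = y + b * horner_sum (\<lambda>x. x) b ys" using Cons.prems by simp
  have "x = y" using arg_cong[OF eq, of "\<lambda>z. z mod b"] Cons.prems by simp
  moreover have "horner_sum (\<lambda>x. x) b xs = horner_sum (\<lambda>x. x) b ys" using eq \<open>x = y\<close> Cons.prems by auto
  ultimately show ?case using Cons by simp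
qed simp

lemma poly_eq_0_if_nonneg:
  fixes p :: "real poly"
  assumes "\<And>x. 0 \<le> x \<Longrightarrow> poly p x = 0"
  shows "p = 0"
proof (rule ccontr)
  assume "p \<noteq> 0"
  then have "finite {x. poly p x = 0}" by (rule poly_roots_finite)
  moreover have "{0..} \<subseteq> {x. poly p x = 0}" using assms by auto
  ultimately have "finite {0 :: real..}" using finite_subset by blast
  then show False using infinite_Ici by blast
qed

text \<open>Kronecker substitution: putting \<open>u k = x ^ ((n + 1) ^ (k - 1))\<close> keeps distinct monomials distinct.\<close>

lemma monomial_coefficients_unique:
  fixes D :: "nat list \<Rightarrow> real"
  assumes zero: "\<And>u. \<forall>k\<in>{1..n}. 0 \<le> u k \<Longrightarrow>
      (\<Sum>c\<in>weak_compositions n. D c * (\<Prod>k=1..n. u k ^ (c ! (k - 1)) / fact (c ! (k - 1)))) = 0"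
    and c: "c \<in> weak_compositions n"
  shows "D c = 0"
proof -
  let ?W = "weak_compositions n"
  define e where "e = (\<lambda>c. horner_sum (\<lambda>x. x) (n + 1) c)"
  define a where "a = (\<lambda>c. D c / (\<Prod>k=1..n. fact (c ! (k - 1))))"
  define p where "p = (\<Sum>c\<in>?W. monom (a c) (e c))"
  have e_sum: "e c = (\<Sum>k=1..n. (c ! (k - 1)) * (n + 1) ^ (k - 1))" if "c \<in> ?W" for c
  proof -
    have "{1..n} = Suc ` {0..<n}" by (simp add: image_Suc_atLeastLessThan atLeastLessThanSuc_atLeastAtMost)
    then have "(\<Sum>k=1..n. (c ! (k - 1)) * (n + 1) ^ (k - 1)) = (\<Sum>k\<in>{0..<n}. (c ! k) * (n + 1) ^ k)"
      by (simp only: sum.reindex[OF inj_Suc, unfolded o_def]) simp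
    then show ?thesis
      using that unfolding e_def horner_sum_eq_sum by (simp add: weak_compositions_def lessThan_atLeast0)
  qed
  have "poly p x = 0" if "0 \<le> x" for x
  proof -
    define u where "u = (\<lambda>k. x ^ ((n + 1) ^ (k - 1)))"
    have "poly p x = (\<Sum>c\<in>?W. a c * x ^ e c)" by (simp add: p_def poly_sum poly_monom)
    also have "\<dots> = (\<Sum>c\<in>?W. D c * (\<Prod>k=1..n. u k ^ (c ! (k - 1)) / fact (c ! (k - 1))))"
    proof (rule sum.cong[OF refl])
      fix c assume c: "c \<in> ?W"
      have "x ^ e c = (\<Prod>k=1..n. u k ^ (c ! (k - 1)))"
        unfolding e_sum[OF c] power_sum u_def by (simp add: power_mult[symmetric] mult.commute)
      then show "a c * x ^ e c = D c * (\<Prod>k=1..n. u k ^ (c ! (k - 1)) / fact (c ! (k - 1)))"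
        by (simp add: a_def prod_dividef)
    qed
    also have "\<dots> = 0" by (rule zero) (use that in \<open>auto simp: u_def\<close>)
    finally show ?thesis .
  qed
  then have "p = 0" by (rule poly_eq_0_if_nonneg)
  have inj: "c' = c" if "c' \<in> ?W" "e c' = e c" for c'
  proof (rule horner_sum_inj[of c' c "n + 1"])
    \<comment> \<open>The parts of a composition of \<open>n\<close> are at most \<open>n\<close>,
      hence digits in base \<open>n + 1\<close>.\<close>
    have "\<forall>x\<in>set c. x < n + 1" if "c \<in> ?W" for c
      using that member_le_sum_list[of _ c] by (fastforce simp: weak_compositions_def less_Suc_eq_le)
    then show "\<forall>x\<in>set c'. x < n + 1" "\<forall>x\<in>set c. x < n + 1" using that c by blast+
  qed (use that c in \<open>auto simp: weak_compositions_def e_def\<close>)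
  have "coeff p (e c) = (\<Sum>c'\<in>?W. if c' = c then a c else 0)"
    unfolding p_def coeff_sum by (rule sum.cong) (use inj in auto)
  also have "\<dots> = a c" using c finite_weak_compositions by simp
  finally have "a c = 0" using \<open>p = 0\<close> by simp
  then show ?thesis by (simp add: a_def)
qed

lemma volume_expansion_chip_weight:
  "volume_expansion n (restrict (\<lambda>c. fact (n + 1) * chip_weight 0 (n + 1) (site_config c)) (weak_compositions n))"
  unfolding volume_expansion_def
proof (intro conjI allI impI)
  fix u :: "nat \<Rightarrow> real" assume "\<forall>k\<in>{1..n}. 0 \<le> u k"
  then have "hyperplane_volume n (hypersimplex_sum n u) = fact (n + 1) * volume_poly 0 (n + 1) u"
    by (rule hyperplane_volume_hypersimplex_sum)
  then show "hyperplane_volume n (hypersimplex_sum n u) = (\<Sum>c\<in>weak_compositions n.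
       restrict (\<lambda>c. fact (n + 1) * chip_weight 0 (n + 1) (site_config c)) (weak_compositions n) c *
       (\<Prod>k=1..n. u k ^ (c ! (k - 1)) / fact (c ! (k - 1))))"
    unfolding volume_poly_weak_compositions sum_distrib_left by (simp add: mult.assoc)
qed simp

lemma volume_expansion_unique:
  assumes A: "volume_expansion n A" and B: "volume_expansion n B"
  shows "A = B"
proof
  fix c
  show "A c = B c"
  proof (cases "c \<in> weak_compositions n")
    case True
    have "A c - B c = 0"
    proof (rule monomial_coefficients_unique[OF _ True])
      fix u :: "nat \<Rightarrow> real" assume u: "\<forall>k\<in>{1..n}. 0 \<le> u k"
      show "(\<Sum>c\<in>weak_compositions n. (A c - B c) * (\<Prod>k=1..n. u k ^ (c ! (k - 1)) / fact (c ! (k - 1)))) = 0"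
        using A B u unfolding volume_expansion_def by (simp add: left_diff_distrib sum_subtractf)
    qed
    then show ?thesis by simp
  next
    case False
    then show ?thesis using A B by (simp add: volume_expansion_def extensional_def)
  qed
qed

text \<open>Uniqueness of the expansion evaluates the definite description; the factorial counts the
  chambers of the permutohedron.\<close>

lemma mixed_eulerian_eq:
  assumes "c \<in> weak_compositions n"
  shows "mixed_eulerian c = fact (n + 1) * chip_weight 0 (n + 1) (site_config c)"
proof -
  have len: "length c = n" using assms by (simp add: weak_compositions_def)
  have "(THE A. volume_expansion n A) = restrict (\<lambda>c. fact (n + 1) * chip_weight 0 (n + 1) (site_config c)) (weak_compositions n)"
    by (rule the_equality[where P = "volume_expansion n"])
      (use volume_expansion_chip_weight volume_expansion_unique in blast)+
  then show ?thesis using assms unfolding mixed_eulerian_def len by simp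
qed

section \<open>Chips on two adjacent sites\<close>

text \<open>For \<open>k = 0\<close> and for \<open>k = n\<close> some chips lie outside of \<open>{0<..<n + 1}\<close>, where \<open>chip_weight\<close> ignores
  them; these boundary cases start and end the chain of values below.\<close>

definition two_sites :: "nat \<Rightarrow> nat \<Rightarrow> nat \<Rightarrow> nat \<Rightarrow> nat" where
  "two_sites n k i x = (if x = k then n - i else 0) + (if x = Suc k then i else 0)"

definition two_site_number :: "nat \<Rightarrow> nat \<Rightarrow> nat \<Rightarrow> real" where
  "two_site_number n k i = fact (n + 1) * chip_weight 0 (n + 1) (two_sites n k i)"

lemma sum_two_sites:
  assumes "finite S"
  shows "sum (two_sites n k i) S = (if k \<in> S then n - i else 0) + (if Suc k \<in> S then i else 0)"
  unfolding two_sites_def using assms by (simp add: sum.distrib)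

lemma two_site_number_first:
  assumes "i \<le> n"
  shows "two_site_number n 0 i = (if i = n then 1 else 0)"
proof (cases "i = n")
  case True
  have "chip_weight 0 (n + 1) (two_sites n 0 i) = 1 / fact (n + 1 - 0)"
    by (rule chip_weight_all_first) (use True in \<open>auto simp: two_sites_def\<close>)
  then show ?thesis using True by (simp add: two_site_number_def)
next
  case False
  have "Suc (0 + sum (two_sites n 0 i) {0<..<n + 1}) \<noteq> n + 1"
    using False assms by (subst sum_two_sites) auto
  then have "chip_weight 0 (n + 1) (two_sites n 0 i) = 0" using chip_weight_nonzero by blast
  then show ?thesis using False by (simp add: two_site_number_def)
qed

lemma two_site_number_last:
  assumes "i \<le> n"
  shows "two_site_number n n i = (if i = 0 then 1 else 0)"
proof (cases "i = 0")
  case True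
  have "chip_weight 0 (n + 1) (two_sites n n i) = 1 / fact (n + 1 - 0)"
    by (rule chip_weight_all_last) (use True in \<open>auto simp: two_sites_def\<close>)
  then show ?thesis using True by (simp add: two_site_number_def)
next
  case False
  have "Suc (0 + sum (two_sites n n i) {0<..<n + 1}) \<noteq> n + 1"
    using False assms by (subst sum_two_sites) auto
  then have "chip_weight 0 (n + 1) (two_sites n n i) = 0" using chip_weight_nonzero by blast
  then show ?thesis using False by (simp add: two_site_number_def)
qed

text \<open>With all chips on site \<open>k + 1\<close>, the pair of sites can be read in two ways.
  This links the end of each row to the beginning of the next.\<close>

lemma two_site_number_chain: "two_site_number n k n = two_site_number n (Suc k) 0"
proof -
  have "two_sites n k n = two_sites n (Suc k) 0" by (auto simp: two_sites_def fun_eq_iff)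
  then show ?thesis by (simp add: two_site_number_def)
qed

text \<open>The remaining \<open>m\<close> chips lie on two adjacent sites, so a hole has all of
  them on one side and must be the first or the last site. This leaves weights of the same kind for
  \<open>m\<close>, and the Green's function at the two holes is linear in \<open>j\<close> with
  denominator \<open>m + 2\<close>.\<close>

lemma two_site_split:
  assumes k: "1 \<le> k" "k \<le> m" and i: "i \<le> m" and j: "j = k \<or> j = Suc k"
    and c: "remove_chip c j = two_sites m k i" "0 < c j"
  shows "fact (m + 2) * chip_weight 0 (m + 2) c =
         real j * two_site_number m k i + (real (m + 2) - real j) * two_site_number m (k - 1) i"
proof -
  let ?d = "two_sites m k i" and ?N = "m + 2"
  let ?t = "\<lambda>p. if ?d p = 0 then green 0 ?N j p * (chip_weight 0 p ?d * chip_weight p ?N ?d) else 0"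
  have jin: "j \<in> {0<..<?N}" using j k by auto
  have "chip_weight 0 ?N c = sum ?t {0<..<?N}"
    using chip_weight_remove_chip[of j 0 ?N c, OF jin c(2)] unfolding c(1) .
  also have "\<dots> = sum ?t {1, Suc m}"
  proof (rule sum.mono_neutral_right)
    show "\<forall>p\<in>{0<..<?N} - {1, Suc m}. ?t p = 0"
    proof (rule ballI, rule ccontr)
      fix p assume p: "p \<in> {0<..<?N} - {1, Suc m}" and "?t p \<noteq> 0"
      then have "?d p = 0" "chip_weight 0 p ?d \<noteq> 0" by (auto split: if_splits)
      then have "Suc (0 + sum ?d {0<..<p}) = p" by (intro chip_weight_nonzero)
      then have "Suc ((if k < p then m - i else 0) + (if Suc k < p then i else 0)) = p"
        using k by (subst (asm) sum_two_sites) auto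
      then show False using p \<open>?d p = 0\<close> k i by (auto simp: two_sites_def split: if_splits)
    qed
  qed auto
  also have "\<dots> = ?t 1 + ?t (Suc m)" using k by simp
  also have "?t 1 = (real ?N - real j) / real ?N * chip_weight 0 (Suc m) (two_sites m (k - 1) i)"
  proof -
    \<comment> \<open>If site 1 is occupied, too few chips lie to its right and the weight is zero
      as well.\<close>
    have "(if ?d 1 = 0 then chip_weight 1 ?N ?d else 0) = chip_weight 1 ?N ?d"
    proof (cases "?d 1 = 0")
      case False
      then have "Suc (1 + sum ?d {1<..<?N}) \<noteq> ?N"
        using k i by (subst sum_two_sites) (auto simp: two_sites_def split: if_splits)
      then show ?thesis using chip_weight_nonzero[of 1 ?N ?d] by auto
    qed simp
    moreover have "chip_weight 1 ?N ?d = chip_weight 0 (Suc m) (two_sites m (k - 1) i)"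
    proof -
      have "chip_weight (0 + 1) (Suc m + 1) ?d = chip_weight 0 (Suc m) (\<lambda>x. ?d (x + 1))" by (rule chip_weight_shift)
      moreover have "(\<lambda>x. ?d (x + 1)) = two_sites m (k - 1) i" using k by (auto simp: two_sites_def fun_eq_iff)
      ultimately show ?thesis by simp
    qed
    moreover have "min j 1 = 1" "max j 1 = j" using jin by auto
    then have "green 0 ?N j 1 = (real ?N - real j) / real ?N" by (simp only: green_def) simp
    ultimately show ?thesis by (auto split: if_splits)
  qed
  also have "?t (Suc m) = real j / real ?N * chip_weight 0 (Suc m) ?d"
  proof -
    have "(if ?d (Suc m) = 0 then chip_weight 0 (Suc m) ?d else 0) = chip_weight 0 (Suc m) ?d"
    proof (cases "?d (Suc m) = 0")
      case False
      then have "Suc (0 + sum ?d {0<..<Suc m}) \<noteq> Suc m"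
        using k i by (subst sum_two_sites) (auto simp: two_sites_def split: if_splits)
      then show ?thesis using chip_weight_nonzero[of 0 "Suc m" ?d] by auto
    qed simp
    moreover have "min j (Suc m) = j" "max j (Suc m) = Suc m" using jin by auto
    then have "green 0 ?N j (Suc m) = real j / real ?N" by (simp only: green_def) simp
    ultimately show ?thesis by (auto split: if_splits)
  qed
  finally have w: "chip_weight 0 ?N c = ((real ?N - real j) * chip_weight 0 (Suc m) (two_sites m (k - 1) i) +
      real j * chip_weight 0 (Suc m) ?d) / real ?N"
    by (simp add: add_divide_distrib)
  have "(fact ?N :: real) = real ?N * fact (m + 1)" by (simp add: numeral_2_eq_2)
  then have f: "fact ?N * (x / real ?N) = fact (m + 1) * x" for x :: real by simp
  show ?thesis unfolding w two_site_number_def f by (simp only: distrib_left mult_ac add_ac add_Suc_right One_nat_def add_0_right add_0_left)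
qed

text \<open>Remove a chip at \<open>k + 1\<close> from one configuration and at \<open>k\<close>
  from the other: both become \<open>two_sites m k i\<close>, and the coefficients in
  \<open>two_site_split\<close> differ by one. The outer rows are compared by their explicit
  values.\<close>

lemma two_site_number_step:
  assumes "k \<le> Suc m" "i \<le> m"
  shows "two_site_number (Suc m) k (Suc i) - two_site_number (Suc m) k i =
    (if k \<le> m then two_site_number m k i else 0) - (if k = 0 then 0 else two_site_number m (k - 1) i)"
proof -
  consider "k = 0" | "k = Suc m" | "1 \<le> k" "k \<le> m" using assms by linarith
  then show ?thesis
  proof cases
    case 1
    then show ?thesis using assms by (auto simp: two_site_number_first)
  next
    case 2
    have "two_site_number m (k - 1) i = (if i = 0 then 1 else 0)"
      using 2 assms two_site_number_last[of i m] by simp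
    moreover have "two_site_number (Suc m) k i = (if i = 0 then 1 else 0)"
      "two_site_number (Suc m) k (Suc i) = 0"
      using 2 assms two_site_number_last[of i "Suc m"] two_site_number_last[of "Suc i" "Suc m"] by simp_all
    ultimately show ?thesis using 2 by simp
  next
    case 3
    have r: "remove_chip (two_sites (Suc m) k i) k = two_sites m k i"
      "remove_chip (two_sites (Suc m) k (Suc i)) (Suc k) = two_sites m k i"
      using assms by (auto simp: remove_chip_def two_sites_def fun_eq_iff)
    have p: "0 < two_sites (Suc m) k i k" "0 < two_sites (Suc m) k (Suc i) (Suc k)"
      using assms by (auto simp: two_sites_def)
    have "two_site_number (Suc m) k i = real k * two_site_number m k i + (real (m + 2) - real k) * two_site_number m (k - 1) i"
      using two_site_split[OF 3 assms(2) disjI1[OF refl] r(1) p(1)]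
      by (simp add: two_site_number_def numeral_2_eq_2)
    moreover have "two_site_number (Suc m) k (Suc i) =
        real (Suc k) * two_site_number m k i + (real (m + 2) - real (Suc k)) * two_site_number m (k - 1) i"
      using two_site_split[OF 3 assms(2) disjI2[OF refl] r(2) p(2)]
      by (simp add: two_site_number_def numeral_2_eq_2)
    ultimately show ?thesis using 3 by (simp add: algebra_simps)
  qed
qed

text \<open>Relabelling that makes room for a last value \<open>v\<close>: composed with a
  permutation of \<open>{1..n}\<close>, which fixes \<open>n + 1\<close>, it yields a permutation of
  \<open>{1..n + 1}\<close> that ends in \<open>v\<close>.\<close>

definition insert_value :: "nat \<Rightarrow> nat \<Rightarrow> nat \<Rightarrow> nat" where
  "insert_value n v x = (if x = n + 1 then v else if v \<le> x \<and> x \<le> n then x + 1 else x)"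

lemma insert_value_permutes:
  assumes "v \<in> {1..n + 1}"
  shows "insert_value n v permutes {1..n + 1}"
proof (rule bij_imp_permutes)
  have "inj_on (insert_value n v) {1..n + 1}"
    using assms by (auto simp: inj_on_def insert_value_def split: if_splits)
  moreover have "insert_value n v ` {1..n + 1} \<subseteq> {1..n + 1}"
    using assms by (auto simp: insert_value_def)
  ultimately show "bij_betw (insert_value n v) {1..n + 1} {1..n + 1}"
    unfolding bij_betw_def using endo_inj_surj[of "{1..n + 1}" "insert_value n v"] by blast
  show "insert_value n v x = x" if "x \<notin> {1..n + 1}" for x
    using that assms by (auto simp: insert_value_def)
qed

text \<open>The relabelling is increasing on \<open>{1..n}\<close>, so descents before
  \<open>n\<close> are unchanged. At \<open>n\<close> the relabelled value exceeds \<open>v\<close>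
  if and only if \<open>s n\<close> was at least \<open>v\<close>.\<close>

lemma card_descents_insert_value:
  assumes s: "s permutes {1..n}" and n: "1 \<le> n" and v: "v \<in> {1..n + 1}"
  shows "card (descents (n + 1) (insert_value n v \<circ> s)) = card (descents n s) + (if v \<le> s n then 1 else 0)"
proof -
  have rng: "s x \<in> {1..n}" if "x \<in> {1..n}" for x using that permutes_in_image[OF s] by blast
  have mono: "insert_value n v x < insert_value n v y \<longleftrightarrow> x < y" if "x \<in> {1..n}" "y \<in> {1..n}" for x y
    using that by (auto simp: insert_value_def)
  have last: "s (n + 1) = n + 1" using permutes_not_in[OF s, of "n + 1"] by simp
  have "i \<in> descents (n + 1) (insert_value n v \<circ> s) \<longleftrightarrow> i \<in> descents n s \<or> i = n \<and> v \<le> s n" for i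
  proof -
    consider "i \<in> {1..<n}" | "i = n" | "i \<notin> {1..<n + 1}" by fastforce
    then show ?thesis
    proof cases
      case 1
      then have "i \<in> {1..n}" "i + 1 \<in> {1..n}" by auto
      then have "s i \<in> {1..n}" "s (i + 1) \<in> {1..n}" by (blast intro: rng)+
      then show ?thesis using 1 mono[of "s (i + 1)" "s i"] by (auto simp: descents_def)
    next
      case 2
      have "insert_value n v (s (n + 1)) = v" unfolding last by (simp add: insert_value_def)
      moreover have "v < insert_value n v (s n) \<longleftrightarrow> v \<le> s n"
        using rng[of n] n by (auto simp: insert_value_def)
      ultimately show ?thesis using 2 n by (auto simp: descents_def)
    qed (use n in \<open>auto simp: descents_def\<close>)
  qed
  then have "descents (n + 1) (insert_value n v \<circ> s) = descents n s \<union> (if v \<le> s n then {n} else {})"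
    by (auto split: if_splits)
  moreover have "n \<notin> descents n s" "finite (descents n s)" by (auto simp: descents_def)
  ultimately show ?thesis by auto
qed

lemma card_permutations_last_value:
  assumes n: "1 \<le> n" and v: "v \<in> {1..n + 1}"
  shows "card {w. w permutes {1..n + 1} \<and> card (descents (n + 1) w) = k \<and> w (n + 1) = v} =
         card {s. s permutes {1..n} \<and> card (descents n s) + (if v \<le> s n then 1 else 0) = k}"
proof -
  let ?r = "insert_value n v"
  have r: "?r permutes {1..n + 1}" by (rule insert_value_permutes[OF v])
  have rv: "?r (n + 1) = v" by (simp add: insert_value_def)
  have "bij_betw (\<lambda>s. ?r \<circ> s) {s. s permutes {1..n} \<and> card (descents n s) + (if v \<le> s n then 1 else 0) = k}
     {w. w permutes {1..n + 1} \<and> card (descents (n + 1) w) = k \<and> w (n + 1) = v}"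
  proof (rule bij_betwI[where g = "\<lambda>w. inv ?r \<circ> w"])
    show "(\<lambda>s. ?r \<circ> s) \<in> {s. s permutes {1..n} \<and> card (descents n s) + (if v \<le> s n then 1 else 0) = k} \<rightarrow>
        {w. w permutes {1..n + 1} \<and> card (descents (n + 1) w) = k \<and> w (n + 1) = v}"
    proof (rule funcsetI)
      fix s assume "s \<in> {s. s permutes {1..n} \<and> card (descents n s) + (if v \<le> s n then 1 else 0) = k}"
      then have s: "s permutes {1..n}" and k: "card (descents n s) + (if v \<le> s n then 1 else 0) = k" by auto
      have "s permutes {1..n + 1}" by (rule permutes_subset[OF s]) auto
      then have "?r \<circ> s permutes {1..n + 1}" by (rule permutes_compose) (rule r)
      moreover have "s (n + 1) = n + 1" using permutes_not_in[OF s, of "n + 1"] by simp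
      ultimately show "?r \<circ> s \<in> {w. w permutes {1..n + 1} \<and> card (descents (n + 1) w) = k \<and> w (n + 1) = v}"
        using card_descents_insert_value[OF s n v] k rv by simp
    qed
  next
    show "(\<lambda>w. inv ?r \<circ> w) \<in> {w. w permutes {1..n + 1} \<and> card (descents (n + 1) w) = k \<and> w (n + 1) = v} \<rightarrow>
      {s. s permutes {1..n} \<and> card (descents n s) + (if v \<le> s n then 1 else 0) = k}"
    proof (rule funcsetI)
      fix w assume "w \<in> {w. w permutes {1..n + 1} \<and> card (descents (n + 1) w) = k \<and> w (n + 1) = v}"
      then have w: "w permutes {1..n + 1}" "card (descents (n + 1) w) = k" "w (n + 1) = v" by auto
      let ?s = "inv ?r \<circ> w"
      have "?s permutes {1..n + 1}" by (rule permutes_compose[OF w(1) permutes_inv[OF r]])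
      then have s: "?s permutes {1..n}"
      proof (rule permutes_superset)
        fix x assume "x \<in> {1..n + 1} - {1..n}"
        then have "x = n + 1" by auto
        then show "?s x = x" using w(3) rv permutes_inverses(2)[OF r, of "n + 1"] by simp
      qed
      have "?r \<circ> ?s = w" using permutes_inv_o(1)[OF r] by (simp flip: comp_assoc)
      then show "?s \<in> {s. s permutes {1..n} \<and> card (descents n s) + (if v \<le> s n then 1 else 0) = k}"
        using s card_descents_insert_value[OF s n v] w by simp
    qed
  next
    show "inv ?r \<circ> (?r \<circ> s) = s" for s using permutes_inv_o(2)[OF r] by (simp flip: comp_assoc)
    show "?r \<circ> (inv ?r \<circ> w) = w" for w using permutes_inv_o(1)[OF r] by (simp flip: comp_assoc)
  qed
  then show ?thesis by (rule bij_betw_same_card[symmetric])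
qed

definition refined_eulerian :: "nat \<Rightarrow> nat \<Rightarrow> nat \<Rightarrow> nat" where
  "refined_eulerian n k i = card {w. w permutes {1..n + 1} \<and> card (descents (n + 1) w) = k \<and> w (n + 1) = i + 1}"

text \<open>Delete the last value and classify by the value \<open>r + 1\<close> that is last
  afterwards. The deleted step was a descent unless \<open>r < i\<close>.\<close>

lemma refined_eulerian_Suc:
  assumes "i \<le> Suc m"
  shows "refined_eulerian (Suc m) k i =
    (\<Sum>r\<le>m. if r < i then refined_eulerian m k r else if k = 0 then 0 else refined_eulerian m (k - 1) r)"
proof -
  let ?P = "\<lambda>s. s permutes {1..Suc m} \<and> card (descents (Suc m) s) + (if i + 1 \<le> s (Suc m) then 1 else 0) = k"
  have fin: "finite {s. ?P s}" by (rule finite_subset[OF _ finite_permutations[of "{1..Suc m}"]]) auto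
  have "refined_eulerian (Suc m) k i = card {s. ?P s}"
    unfolding refined_eulerian_def by (rule card_permutations_last_value) (use assms in auto)
  also have "{s. ?P s} = (\<Union>r\<le>m. {s. ?P s \<and> s (Suc m) = r + 1})"
  proof -
    have "\<exists>r\<le>m. s (Suc m) = r + 1" if "s permutes {1..Suc m}" for s
    proof -
      have "s (Suc m) \<in> {1..Suc m}" using permutes_in_image[OF that, of "Suc m"] by simp
      then show ?thesis by (intro exI[of _ "s (Suc m) - 1"]) auto
    qed
    then show ?thesis by auto
  qed
  also have "card \<dots> = (\<Sum>r\<le>m. card {s. ?P s \<and> s (Suc m) = r + 1})"
    by (rule card_UN_disjoint) (auto intro: finite_subset[OF _ fin])
  also have "\<dots> = (\<Sum>r\<le>m. if r < i then refined_eulerian m k r else if k = 0 then 0 else refined_eulerian m (k - 1) r)"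
  proof (rule sum.cong[OF refl])
    fix r
    have "{s. ?P s \<and> s (Suc m) = r + 1} =
      (if r < i then {s. s permutes {1..m + 1} \<and> card (descents (m + 1) s) = k \<and> s (m + 1) = r + 1}
       else if k = 0 then {}
       else {s. s permutes {1..m + 1} \<and> card (descents (m + 1) s) = k - 1 \<and> s (m + 1) = r + 1})"
      by auto
    then show "card {s. ?P s \<and> s (Suc m) = r + 1} =
      (if r < i then refined_eulerian m k r else if k = 0 then 0 else refined_eulerian m (k - 1) r)"
      by (simp add: refined_eulerian_def)
  qed
  finally show ?thesis .
qed

text \<open>Between \<open>i\<close> and \<open>i + 1\<close> only the term \<open>r = i\<close> of
  the recurrence changes. The result has the shape of \<open>two_site_number_step\<close>.\<close>

lemma refined_eulerian_step:
  assumes "i \<le> m"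
  shows "real (refined_eulerian (Suc m) k (Suc i)) - real (refined_eulerian (Suc m) k i) =
    real (refined_eulerian m k i) - (if k = 0 then 0 else real (refined_eulerian m (k - 1) i))"
proof -
  let ?f = "\<lambda>i r. if r < i then refined_eulerian m k r else if k = 0 then 0 else refined_eulerian m (k - 1) r"
  have s: "(\<Sum>r\<le>m. ?f j r) = ?f j i + (\<Sum>r\<in>{..m} - {i}. ?f j r)" for j
    by (rule sum.remove) (use assms in auto)
  have "(\<Sum>r\<in>{..m} - {i}. ?f (Suc i) r) = (\<Sum>r\<in>{..m} - {i}. ?f i r)"
    by (rule sum.cong) auto
  then show ?thesis
    using assms s[of i] s[of "Suc i"] by (simp add: refined_eulerian_Suc)
qed

lemma refined_eulerian_large:
  assumes "n < k"
  shows "refined_eulerian n k i = 0"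
proof -
  have "card (descents (n + 1) w) \<le> n" for w
  proof -
    have "descents (n + 1) w \<subseteq> {1..<n + 1}" by (auto simp: descents_def)
    from card_mono[OF _ this] show ?thesis by simp
  qed
  then have "card (descents (n + 1) w) \<noteq> k" for w using assms by (metis not_less)
  then show ?thesis by (simp add: refined_eulerian_def)
qed

text \<open>The difference equation determines a row from its entry at \<open>i = 0\<close>, and
  that entry equals the last one of the preceding row. For permutations the link holds because a
  largest last value never ends a descent, while a last value 1 always does.\<close>

lemma two_site_number_eq_refined_eulerian:
  "k \<le> n \<Longrightarrow> i \<le> n \<Longrightarrow> two_site_number n k i = real (refined_eulerian n k i)"
proof (induction n arbitrary: k i)
  case 0
  have "{w. w permutes {1..0 + 1} \<and> card (descents (0 + 1) w) = 0 \<and> w (0 + 1) = 0 + 1} = {id :: nat \<Rightarrow> nat}"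
    by (auto simp: descents_def)
  then show ?case using 0 two_site_number_first[of 0 0] by (simp add: refined_eulerian_def)
next
  case (Suc m)
  have IH: "(if k \<le> m then two_site_number m k i else 0) = real (refined_eulerian m k i)" if "i \<le> m" for k i
    using Suc.IH[of k i] refined_eulerian_large[of m k i] that by auto
  have step: "two_site_number (Suc m) k (Suc i) - two_site_number (Suc m) k i =
     real (refined_eulerian (Suc m) k (Suc i)) - real (refined_eulerian (Suc m) k i)" if "k \<le> Suc m" "i \<le> m" for k i
    unfolding two_site_number_step[OF that] refined_eulerian_step[OF that(2)]
    using IH[OF that(2), of k] IH[OF that(2), of "k - 1"] that by (auto split: if_splits)
  have row: "two_site_number (Suc m) k i = real (refined_eulerian (Suc m) k i)"
    if "k \<le> Suc m" "two_site_number (Suc m) k 0 = real (refined_eulerian (Suc m) k 0)" "i \<le> Suc m" for k i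
    using that(3)
  proof (induction i)
    case (Suc i)
    then show ?case using step[OF that(1), of i] by simp
  qed (use that in simp)
  have "two_site_number (Suc m) k 0 = real (refined_eulerian (Suc m) k 0)" if "k \<le> Suc m" for k
    using that
  proof (induction k)
    case 0
    then show ?case by (simp add: two_site_number_first refined_eulerian_Suc)
  next
    case (Suc k)
    have "two_site_number (Suc m) (Suc k) 0 = two_site_number (Suc m) k (Suc m)"
      by (rule two_site_number_chain[symmetric])
    also have "\<dots> = real (refined_eulerian (Suc m) k (Suc m))"
      by (rule row) (use Suc in auto)
    also have "refined_eulerian (Suc m) k (Suc m) = refined_eulerian (Suc m) (Suc k) 0"
      by (simp add: refined_eulerian_Suc)
    finally show ?case .
  qed
  then show ?case using row Suc.prems by blast
qed

text \<open>A final value 1 always follows a larger one; this descent is the \<open>+ 1\<close> in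
  \<open>eulerian\<close>.\<close>

lemma refined_eulerian_0:
  assumes "1 \<le> n"
  shows "refined_eulerian n k 0 = eulerian n k"
proof -
  have "1 \<le> s n" if "s permutes {1..n}" for s
    using permutes_in_image[OF that, of n] assms by simp
  then have "{s. s permutes {1..n} \<and> card (descents n s) + (if 1 \<le> s n then 1 else 0) = k} =
     {w. w permutes {1..n} \<and> card (descents n w) + 1 = k}" by auto
  then show ?thesis
    using card_permutations_last_value[OF assms, of 1 k] by (simp add: refined_eulerian_def eulerian_def)
qed

section \<open>Chips on a cycle\<close>

definition periodic_config :: "nat \<Rightarrow> (nat \<Rightarrow> nat) \<Rightarrow> nat \<Rightarrow> nat" where
  "periodic_config N v i = v (i mod N)"

text \<open>The window from \<open>r\<close> to \<open>r + N\<close> is the cycle cut open at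
  \<open>r\<close>. Chips on the cut are ignored, so with \<open>N - 1\<close> chips in all only
  cuts at empty sites contribute.\<close>

definition cyclic_sum :: "nat \<Rightarrow> (nat \<Rightarrow> nat) \<Rightarrow> real" where
  "cyclic_sum N v = (\<Sum>r<N. chip_weight r (r + N) (periodic_config N v))"

lemma periodic_config_add [simp]: "periodic_config N v (i + N) = periodic_config N v i"
  by (simp add: periodic_config_def)

lemma sum_window:
  "sum (periodic_config N v) {r..<r + N} = sum v {..<N}"
proof (induction r)
  case 0
  show ?case unfolding lessThan_atLeast0 add_0_left by (rule sum.cong) (auto simp: periodic_config_def)
next
  case (Suc r)
  show ?case
  proof (cases "N = 0")
    case False
    let ?f = "periodic_config N v"
    have "sum ?f {r..<Suc (r + N)} = sum ?f {r..<r + N} + ?f (r + N)" by simp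
    moreover have "sum ?f {r..<Suc (r + N)} = ?f r + sum ?f {Suc r..<Suc (r + N)}"
      by (rule sum.atLeast_Suc_lessThan) (use False in auto)
    ultimately show ?thesis using Suc by simp
  qed simp
qed

lemma sum_open_window:
  assumes "0 < N"
  shows "sum v {..<N} = periodic_config N v r + sum (periodic_config N v) {r<..<r + N}"
proof -
  have "{r..<r + N} = insert r {r<..<r + N}" using assms by auto
  then show ?thesis using sum_window[of N v r] by simp
qed

definition cyclic_offset :: "nat \<Rightarrow> nat \<Rightarrow> nat \<Rightarrow> nat" where
  "cyclic_offset N r j = (if r \<le> j then j - r else j + N - r)"

text \<open>The extra chip is the one to remove. If it lies on the cut, the left side is zero for
  lack of chips, and the right side because the Green's function vanishes at the boundary.\<close>

lemma chip_weight_window_add: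
  assumes N: "2 \<le> N" and v: "sum v {..<N} = N - 2" and r: "r < N" and j: "j < N"
  shows "chip_weight r (r + N) (periodic_config N (v(j := Suc (v j)))) =
    (\<Sum>d\<in>{1..<N}. green 0 N (cyclic_offset N r j) d *
       (chip_weight r (r + d) (periodic_config N v) * chip_weight (r + d) (r + N) (periodic_config N v)))"
proof -
  let ?g = "periodic_config N v" and ?f = "periodic_config N (v(j := Suc (v j)))"
  have win: "N - 2 = ?g r + sum ?g {r<..<r + N}" using sum_open_window[of N v r] N v by simp
  show ?thesis
  proof (cases "r = j")
    case True
    have "sum ?f {r<..<r + N} = sum ?g {r<..<r + N}"
    proof (rule sum.cong[OF refl])
      fix i assume i: "i \<in> {r<..<r + N}"
      have "i mod N \<noteq> j"
      proof (cases "i < N")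
        case False
        then have "i mod N = i - N" using i r by (simp add: le_mod_geq)
        then show ?thesis using i True by auto
      qed (use i True in auto)
      then show "?f i = ?g i" by (simp add: periodic_config_def)
    qed
    then have "Suc (r + sum ?f {r<..<r + N}) \<noteq> r + N" using win N by auto
    then have "chip_weight r (r + N) ?f = 0" using chip_weight_nonzero by blast
    moreover have "green 0 N (cyclic_offset N r j) d = 0" for d
      using True by (simp add: cyclic_offset_def green_def)
    ultimately show ?thesis by simp
  next
    case False
    define J where "J = r + cyclic_offset N r j"
    have J: "J \<in> {r<..<r + N}" "J mod N = j" using False r j by (auto simp: J_def cyclic_offset_def)
    have uniq: "i mod N \<noteq> j" if "i \<in> {r<..<r + N}" "i \<noteq> J" for i
    proof
      assume "i mod N = j"
      moreover have "i mod N = (if i < N then i else i - N)"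
        using that r by (auto simp: le_mod_geq)
      ultimately have "i = J" using that by (auto simp: J_def cyclic_offset_def split: if_splits)
      then show False using that by simp
    qed
    have eq: "remove_chip ?f J i = ?g i" if "i \<in> {r<..<r + N}" for i
      using J uniq[OF that] by (cases "i = J") (auto simp: remove_chip_def periodic_config_def)
    have "0 < ?f J" using J by (simp add: periodic_config_def)
    from chip_weight_remove_chip[of J r "r + N" ?f, OF J(1) this]
    have "chip_weight r (r + N) ?f = (\<Sum>k\<in>{r<..<r + N}. if ?g k = 0 then
       green r (r + N) J k * (chip_weight r k ?g * chip_weight k (r + N) ?g) else 0)"
    proof (rule trans, intro sum.cong refl)
      fix k assume k: "k \<in> {r<..<r + N}"
      have "chip_weight r k (remove_chip ?f J) = chip_weight r k ?g"
        "chip_weight k (r + N) (remove_chip ?f J) = chip_weight k (r + N) ?g"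
        by (rule chip_weight_cong, rule eq, use k in auto)+
      then show "(if remove_chip ?f J k = 0 then green r (r + N) J k *
          (chip_weight r k (remove_chip ?f J) * chip_weight k (r + N) (remove_chip ?f J)) else 0) =
        (if ?g k = 0 then green r (r + N) J k * (chip_weight r k ?g * chip_weight k (r + N) ?g) else 0)"
        using eq[OF k] by simp
    qed
    \<comment> \<open>Nonzero weights on both sides already use up all \<open>N - 2\<close> chips,
      so none is left for the site \<open>k\<close>.\<close>
    also have "\<dots> = (\<Sum>k\<in>{r<..<r + N}. green r (r + N) J k * (chip_weight r k ?g * chip_weight k (r + N) ?g))"
    proof (intro sum.cong refl)
      fix k assume k: "k \<in> {r<..<r + N}"
      have "chip_weight r k ?g * chip_weight k (r + N) ?g = 0" if "?g k \<noteq> 0"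
      proof (rule ccontr)
        assume "chip_weight r k ?g * chip_weight k (r + N) ?g \<noteq> 0"
        then have "Suc (r + sum ?g {r<..<k}) = k" "Suc (k + sum ?g {k<..<r + N}) = r + N"
          by (auto intro: chip_weight_nonzero)
        then show False using sum_split_open[of r k "r + N" ?g] k win that N by auto
      qed
      then show "(if ?g k = 0 then green r (r + N) J k * (chip_weight r k ?g * chip_weight k (r + N) ?g) else 0) =
        green r (r + N) J k * (chip_weight r k ?g * chip_weight k (r + N) ?g)" by auto
    qed
    also have "\<dots> = (\<Sum>d\<in>{1..<N}. green 0 N (cyclic_offset N r j) d * (chip_weight r (r + d) ?g * chip_weight (r + d) (r + N) ?g))"
    proof (rule sum.reindex_bij_witness[of _ "\<lambda>d. r + d" "\<lambda>k. k - r"], goal_cases)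
      case (5 k)
      have "green (0 + r) (N + r) (cyclic_offset N r j + r) (k - r + r) = green 0 N (cyclic_offset N r j) (k - r)"
        by (rule green_shift)
      then have "green r (r + N) J k = green 0 N (cyclic_offset N r j) (k - r)"
        using 5 by (simp add: J_def add.commute)
      then show ?case using 5 by simp
    qed auto
    finally show ?thesis .
  qed
qed

text \<open>The cut \<open>r\<close> with hole \<open>r + d\<close> and the cut \<open>r + d\<close>
  with hole \<open>r\<close> divide the cycle at the same two sites. As the chip moves, one Green's
  function rises as fast as the other falls.\<close>

lemma green_cyclic_pair:
  assumes "d \<in> {1..<N}" "r < N" "j < N"
  shows "green 0 N (cyclic_offset N r j) d +
    green 0 N (cyclic_offset N (if r + d < N then r + d else r + d - N) j) (N - d) = real d * (real N - real d) / real N"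
proof -
  define a where "a = cyclic_offset N r j"
  have a: "a < N" using assms by (auto simp: a_def cyclic_offset_def)
  have a': "cyclic_offset N (if r + d < N then r + d else r + d - N) j = (if d \<le> a then a - d else a + N - d)"
    using assms by (auto simp: a_def cyclic_offset_def)
  show ?thesis
  proof (cases "d \<le> a")
    case True
    have "min (a - d) (N - d) = a - d" "max (a - d) (N - d) = N - d" using a by auto
    moreover have "min a d = d" "max a d = a" using True by auto
    ultimately show ?thesis
      unfolding a' a_def[symmetric] green_def using True assms a
      by (simp add: of_nat_diff add_divide_distrib[symmetric]) (simp add: algebra_simps)
  next
    case False
    have "min (a + N - d) (N - d) = N - d" "max (a + N - d) (N - d) = a + N - d" using a by auto
    moreover have "min a d = a" "max a d = d" using False by auto
    ultimately show ?thesis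
      unfolding a' a_def[symmetric] green_def using False assms a
      by (simp add: of_nat_diff add_divide_distrib[symmetric]) (simp add: algebra_simps)
  qed
qed

text \<open>Each pair of holes contributes to two windows; the two Green's functions add up to a
  quantity that no longer depends on the position of the extra chip.\<close>

lemma cyclic_sum_add_chip:
  assumes N: "2 \<le> N" and v: "sum v {..<N} = N - 2" and j: "j < N"
  shows "2 * cyclic_sum N (v(j := Suc (v j))) =
    (\<Sum>(r, d)\<in>{..<N} \<times> {1..<N}. real d * (real N - real d) / real N *
      (chip_weight r (r + d) (periodic_config N v) * chip_weight (r + d) (r + N) (periodic_config N v)))"
proof -
  let ?g = "periodic_config N v"
  define Q where "Q = (\<lambda>r d. chip_weight r (r + d) ?g * chip_weight (r + d) (r + N) ?g)"
  \<comment> \<open>\<open>\<tau>\<close> exchanges cut and hole; it is an involution on the index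
    pairs that preserves the product of the weights of the two arcs.\<close>
  define \<tau> where "\<tau> = (\<lambda>(r, d). (if r + d < N then r + d else r + d - N, N - d))"
  define \<gamma> where "\<gamma> = (\<lambda>(r, d). green 0 N (cyclic_offset N r j) d)"
  have shift: "chip_weight (a + N) (b + N) ?g = chip_weight a b ?g" for a b
    unfolding chip_weight_shift by simp
  have Q: "case_prod Q (\<tau> (r, d)) = Q r d" if "r < N" "d \<in> {1..<N}" for r d
  proof (cases "r + d < N")
    case True
    have "r + d + (N - d) = r + N" "r + d + N = (r + d) + N" using that by auto
    then show ?thesis using True shift[of r "r + d"] by (simp add: Q_def \<tau>_def mult.commute)
  next
    case False
    have "r + d - N + (N - d) = r" "r + d - N + N = r + d" using that False by auto
    then show ?thesis using False shift[of "r + d - N" r] by (simp add: Q_def \<tau>_def mult.commute)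
  qed
  have 1: "cyclic_sum N (v(j := Suc (v j))) = (\<Sum>p\<in>{..<N} \<times> {1..<N}. \<gamma> p * case_prod Q p)"
  proof -
    have "cyclic_sum N (v(j := Suc (v j))) = (\<Sum>r<N. \<Sum>d\<in>{1..<N}. \<gamma> (r, d) * Q r d)"
      unfolding cyclic_sum_def
      by (rule sum.cong[OF refl]) (use chip_weight_window_add[OF N v _ j] in \<open>simp add: Q_def \<gamma>_def\<close>)
    also have "\<dots> = (\<Sum>p\<in>{..<N} \<times> {1..<N}. \<gamma> p * case_prod Q p)"
      unfolding sum.cartesian_product by (rule sum.cong) auto
    finally show ?thesis .
  qed
  also have "\<dots> = (\<Sum>p\<in>{..<N} \<times> {1..<N}. \<gamma> (\<tau> p) * case_prod Q (\<tau> p))"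
    by (rule sum.reindex_bij_witness[of _ \<tau> \<tau>]) (auto simp: \<tau>_def)
  also have "\<dots> = (\<Sum>p\<in>{..<N} \<times> {1..<N}. \<gamma> (\<tau> p) * case_prod Q p)"
  proof (rule sum.cong[OF refl])
    fix p assume "p \<in> {..<N} \<times> {1..<N}"
    then obtain r d where "p = (r, d)" "r < N" "d \<in> {1..<N}" by auto
    then show "\<gamma> (\<tau> p) * case_prod Q (\<tau> p) = \<gamma> (\<tau> p) * case_prod Q p" using Q[of r d] by simp
  qed
  finally have 2: "cyclic_sum N (v(j := Suc (v j))) = (\<Sum>p\<in>{..<N} \<times> {1..<N}. \<gamma> (\<tau> p) * case_prod Q p)" .
  have "2 * cyclic_sum N (v(j := Suc (v j))) = (\<Sum>p\<in>{..<N} \<times> {1..<N}. (\<gamma> p + \<gamma> (\<tau> p)) * case_prod Q p)"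
    using 1 2 by (simp add: sum.distrib distrib_right)
  also have "\<dots> = (\<Sum>(r, d)\<in>{..<N} \<times> {1..<N}. real d * (real N - real d) / real N * Q r d)"
  proof (rule sum.cong[OF refl])
    fix p assume "p \<in> {..<N} \<times> {1..<N}"
    then obtain r d where p: "p = (r, d)" "r < N" "d \<in> {1..<N}" by auto
    have "\<gamma> p + \<gamma> (\<tau> p) = real d * (real N - real d) / real N"
      unfolding p \<gamma>_def \<tau>_def using green_cyclic_pair[OF p(3,2) j] by simp
    then show "(\<gamma> p + \<gamma> (\<tau> p)) * case_prod Q p = (case p of (r, d) \<Rightarrow> real d * (real N - real d) / real N * Q r d)"
      by (simp add: p)
  qed
  finally show ?thesis unfolding Q_def .
qed

lemma cyclic_sum_cong:
  assumes "\<And>i. i < N \<Longrightarrow> v i = w i"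
  shows "cyclic_sum N v = cyclic_sum N w"
proof (cases "N = 0")
  case False
  have "periodic_config N v i = periodic_config N w i" for i
    unfolding periodic_config_def by (rule assms) (use False in simp)
  then have "periodic_config N v = periodic_config N w" by (rule ext)
  then show ?thesis by (simp add: cyclic_sum_def)
qed (simp add: cyclic_sum_def)

text \<open>Chips are carried to site 0 one by one. By \<open>cyclic_sum_add_chip\<close> the sum
  depends only on the configuration without the moving chip.\<close>

lemma cyclic_sum_collect:
  assumes N: "2 \<le> N" and v: "sum v {..<N} = N - 1"
  shows "cyclic_sum N v = cyclic_sum N (\<lambda>i. if i = 0 then N - 1 else 0)"
  using v
proof (induction "sum v {1..<N}" arbitrary: v)
  case 0
  have split: "sum v {..<N} = v 0 + sum v {1..<N}"
    unfolding lessThan_atLeast0 using sum.atLeast_Suc_lessThan[of 0 N v] N by simp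
  show ?case by (rule cyclic_sum_cong) (use 0 split in \<open>auto simp: Suc_le_eq\<close>)
next
  case (Suc s)
  have "\<exists>j\<in>{1..<N}. v j \<noteq> 0" using Suc(2) by (metis nat.distinct(1) sum.neutral)
  then obtain j where j: "j \<in> {1..<N}" "0 < v j" by auto
  define g where "g = remove_chip v j"
  have v_eq: "v = g(j := Suc (g j))" using j by (auto simp: g_def remove_chip_def)
  have sg: "sum v {..<N} = Suc (sum g {..<N})" "sum v {1..<N} = Suc (sum g {1..<N})"
    unfolding g_def by (rule sum_remove_chip; use j in auto)+
  define w where "w = g(0 := Suc (g 0))"
  have g: "sum g {..<N} = N - 2" using sg Suc.prems by simp
  have "2 * cyclic_sum N v = 2 * cyclic_sum N w"
    unfolding w_def by (subst v_eq) (use cyclic_sum_add_chip[OF N g] j N in auto)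
  moreover have "cyclic_sum N w = cyclic_sum N (\<lambda>i. if i = 0 then N - 1 else 0)"
  proof (rule Suc.hyps(1))
    have "sum w {1..<N} = sum g {1..<N}" by (rule sum.cong) (auto simp: w_def)
    then show "s = sum w {1..<N}" using sg Suc.hyps(2) by simp
    have "sum w {..<N} = Suc (sum (remove_chip w 0) {..<N})"
      by (rule sum_remove_chip) (use N in \<open>auto simp: w_def\<close>)
    also have "remove_chip w 0 = g" by (auto simp: w_def remove_chip_def)
    finally show "sum w {..<N} = N - 1" using g N by simp
  qed
  ultimately show ?case by simp
qed

text \<open>The constant is found with one chip on every site except 0: only the cut at 0
  contributes, and its weight is \<open>fact (N - 1) / fact N\<close>.\<close>

theorem cyclic_sum_eq:
  assumes N: "2 \<le> N" and v: "sum v {..<N} = N - 1"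
  shows "cyclic_sum N v = 1 / real N"
proof -
  define w :: "nat \<Rightarrow> nat" where "w = (\<lambda>i. if i = 0 then 0 else 1)"
  have "sum w {..<N} = w 0 + sum w {1..<N}"
    unfolding lessThan_atLeast0 using sum.atLeast_Suc_lessThan[of 0 N w] N by simp
  moreover have "sum w {1..<N} = (\<Sum>i\<in>{1..<N}. 1)" by (rule sum.cong) (auto simp: w_def)
  ultimately have sw: "sum w {..<N} = N - 1" by (simp add: w_def)
  have "cyclic_sum N v = cyclic_sum N w" using cyclic_sum_collect[OF N v] cyclic_sum_collect[OF N sw] by simp
  also have "\<dots> = (\<Sum>r\<in>{0}. chip_weight r (r + N) (periodic_config N w))"
    unfolding cyclic_sum_def
  proof (rule sum.mono_neutral_right)
    show "\<forall>r\<in>{..<N} - {0}. chip_weight r (r + N) (periodic_config N w) = 0"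
    proof
      fix r assume r: "r \<in> {..<N} - {0}"
      then have "N - 1 = 1 + sum (periodic_config N w) {r<..<r + N}"
        using sum_open_window[of N w r] sw by (simp add: periodic_config_def w_def)
      then have "Suc (r + sum (periodic_config N w) {r<..<r + N}) \<noteq> r + N" by auto
      then show "chip_weight r (r + N) (periodic_config N w) = 0" using chip_weight_nonzero by blast
    qed
  qed (use N in auto)
  also have "\<dots> = chip_weight 0 N (\<lambda>i. 1)"
  proof -
    have "chip_weight 0 N (periodic_config N w) = chip_weight 0 N (\<lambda>i. 1)"
      by (rule chip_weight_cong) (auto simp: periodic_config_def w_def)
    then show ?thesis by simp
  qed
  also have "\<dots> = (\<Prod>i\<in>{0<..<N}. real i ^ 1) / fact N"
    by (rule chip_weight_parking) (use N in auto)
  also have "(\<Prod>i\<in>{0<..<N}. real i ^ 1) = fact (N - 1)"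
  proof -
    have "{0<..<N} = {1..N - 1}" using N by auto
    then show ?thesis by (simp add: fact_prod)
  qed
  also have "(fact N :: real) = real N * fact (N - 1)" using N by (simp add: fact_reduce)
  finally show ?thesis by simp
qed

section \<open>Rotations of lists\<close>

definition lists_with_sum :: "nat \<Rightarrow> nat \<Rightarrow> nat list set" where
  "lists_with_sum m s = {xs. length xs = m \<and> sum_list xs = s}"

lemma finite_lists_with_sum: "finite (lists_with_sum m s)"
proof (rule finite_subset)
  show "lists_with_sum m s \<subseteq> {xs. set xs \<subseteq> {..s} \<and> length xs = m}"
    using member_le_sum_list by (auto simp: lists_with_sum_def)
qed (simp add: finite_lists_length_eq)

lemma rotate_lists_with_sum: "xs \<in> lists_with_sum m s \<Longrightarrow> rotate r xs \<in> lists_with_sum m s"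
proof (induction r)
  case (Suc r)
  have "sum_list (rotate1 ys) = sum_list ys" for ys :: "nat list" by (cases ys) auto
  then show ?case using Suc by (simp add: lists_with_sum_def)
qed simp

text \<open>Each rotation permutes the lists and keeps \<open>weight\<close>. Summing over all
  \<open>N\<close> rotations, rather than over orbits, treats periodic lists correctly as
  well.\<close>

lemma rotation_double_count:
  fixes W weight :: "nat list \<Rightarrow> real"
  assumes "0 < N" and weight: "\<And>xs. weight (rotate1 xs) = weight xs"
    and W: "\<And>xs. xs \<in> lists_with_sum N s \<Longrightarrow> (\<Sum>r<N. W (rotate r xs)) = C"
  shows "real N * (\<Sum>xs\<in>lists_with_sum N s. weight xs * W xs) = C * (\<Sum>xs\<in>lists_with_sum N s. weight xs)"
proof -
  let ?S = "lists_with_sum N s"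
  have wr: "weight (rotate r xs) = weight xs" for r xs by (induction r) (simp_all add: weight)
  have "C * (\<Sum>xs\<in>?S. weight xs) = (\<Sum>xs\<in>?S. \<Sum>r<N. weight (rotate r xs) * W (rotate r xs))"
    unfolding sum_distrib_left
  proof (rule sum.cong[OF refl])
    fix xs assume xs: "xs \<in> ?S"
    show "C * weight xs = (\<Sum>r<N. weight (rotate r xs) * W (rotate r xs))"
      unfolding W[OF xs, symmetric] sum_distrib_right wr by (rule sum.cong[OF refl]) (rule mult.commute)
  qed
  also have "\<dots> = (\<Sum>r<N. \<Sum>xs\<in>?S. weight (rotate r xs) * W (rotate r xs))" by (rule sum.swap)
  also have "\<dots> = (\<Sum>r<N. \<Sum>xs\<in>?S. weight xs * W xs)"
  proof (rule sum.cong[OF refl])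
    fix r assume r: "r \<in> {..<N}"
    have inv: "rotate (N - r) (rotate r xs) = xs" "rotate r (rotate (N - r) xs) = xs" if "xs \<in> ?S" for xs
      using that r by (auto simp: rotate_rotate lists_with_sum_def)
    show "(\<Sum>xs\<in>?S. weight (rotate r xs) * W (rotate r xs)) = (\<Sum>xs\<in>?S. weight xs * W xs)"
      by (rule sum.reindex_bij_witness[of _ "rotate (N - r)" "rotate r"]) (use inv rotate_lists_with_sum in auto)
  qed
  finally show ?thesis by simp
qed

lemma sum_lists_with_sum_Cons_0:
  fixes F :: "nat list \<Rightarrow> real"
  assumes "\<And>xs. xs \<in> lists_with_sum (n + 1) n \<Longrightarrow> xs ! 0 \<noteq> 0 \<Longrightarrow> F xs = 0"
  shows "(\<Sum>xs\<in>lists_with_sum (n + 1) n. F xs) = (\<Sum>c\<in>weak_compositions n. F (0 # c))"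
proof -
  have "(\<Sum>xs\<in>lists_with_sum (n + 1) n. F xs) = (\<Sum>xs\<in>{xs \<in> lists_with_sum (n + 1) n. xs ! 0 = 0}. F xs)"
    by (rule sum.mono_neutral_right) (use assms finite_lists_with_sum in auto)
  also have "\<dots> = (\<Sum>c\<in>weak_compositions n. F (0 # c))"
  proof (rule sum.reindex_bij_witness[of _ "\<lambda>c. 0 # c" tl], goal_cases)
    case (1 xs)
    then show ?case by (cases xs) (auto simp: lists_with_sum_def)
  next
    case (2 xs)
    then show ?case by (cases xs) (auto simp: lists_with_sum_def weak_compositions_def)
  next
    case (5 xs)
    then show ?case by (cases xs) (auto simp: lists_with_sum_def)
  qed (auto simp: lists_with_sum_def weak_compositions_def)
  finally show ?thesis .
qed

lemma sum_nth_lists_with_sum: "xs \<in> lists_with_sum m s \<Longrightarrow> sum ((!) xs) {0..<m} = s"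
  by (auto simp: lists_with_sum_def sum_list_sum_nth)

lemma sum_nth_split:
  assumes "xs \<in> lists_with_sum (n + 1) n"
  shows "n = xs ! 0 + sum ((!) xs) {0<..<n + 1}"
proof -
  have "n = sum ((!) xs) {0..<n + 1}" using assms by (simp only: sum_nth_lists_with_sum)
  also have "\<dots> = xs ! 0 + sum ((!) xs) {Suc 0..<n + 1}" by (rule sum.atLeast_Suc_lessThan) simp
  finally show ?thesis by (simp only: atLeastSucLessThan_greaterThanLessThan)
qed

lemma sum_rotated_chip_weight:
  assumes n: "1 \<le> n" and xs: "xs \<in> lists_with_sum (n + 1) n"
  shows "(\<Sum>r<n + 1. chip_weight 0 (n + 1) ((!) (rotate r xs))) = 1 / real (n + 1)"
proof -
  have "chip_weight 0 (n + 1) ((!) (rotate r xs)) = chip_weight r (r + (n + 1)) (periodic_config (n + 1) ((!) xs))" for r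
  proof -
    have "chip_weight (0 + r) (n + 1 + r) (periodic_config (n + 1) ((!) xs)) =
        chip_weight 0 (n + 1) (\<lambda>i. periodic_config (n + 1) ((!) xs) (i + r))"
      by (rule chip_weight_shift)
    also have "\<dots> = chip_weight 0 (n + 1) ((!) (rotate r xs))"
      by (rule chip_weight_cong) (use xs in \<open>auto simp: periodic_config_def lists_with_sum_def nth_rotate add.commute\<close>)
    finally show ?thesis by (simp add: add.commute)
  qed
  then have "(\<Sum>r<n + 1. chip_weight 0 (n + 1) ((!) (rotate r xs))) = cyclic_sum (n + 1) ((!) xs)"
    by (simp only: cyclic_sum_def)
  also have "\<dots> = 1 / real (n + 1)"
  proof (rule cyclic_sum_eq)
    show "sum ((!) xs) {..<n + 1} = n + 1 - 1"
      unfolding lessThan_atLeast0 sum_nth_lists_with_sum[OF xs] by simp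
  qed (use n in simp)
  finally show ?thesis .
qed

text \<open>One factor \<open>n + 1\<close> is the number of rotations, the other comes from the
  value \<open>1 / (n + 1)\<close> of each sum over rotations. Position 0 is the cut, so lists with
  a chip there drop out and those of the form \<open>0 # c\<close> remain.\<close>

lemma sum_weighted_chip_weight:
  fixes weight :: "nat list \<Rightarrow> real"
  assumes n: "1 \<le> n" and weight: "\<And>xs. weight (rotate1 xs) = weight xs"
  shows "(\<Sum>c\<in>weak_compositions n. weight (0 # c) * chip_weight 0 (n + 1) (site_config c)) =
    (\<Sum>xs\<in>lists_with_sum (n + 1) n. weight xs) / real (n + 1) ^ 2"
proof -
  let ?W = "\<lambda>xs. chip_weight 0 (n + 1) ((!) xs)"
  have "real (n + 1) * (\<Sum>xs\<in>lists_with_sum (n + 1) n. weight xs * ?W xs) =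
      1 / real (n + 1) * (\<Sum>xs\<in>lists_with_sum (n + 1) n. weight xs)"
    by (rule rotation_double_count[where W = ?W]) (use weight sum_rotated_chip_weight[OF n] in auto)
  moreover have "(\<Sum>xs\<in>lists_with_sum (n + 1) n. weight xs * ?W xs) = (\<Sum>c\<in>weak_compositions n. weight (0 # c) * ?W (0 # c))"
  proof (rule sum_lists_with_sum_Cons_0)
    fix xs assume xs: "xs \<in> lists_with_sum (n + 1) n" "xs ! 0 \<noteq> 0"
    then have "Suc (0 + sum ((!) xs) {0<..<n + 1}) \<noteq> n + 1" using sum_nth_split[OF xs(1)] by auto
    then show "weight xs * ?W xs = 0" using chip_weight_nonzero by (metis mult_zero_right)
  qed
  moreover have "?W (0 # c) = chip_weight 0 (n + 1) (site_config c)" if "c \<in> weak_compositions n" for c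
    by (rule chip_weight_cong) (use that in \<open>auto simp: site_config_def weak_compositions_def nth_Cons'\<close>)
  ultimately have "real (n + 1) * (\<Sum>c\<in>weak_compositions n. weight (0 # c) * chip_weight 0 (n + 1) (site_config c)) =
     1 / real (n + 1) * (\<Sum>xs\<in>lists_with_sum (n + 1) n. weight xs)" by simp
  then show ?thesis by (simp add: power2_eq_square divide_simps mult_ac)
qed

text \<open>The multinomial theorem for a sum of \<open>m\<close> ones, divided by
  \<open>fact s\<close>.\<close>

lemma sum_inverse_factorials:
  "(\<Sum>xs\<in>lists_with_sum m s. prod_list (map (\<lambda>x. 1 / fact x) xs)) = real m ^ s / fact s"
proof (induction m arbitrary: s)
  case 0
  have "lists_with_sum 0 0 = {[]}" "s \<noteq> 0 \<Longrightarrow> lists_with_sum 0 s = {}" by (auto simp: lists_with_sum_def)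
  then show ?case by (cases "s = 0") simp_all
next
  case (Suc m)
  let ?f = "\<lambda>xs. prod_list (map (\<lambda>x. 1 / fact x) xs) :: real"
  have "(\<Sum>xs\<in>lists_with_sum (Suc m) s. ?f xs) = (\<Sum>(x, xs)\<in>(SIGMA x:{..s}. lists_with_sum m (s - x)). ?f (x # xs))"
  proof (rule sum.reindex_bij_witness[of _ "\<lambda>(x, xs). x # xs" "\<lambda>xs. (hd xs, tl xs)"], goal_cases)
    case (1 xs)
    then show ?case by (cases xs) (auto simp: lists_with_sum_def)
  next
    case (2 xs)
    then show ?case by (cases xs) (auto simp: lists_with_sum_def)
  next
    case (5 xs)
    then show ?case by (cases xs) (auto simp: lists_with_sum_def)
  qed (auto simp: lists_with_sum_def)
  also have "\<dots> = (\<Sum>x\<le>s. \<Sum>xs\<in>lists_with_sum m (s - x). 1 / fact x * ?f xs)"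
    by (subst sum.Sigma) (auto simp: finite_lists_with_sum)
  also have "\<dots> = (\<Sum>x\<le>s. 1 / fact x * (real m ^ (s - x) / fact (s - x)))"
    unfolding sum_distrib_left[symmetric] Suc.IH ..
  also have "\<dots> = (\<Sum>x\<le>s. real (s choose x) * 1 ^ x * real m ^ (s - x)) / fact s"
    unfolding sum_divide_distrib by (rule sum.cong) (auto simp: binomial_fact)
  also have "\<dots> = (1 + real m) ^ s / fact s" unfolding binomial_ring by simp
  finally show ?case by simp
qed

section \<open>Ballot sequences and the cycle lemma\<close>

lemma card_lists_with_sum: "card (lists_with_sum (n + 1) n) = (2 * n) choose n"
  unfolding lists_with_sum_def using card_length_sum_list[of "n + 1" n] by (simp add: mult_2)

text \<open>The position \<open>r + 1\<close> is the leftmost minimum of the excess \<open>q\<close> of the partial sums.\<close>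

lemma cycle_lemma:
  assumes N: "0 < N" and v: "sum v {..<N} = N - 1"
  shows "\<exists>!r. r < N \<and> (\<forall>i<N. i \<le> (\<Sum>l=1..i. periodic_config N v (r + l)))"
proof -
  let ?f = "periodic_config N v"
  define q where "q = (\<lambda>j. int (sum ?f {..<j}) - int j)"
  \<comment> \<open>A period has \<open>N\<close> sites and \<open>N - 1\<close> chips, so the
    excess drops by one; this is what breaks ties between equal minima.\<close>
  have shift: "q (j + N) = q j - 1" for j
  proof -
    have "sum ?f {..<j + N} = sum ?f {..<j} + sum ?f {j..<j + N}"
      unfolding lessThan_atLeast0 by (rule sum.atLeastLessThan_concat[symmetric]) auto
    also have "sum ?f {j..<j + N} = N - 1" using sum_window[of N v j] v by simp
    finally show ?thesis using N unfolding q_def by linarith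
  qed
  have cond: "i \<le> (\<Sum>l=1..i. ?f (r + l)) \<longleftrightarrow> q (r + 1) \<le> q (r + 1 + i)" for r i
  proof -
    have "q (r + 1 + i) - q (r + 1) = int (\<Sum>l=1..i. ?f (r + l)) - int i"
      by (induction i) (simp_all add: q_def)
    then show ?thesis by linarith
  qed
  \<comment> \<open>Positions beyond \<open>N\<close> are those before \<open>r + 1\<close> moved by
    one period, where the excess is lower by one; hence the strict inequality for
    \<open>j < r + 1\<close>.\<close>
  have good: "(\<forall>i<N. i \<le> (\<Sum>l=1..i. ?f (r + l))) \<longleftrightarrow>
     (\<forall>j\<in>{1..N}. q (r + 1) \<le> q j \<and> (j < r + 1 \<longrightarrow> q (r + 1) < q j))" if r: "r < N" for r
    unfolding cond
  proof (intro iffI ballI allI impI)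
    fix j assume a: "\<forall>i<N. q (r + 1) \<le> q (r + 1 + i)" and j: "j \<in> {1..N}"
    show "q (r + 1) \<le> q j \<and> (j < r + 1 \<longrightarrow> q (r + 1) < q j)"
    proof (cases "j < r + 1")
      case True
      have "r + 1 + (j + N - (r + 1)) = j + N" "j + N - (r + 1) < N" using True r by auto
      then have "q (r + 1) \<le> q (j + N)" using a by metis
      then show ?thesis unfolding shift by simp
    next
      case False
      then have "r + 1 + (j - (r + 1)) = j" "j - (r + 1) < N" using j by auto
      then show ?thesis using a False by metis
    qed
  next
    fix i assume a: "\<forall>j\<in>{1..N}. q (r + 1) \<le> q j \<and> (j < r + 1 \<longrightarrow> q (r + 1) < q j)" and i: "i < N"
    show "q (r + 1) \<le> q (r + 1 + i)"
    proof (cases "r + 1 + i \<le> N")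
      case True
      then have "r + 1 + i \<in> {1..N}" by auto
      then show ?thesis using a by blast
    next
      case False
      define j where "j = r + 1 + i - N"
      have j: "r + 1 + i = j + N" "j \<in> {1..N}" "j < r + 1" using False i r by (auto simp: j_def)
      then have "q (r + 1) < q j" using a by blast
      then show ?thesis unfolding j(1) shift by simp
    qed
  qed
  define \<mu> where "\<mu> = Min (q ` {1..N})"
  have "\<mu> \<in> q ` {1..N}" unfolding \<mu>_def using N by (intro Min_in) auto
  then have ex: "\<exists>p. p \<in> {1..N} \<and> q p = \<mu>" by blast
  have min: "\<mu> \<le> q j" if "j \<in> {1..N}" for j unfolding \<mu>_def using that by (intro Min_le) auto
  define p where "p = (LEAST p. p \<in> {1..N} \<and> q p = \<mu>)"
  have p: "p \<in> {1..N}" "q p = \<mu>" using LeastI_ex[OF ex] unfolding p_def by blast+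
  have pleast: "p \<le> j" if "j \<in> {1..N}" "q j = \<mu>" for j
    unfolding p_def by (rule Least_le) (use that in blast)
  obtain r where r: "p = r + 1" "r < N" using p(1) by (cases p) auto
  show ?thesis
  proof (rule ex1I[of _ r])
    have "\<forall>j\<in>{1..N}. q (r + 1) \<le> q j \<and> (j < r + 1 \<longrightarrow> q (r + 1) < q j)"
    proof (intro ballI conjI impI)
      fix j assume j: "j \<in> {1..N}"
      show "q (r + 1) \<le> q j" using min[OF j] p(2) r by simp
      assume "j < r + 1"
      then have "q j \<noteq> \<mu>" using pleast[OF j] r by auto
      then show "q (r + 1) < q j" using min[OF j] p(2) r by simp
    qed
    then show "r < N \<and> (\<forall>i<N. i \<le> (\<Sum>l=1..i. ?f (r + l)))" using good[OF r(2)] r(2) by blast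
  next
    fix r' assume "r' < N \<and> (\<forall>i<N. i \<le> (\<Sum>l=1..i. ?f (r' + l)))"
    then have r': "r' < N" "\<forall>j\<in>{1..N}. q (r' + 1) \<le> q j \<and> (j < r' + 1 \<longrightarrow> q (r' + 1) < q j)"
      using good[of r'] by blast+
    have "r + 1 \<in> {1..N}" "r' + 1 \<in> {1..N}" using r r' by auto
    then have le: "q (r' + 1) \<le> q (r + 1)" and "r + 1 < r' + 1 \<longrightarrow> q (r' + 1) < q (r + 1)" using r'(2) by blast+
    moreover have "q (r + 1) \<le> q (r' + 1)" using min[OF \<open>r' + 1 \<in> {1..N}\<close>] p(2) r(1) by simp
    ultimately have "\<not> r + 1 < r' + 1" "r + 1 \<le> r' + 1"
      using pleast[OF \<open>r' + 1 \<in> {1..N}\<close>] p(2) r(1) by auto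
    then show "r' = r" by simp
  qed
qed

text \<open>Exactly one of the \<open>n + 1\<close> rotations of a list satisfies the ballot
  condition for all \<open>i \<le> n\<close>. It starts with 0, because its other entries already
  sum to \<open>n\<close>, and dropping this 0 gives the compositions in question.\<close>

lemma card_ballot_compositions:
  "real (card {c \<in> weak_compositions n. \<forall>i\<in>{1..n - 1}. i \<le> (\<Sum>j=1..i. c ! (j - 1))}) = catalan n"
proof -
  define F :: "nat list \<Rightarrow> real" where "F = (\<lambda>xs. if \<forall>i<n + 1. i \<le> (\<Sum>l=1..i. xs ! l) then 1 else 0)"
  have rot: "(\<Sum>r<n + 1. F (rotate r xs)) = 1" if xs: "xs \<in> lists_with_sum (n + 1) n" for xs
  proof -
    have sum: "sum ((!) xs) {..<n + 1} = n + 1 - 1"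
      unfolding lessThan_atLeast0 sum_nth_lists_with_sum[OF xs] by simp
    define G where "G = (\<lambda>r. \<forall>i<n + 1. i \<le> (\<Sum>l=1..i. periodic_config (n + 1) ((!) xs) (r + l)))"
    have eq: "(\<Sum>l=1..i. rotate r xs ! l) = (\<Sum>l=1..i. periodic_config (n + 1) ((!) xs) (r + l))" if "i < n + 1" for r i
      by (rule sum.cong) (use xs that in \<open>auto simp: periodic_config_def lists_with_sum_def nth_rotate\<close>)
    have FG: "F (rotate r xs) = (if G r then 1 else 0)" for r
    proof -
      have "(\<forall>i<n + 1. i \<le> (\<Sum>l=1..i. rotate r xs ! l)) \<longleftrightarrow> G r"
        unfolding G_def using eq by metis
      then show ?thesis unfolding F_def by simp
    qed
    have ex1: "\<exists>!r. r < n + 1 \<and> G r" unfolding G_def by (rule cycle_lemma[OF _ sum]) simp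
    then obtain r0 where r0: "r0 < n + 1" "G r0" by blast
    have r0_unique: "r = r0" if "r < n + 1" "G r" for r using ex1 r0 that by blast
    have "(\<Sum>r<n + 1. F (rotate r xs)) = (\<Sum>r<n + 1. if r = r0 then 1 else 0)"
    proof (rule sum.cong[OF refl])
      fix r assume "r \<in> {..<n + 1}"
      then have "G r \<longleftrightarrow> r = r0" using r0(2) r0_unique[of r] by blast
      then show "F (rotate r xs) = (if r = r0 then 1 else 0)" unfolding FG by simp
    qed
    also have "\<dots> = 1" using r0(1) by simp
    finally show ?thesis .
  qed
  have "real (n + 1) * (\<Sum>xs\<in>lists_with_sum (n + 1) n. 1 * F xs) = 1 * (\<Sum>xs\<in>lists_with_sum (n + 1) n. 1)"
    by (rule rotation_double_count) (use rot in auto)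
  also have "(\<Sum>xs\<in>lists_with_sum (n + 1) n. 1) = real ((2 * n) choose n)"
    using card_lists_with_sum[of n] by simp
  also have "(\<Sum>xs\<in>lists_with_sum (n + 1) n. 1 * F xs) = (\<Sum>c\<in>weak_compositions n. 1 * F (0 # c))"
  proof (rule sum_lists_with_sum_Cons_0)
    fix xs assume xs: "xs \<in> lists_with_sum (n + 1) n" "xs ! 0 \<noteq> 0"
    have "{0<..<n + 1} = {1..n}" by auto
    then have "\<not> n \<le> (\<Sum>l=1..n. xs ! l)" using sum_nth_split[OF xs(1)] xs(2) by simp
    then show "1 * F xs = 0" by (auto simp: F_def)
  qed
  also have "\<dots> = (\<Sum>c\<in>weak_compositions n. if \<forall>i\<in>{1..n - 1}. i \<le> (\<Sum>j=1..i. c ! (j - 1)) then 1 else 0)"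
  proof (rule sum.cong[OF refl])
    fix c assume c: "c \<in> weak_compositions n"
    have s: "(\<Sum>l=1..i. (0 # c) ! l) = (\<Sum>j=1..i. c ! (j - 1))" for i
      by (rule sum.cong) (auto simp: nth_Cons')
    have "0 # c \<in> lists_with_sum (n + 1) n" using c by (simp add: lists_with_sum_def weak_compositions_def)
    then have "(\<Sum>l=1..n. (0 # c) ! l) = n"
      using sum_nth_split[of "0 # c" n] by (simp add: atLeastSucLessThan_greaterThanLessThan[symmetric] atLeastLessThanSuc_atLeastAtMost)
    then have last: "(\<Sum>j=1..n. c ! (j - 1)) = n" unfolding s .
    have "(\<forall>i<n + 1. i \<le> (\<Sum>j=1..i. c ! (j - 1))) \<longleftrightarrow> (\<forall>i\<in>{1..n - 1}. i \<le> (\<Sum>j=1..i. c ! (j - 1)))"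
    proof (intro iffI ballI allI impI)
      fix i assume a: "\<forall>i\<in>{1..n - 1}. i \<le> (\<Sum>j=1..i. c ! (j - 1))" and "i < n + 1"
      then consider "i = 0" | "i = n" | "i \<in> {1..n - 1}" by fastforce
      then show "i \<le> (\<Sum>j=1..i. c ! (j - 1))" using last a by cases auto
    next
      fix i assume a: "\<forall>i<n + 1. i \<le> (\<Sum>j=1..i. c ! (j - 1))" and "i \<in> {1..n - 1}"
      then have "i < n + 1" by auto
      then show "i \<le> (\<Sum>j=1..i. c ! (j - 1))" using a by blast
    qed
    then show "1 * F (0 # c) = (if \<forall>i\<in>{1..n - 1}. i \<le> (\<Sum>j=1..i. c ! (j - 1)) then 1 else 0)"
      unfolding F_def s by simp
  qed
  also have "\<dots> = real (card {c \<in> weak_compositions n. \<forall>i\<in>{1..n - 1}. i \<le> (\<Sum>j=1..i. c ! (j - 1))})"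
    using finite_weak_compositions[of n] by (simp flip: sum.inter_filter)
  finally show ?thesis unfolding catalan_def by (simp add: field_simps)
qed

theorem theorem16p3:
  fixes n :: nat
  assumes "n \<ge> 1"
  shows
    "(\<forall>c\<in>weak_compositions n. mixed_eulerian c \<in> \<int> \<and> mixed_eulerian c > 0) \<and>
     (\<forall>c\<in>weak_compositions n. mixed_eulerian c = mixed_eulerian (rev c)) \<and>
     (\<forall>k\<in>{1..n}.
        mixed_eulerian (replicate (k - 1) 0 @ [n] @ replicate (n - k) 0) = real (eulerian n k)) \<and>
     (\<Sum>c\<in>weak_compositions n. 1 / (\<Prod>i=1..n. fact (c ! (i - 1))) * mixed_eulerian c) =
        (real n + 1) ^ (n - 1) \<and>
     (\<Sum>c\<in>weak_compositions n. mixed_eulerian c) = fact n * catalan n \<and>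
     (\<forall>k\<in>{1..n - 1}. \<forall>i\<in>{0..n}.
        mixed_eulerian (replicate (k - 1) 0 @ [n - i, i] @ replicate (n - k - 1) 0) =
        real (card {w. w permutes {1..n + 1} \<and> card (descents (n + 1) w) = k \<and>
                       w (n + 1) = i + 1})) \<and>
     mixed_eulerian (replicate n 1) = fact n \<and>
     (n \<ge> 2 \<longrightarrow> (\<forall>k\<in>{0..n}.
        mixed_eulerian ([k] @ replicate (n - 2) 0 @ [n - k]) = real (n choose k))) \<and>
     (\<forall>c\<in>weak_compositions n.
        (\<forall>i\<in>{1..n - 1}. (\<Sum>j=1..i. c ! (j - 1)) \<ge> i) \<longrightarrow>
        mixed_eulerian c = (\<Prod>i=1..n. real i ^ (c ! (i - 1)))) \<and>
     real (card {c\<in>weak_compositions n. \<forall>i\<in>{1..n - 1}. (\<Sum>j=1..i. c ! (j - 1)) \<ge> i}) =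
        catalan n"
proof -
  let ?W = "weak_compositions n"
  let ?w = "\<lambda>c. chip_weight 0 (n + 1) (site_config c)"
  have sum_c: "sum (site_config c) {0<..<n + 1} = n" if "c \<in> ?W" for c
    using sum_site_config[of c] that by (simp add: weak_compositions_def)
  have positive_integer: "mixed_eulerian c \<in> \<int> \<and> mixed_eulerian c > 0" if c: "c \<in> ?W" for c
    unfolding mixed_eulerian_eq[OF c]
    using fact_chip_weight_Ints[of "n + 1" 0 "site_config c"] chip_weight_pos[of 0 "site_config c" "n + 1"] sum_c[OF c]
    by (simp del: fact_Suc)
  have symmetric: "mixed_eulerian c = mixed_eulerian (rev c)" if c: "c \<in> ?W" for c
  proof -
    have r: "rev c \<in> ?W" using c by (simp add: weak_compositions_def)
    have len: "length c = n" using c by (simp add: weak_compositions_def)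
    \<comment> \<open>Reversal of the list is the reflection that sends site \<open>i\<close> to
      \<open>n + 1 - i\<close>.\<close>
    have "?w (rev c) = chip_weight (n + 1 - (n + 1)) (n + 1 - 0) (\<lambda>i. site_config c (n + 1 - i))"
      unfolding diff_self_eq_0 diff_zero
    proof (rule chip_weight_cong)
      fix i assume i: "i \<in> {0<..<n + 1}"
      then have "rev c ! (i - 1) = c ! (n + 1 - i - 1)" using len by (subst rev_nth) auto
      then show "site_config (rev c) i = site_config c (n + 1 - i)" using i len by (auto simp: site_config_def)
    qed
    also have "\<dots> = ?w c" by (rule chip_weight_reflect) auto
    finally show ?thesis unfolding mixed_eulerian_eq[OF c] mixed_eulerian_eq[OF r] by simp
  qed
  have two_sites: "mixed_eulerian (replicate (k - 1) 0 @ [n - i, i] @ replicate (n - k - 1) 0) = real (refined_eulerian n k i)"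
    if k: "k \<in> {1..n - 1}" and i: "i \<in> {0..n}" for k i
  proof -
    let ?c = "replicate (k - 1) 0 @ [n - i, i] @ replicate (n - k - 1) 0"
    have c: "?c \<in> ?W" using k i by (auto simp: weak_compositions_def sum_list_replicate)
    have "?w ?c = chip_weight 0 (n + 1) (two_sites n k i)"
    proof (rule chip_weight_cong)
      fix x assume x: "x \<in> {0<..<n + 1}"
      consider "x < k" | "x = k" | "x = Suc k" | "Suc k < x" by linarith
      then show "site_config ?c x = two_sites n k i x"
        using x k by cases (auto simp: site_config_def two_sites_def nth_append nth_Cons')
    qed
    then have "mixed_eulerian ?c = two_site_number n k i"
      unfolding mixed_eulerian_eq[OF c] two_site_number_def by simp
    also have "\<dots> = real (refined_eulerian n k i)"
      by (rule two_site_number_eq_refined_eulerian) (use k i in auto)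
    finally show ?thesis .
  qed
  have one_site: "mixed_eulerian (replicate (k - 1) 0 @ [n] @ replicate (n - k) 0) = real (eulerian n k)"
    if k: "k \<in> {1..n}" for k
  proof -
    let ?c = "replicate (k - 1) 0 @ [n] @ replicate (n - k) 0"
    have c: "?c \<in> ?W" using k by (auto simp: weak_compositions_def sum_list_replicate)
    \<comment> \<open>A single occupied site is the case \<open>i = 0\<close> of two adjacent ones;
      for \<open>k = n\<close> the second site is the boundary \<open>n + 1\<close>.\<close>
    have "?w ?c = chip_weight 0 (n + 1) (two_sites n k 0)"
    proof (rule chip_weight_cong)
      fix x assume x: "x \<in> {0<..<n + 1}"
      consider "x < k" | "x = k" | "k < x" by linarith
      then show "site_config ?c x = two_sites n k 0 x"
        using x k by cases (auto simp: site_config_def two_sites_def nth_append nth_Cons')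
    qed
    then have "mixed_eulerian ?c = two_site_number n k 0"
      unfolding mixed_eulerian_eq[OF c] two_site_number_def by simp
    also have "\<dots> = real (refined_eulerian n k 0)"
      by (rule two_site_number_eq_refined_eulerian) (use k in auto)
    finally show ?thesis using refined_eulerian_0[OF assms] by simp
  qed
  \<comment> \<open>Both sums over all compositions have this form, with products of inverse
    factorials or the constant 1 as the weight that rotation preserves.\<close>
  have weighted: "(\<Sum>c\<in>?W. weight (0 # c) * mixed_eulerian c) =
      fact n * (\<Sum>xs\<in>lists_with_sum (n + 1) n. weight xs) / real (n + 1)"
    if "\<And>xs. weight (rotate1 xs) = weight xs" for weight :: "nat list \<Rightarrow> real"
  proof -
    have "(\<Sum>c\<in>?W. weight (0 # c) * mixed_eulerian c) = fact (n + 1) * (\<Sum>c\<in>?W. weight (0 # c) * ?w c)"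
      unfolding sum_distrib_left by (rule sum.cong) (auto simp: mixed_eulerian_eq simp del: fact_Suc)
    also have "\<dots> = fact (n + 1) * ((\<Sum>xs\<in>lists_with_sum (n + 1) n. weight xs) / real (n + 1) ^ 2)"
      unfolding sum_weighted_chip_weight[of n weight, OF assms that] ..
    also have "(fact (n + 1) :: real) = real (n + 1) * fact n" by simp
    finally show ?thesis by (simp add: power2_eq_square)
  qed
  have factorial_sum: "(\<Sum>c\<in>?W. 1 / (\<Prod>i=1..n. fact (c ! (i - 1))) * mixed_eulerian c) = (real n + 1) ^ (n - 1)"
  proof -
    let ?f = "\<lambda>xs :: nat list. prod_list (map (\<lambda>x. 1 / fact x) xs) :: real"
    have "?f (0 # c) = 1 / (\<Prod>i=1..n. fact (c ! (i - 1)))" if c: "c \<in> ?W" for c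
    proof -
      have I: "{1..n} = Suc ` {0..<n}" by (simp add: image_Suc_atLeastLessThan atLeastLessThanSuc_atLeastAtMost)
      have "?f (0 # c) = (\<Prod>i\<in>{0..<n}. 1 / fact (c ! i))"
        using c prod.list_conv_set_nth[of "map (\<lambda>x. 1 / fact x :: real) c"] by (simp add: weak_compositions_def)
      also have "\<dots> = 1 / (\<Prod>i=1..n. fact (c ! (i - 1)))"
        unfolding I by (simp only: prod.reindex[OF inj_Suc, unfolded o_def]) (simp add: prod_dividef)
      finally show ?thesis .
    qed
    then have "(\<Sum>c\<in>?W. 1 / (\<Prod>i=1..n. fact (c ! (i - 1))) * mixed_eulerian c) = (\<Sum>c\<in>?W. ?f (0 # c) * mixed_eulerian c)"
      by (intro sum.cong) auto
    also have "\<dots> = fact n * (real (n + 1) ^ n / fact n) / real (n + 1)"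
    proof (subst weighted)
      show "?f (rotate1 xs) = ?f xs" for xs by (cases xs) auto
    qed (simp only: sum_inverse_factorials)
    also have "\<dots> = (real n + 1) ^ (n - 1)" using assms by (cases n) auto
    finally show ?thesis .
  qed
  have total: "(\<Sum>c\<in>?W. mixed_eulerian c) = fact n * catalan n"
    using weighted[of "\<lambda>_. 1"] card_lists_with_sum[of n] by (simp add: catalan_def add.commute)
  have ballot: "mixed_eulerian c = (\<Prod>i=1..n. real i ^ (c ! (i - 1)))"
    if c: "c \<in> ?W" and le: "\<forall>i\<in>{1..n - 1}. (\<Sum>j=1..i. c ! (j - 1)) \<ge> i" for c
  proof -
    have len: "length c = n" using c by (simp add: weak_compositions_def)
    have "sum (site_config c) {0<..i} = (\<Sum>j=1..i. c ! (j - 1))" if "i \<le> n" for i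
      by (rule sum.cong) (use that len in \<open>auto simp: site_config_def\<close>)
    moreover have "{0<..<n + 1} = {0<..n}" by auto
    ultimately have prefix: "i \<le> sum (site_config c) {0<..i}" if "i \<in> {0<..<n + 1}" for i
      using that le sum_c[OF c] by (cases "i = n") auto
    have "?w c = (\<Prod>i\<in>{0<..<n + 1}. real i ^ site_config c i) / fact (n + 1)"
      by (rule chip_weight_parking) (use prefix sum_c[OF c] in auto)
    also have "(\<Prod>i\<in>{0<..<n + 1}. real i ^ site_config c i) = (\<Prod>i=1..n. real i ^ (c ! (i - 1)))"
      by (rule prod.cong) (use len in \<open>auto simp: site_config_def\<close>)
    finally show ?thesis unfolding mixed_eulerian_eq[OF c] by (simp del: fact_Suc)
  qed
  have ones: "mixed_eulerian (replicate n 1) = fact n"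
  proof -
    have "mixed_eulerian (replicate n 1) = (\<Prod>i=1..n. real i ^ (replicate n 1 ! (i - 1)))"
    proof (rule ballot)
      show "\<forall>i\<in>{1..n - 1}. (\<Sum>j=1..i. replicate n 1 ! (j - 1)) \<ge> i"
      proof
        fix i assume "i \<in> {1..n - 1}"
        then have ones: "(\<Sum>j=1..i. replicate n 1 ! (j - 1)) = (\<Sum>j=1..i. 1 :: nat)" by (intro sum.cong) auto
        show "(\<Sum>j=1..i. replicate n 1 ! (j - 1)) \<ge> i" unfolding ones by simp
      qed
    qed (simp add: weak_compositions_def sum_list_replicate)
    also have "\<dots> = (\<Prod>i=1..n. real i)" by (rule prod.cong) auto
    finally show ?thesis by (simp add: fact_prod)
  qed
  have binomial: "mixed_eulerian ([k] @ replicate (n - 2) 0 @ [n - k]) = real (n choose k)"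
    if n: "2 \<le> n" and k: "k \<in> {0..n}" for k
  proof -
    let ?c = "[k] @ replicate (n - 2) 0 @ [n - k]"
    have c: "?c \<in> ?W" using n k by (auto simp: weak_compositions_def sum_list_replicate)
    have "?w ?c = chip_weight 0 (n + 1) (\<lambda>i. if i = 1 then k else if i = n then n - k else 0)"
    proof (rule chip_weight_cong)
      fix x assume x: "x \<in> {0<..<n + 1}"
      consider "x = 1" | "x = n" | "x \<noteq> 1" "x \<noteq> n" by blast
      then show "site_config ?c x = (if x = 1 then k else if x = n then n - k else 0)"
        using x n by cases (auto simp: site_config_def nth_append nth_Cons')
    qed
    then show ?thesis
      unfolding mixed_eulerian_eq[OF c] using chip_weight_first_last[OF n, of k] k by simp
  qed
  show ?thesis
    using positive_integer symmetric one_site factorial_sum total two_sites[unfolded refined_eulerian_def]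
      ones binomial ballot card_ballot_compositions[of n] by blast
qed

end
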